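(* Let $\mathbb{F}$ be a field of characteristic $0$ and let $\mathcal{W}(-1)$ be the Lie conformal algebra that is the free $\mathbb{F}[\partial]$-module on $L,H$ with $[L_\lambda L]=(\partial+2\lambda)L$, $[L_\lambda H]=(\partial+2\lambda)H$, $[H_\lambda L]=(\partial+2\lambda)H$, $[H_\lambda H]=0$. Then the basic and reduced cohomology of $\mathcal{W}(-1)$ with coefficients in its adjoint module satisfy, for $q\ge 0$, $$\dim\widetilde{\mathrm{H}}^q(\mathcal{W}(-1),\mathcal{W}(-1))=\begin{cases}1,& q=2,4,\\ 2,& q=3,\\ 0,&\text{otherwise,}\end{cases}\qquad \dim\mathrm{H}^q(\mathcal{W}(-1),\mathcal{W}(-1))=\begin{cases}1,& q=1,4,\\ 3,& q=2,3,\\ 0,&\text{otherwise.}\end{cases}$$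
   Context: Lie conformal algebra (LCA): an $\mathbb{F}[\partial]$-module $\mathcal{A}$ with an $\mathbb{F}$-bilinear $\lambda$-bracket $\mathcal{A}\otimes\mathcal{A}\to\mathcal{A}[\lambda]$, $a\otimes b\mapsto[a_\lambda b]$, such that $[\partial a_\lambda b]=-\lambda[a_\lambda b]$, $[a_\lambda\partial b]=(\partial+\lambda)[a_\lambda b]$, $[a_\lambda b]=-[b_{-\lambda-\partial}a]$, and $[a_\lambda[b_\mu c]]=[[a_\lambda b]_{\lambda+\mu}c]+[b_\mu[a_\lambda c]]$. The $\lambda$-bracket on $\mathbb{F}[\partial]$-generators determines it everywhere. An $\mathcal{A}$-module is an $\mathbb{F}[\partial]$-module $M$ with an $\mathbb{F}$-bilinear $\lambda$-action $a\otimes m\mapsto a_\lambda m\in M[\lambda]$ such that $(\partial a)_\lambda m=-\lambda a_\lambda m$, $a_\lambda(\partial m)=(\partial+\lambda)a_\lambda m$, $a_\lambda(b_\mu m)-b_\mu(a_\lambda m)=[a_\lambda b]_{\lambda+\mu}m$. The adjoint module is $M=\mathcal{A}$ with $a_\lambda m=[a_\lambda m]$. Write $\partial^M$ for the action of $\partial$ on $M$. Basic complex: for $q\ge 1$, $\widetilde{C}^q(\mathcal{A},M)$ is the space of $\mathbb{F}$-linear maps $f:\mathcal{A}^{\otimes q}\to M[\lambda_1,\dots,\lambda_q]$, $a_1\otimes\cdots\otimes a_q\mapsto f_{\lambda_1,\dots,\lambda_q}(a_1,\dots,a_q)$, with $f_{\lambda_1,\dots,\lambda_q}(a_1,\dots,\partial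 a_i,\dots,a_q)=-\lambda_i f_{\lambda_1,\dots,\lambda_q}(a_1,\dots,a_q)$ for all $i$, and skew-symmetric under simultaneous permutations of the $a_i$ and the $\lambda_i$. Also $\widetilde{C}^0(\mathcal{A},M)=M$. The differential is $$(\mathbf{d}f)_{\lambda_1,\dots,\lambda_{q+1}}(a_1,\dots,a_{q+1})=\sum_{k}(-1)^{k+1}a_{k\,\lambda_k}f_{\lambda_1,\dots,\hat\lambda_k,\dots,\lambda_{q+1}}(a_1,\dots,\hat a_k,\dots,a_{q+1})+\sum_{k<l}(-1)^{k+l}f_{\lambda_k+\lambda_l,\lambda_1,\dots,\hat\lambda_k,\dots,\hat\lambda_l,\dots,\lambda_{q+1}}([a_{k\,\lambda_k}a_l],a_1,\dots,\hat a_k,\dots,\hat a_l,\dots,a_{q+1}),$$ with $(\mathbf{d}m)_\lambda(a)=a_\lambda m$ for $m\in M$; hats denote omission, and polynomial coefficients in the $\lambda$'s are extended linearly. One has $\mathbf{d}^2=0$. Define $(\partial f)_{\lambda_1,\dots,\lambda_q}(a_1,\dots,a_q)=(\partial^M+\sum_{k=1}^q\lambda_k)f_{\lambda_1,\dots,\lambda_q}(a_1,\dots,a_q)$; then $\mathbf{d}\partial=\partial\mathbf{d}$. The reduced complex is $C^\bullet(\mathcal{A},M)=\widetilde{C}^\bullet(\mathcal{A},M)/\partial\widetilde{C}^\bullet(\mathcal{A},M)$. The basic cohomology $\widetilde{\mathrm{H}}^\bullet(\mathcal{A},M)$ is the cohomology of $\widetilde{C}^\bullet(\mathcal{A},M)$;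 the reduced cohomology $\mathrm{H}^\bullet(\mathcal{A},M)$ is the cohomology of $C^\bullet(\mathcal{A},M)$. Dimensions are over $\mathbb{F}$. *)

theory Defs
  imports
    "HOL-Library.Poly_Mapping"
    "HOL-Library.Product_Plus"
    "HOL-Computational_Algebra.Polynomial"
    "HOL-Combinatorics.Permutations"
begin

section \<open>Vector spaces with an explicit carrier, quotients, dimension, cohomology\<close>

record ('f, 'v) vspace =
  vcarrier :: "'v set"
  vadd :: "'v \<Rightarrow> 'v \<Rightarrow> 'v"
  vzero :: "'v"
  vscale :: "'f \<Rightarrow> 'v \<Rightarrow> 'v"

definition vcoset :: "('f, 'v) vspace \<Rightarrow> 'v set \<Rightarrow> 'v \<Rightarrow> 'v set" where
  "vcoset V U v = vadd V v ` U"

text \<open>The operations of the quotient are written on all representatives at once.  In the scalar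
  multiplication \<open>U\<close> is added afterwards because \<open>0 (v + U)\<close> has to be \<open>U\<close> and not \<open>{0}\<close>.\<close>

definition vquot :: "('f, 'v) vspace \<Rightarrow> 'v set \<Rightarrow> ('f, 'v set) vspace" where
  "vquot V U =
    \<lparr>vcarrier = vcoset V U ` vcarrier V,
     vadd = (\<lambda>X Y. {vadd V x y | x y. x \<in> X \<and> y \<in> Y}),
     vzero = U,
     vscale = (\<lambda>c X. {vadd V (vscale V c x) u | x u. x \<in> X \<and> u \<in> U})\<rparr>"

definition lincomb :: "('f, 'v) vspace \<Rightarrow> 'f list \<Rightarrow> 'v list \<Rightarrow> 'v" where
  "lincomb V cs bs = foldr (\<lambda>(c, b). vadd V (vscale V c b)) (zip cs bs) (vzero V)"

text \<open>\<open>has_dim V n\<close>: there is a basis with \<open>n\<close> elements.  In particular \<open>V\<close> is finite-dimensional,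
  and \<open>has_dim V 0\<close> says that \<open>V\<close> is zero.\<close>

definition has_dim :: "('f, 'v) vspace \<Rightarrow> nat \<Rightarrow> bool" where
  "has_dim V n \<longleftrightarrow>
    (\<exists>bs. length bs = n \<and> set bs \<subseteq> vcarrier V \<and>
      (\<forall>v\<in>vcarrier V. \<exists>!cs. length cs = n \<and> lincomb V cs bs = v))"

definition cocycles :: "(nat \<Rightarrow> ('f, 'v) vspace) \<Rightarrow> (nat \<Rightarrow> 'v \<Rightarrow> 'v) \<Rightarrow> nat \<Rightarrow> 'v set" where
  "cocycles C d q = {x \<in> vcarrier (C q). d q x = vzero (C (Suc q))}"

definition coboundaries :: "(nat \<Rightarrow> ('f, 'v) vspace) \<Rightarrow> (nat \<Rightarrow> 'v \<Rightarrow> 'v) \<Rightarrow> nat \<Rightarrow> 'v set" where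
  "coboundaries C d q =
    (case q of 0 \<Rightarrow> {vzero (C 0)} | Suc p \<Rightarrow> d p ` vcarrier (C p))"

definition cohomology ::
    "(nat \<Rightarrow> ('f, 'v) vspace) \<Rightarrow> (nat \<Rightarrow> 'v \<Rightarrow> 'v) \<Rightarrow> nat \<Rightarrow> ('f, 'v set) vspace" where
  "cohomology C d q = vquot ((C q)\<lparr>vcarrier := cocycles C d q\<rparr>) (coboundaries C d q)"


section \<open>Polynomials with coefficients in a module\<close>

text \<open>\<open>'m mpol\<close> is \<open>M[\<lambda>\<^sub>0, \<lambda>\<^sub>1, \<dots>]\<close>: a finitely supported function from exponents to coefficients.
  Variables are numbered from \<open>0\<close>.\<close>

type_synonym 'm mpol = "(nat \<Rightarrow>\<^sub>0 nat) \<Rightarrow>\<^sub>0 'm"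

definition lam :: "nat \<Rightarrow> 'f::field mpol" where
  "lam i = Poly_Mapping.single (Poly_Mapping.single i 1) 1"

definition const :: "'m::zero \<Rightarrow> 'm mpol" where
  "const m = Poly_Mapping.single 0 m"

text \<open>The action of \<open>F[\<lambda>\<^sub>0, \<lambda>\<^sub>1, \<dots>]\<close> on \<open>M[\<lambda>\<^sub>0, \<lambda>\<^sub>1, \<dots>]\<close>, where \<open>sc\<close> is the action of \<open>F\<close> on \<open>M\<close>.\<close>

definition pscale :: "('f::field \<Rightarrow> 'm \<Rightarrow> 'm) \<Rightarrow> 'f mpol \<Rightarrow> 'm::ab_group_add mpol \<Rightarrow> 'm mpol" where
  "pscale sc s p =
    (\<Sum>d\<in>Poly_Mapping.keys s. \<Sum>e\<in>Poly_Mapping.keys p.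
      Poly_Mapping.single (d + e) (sc (Poly_Mapping.lookup s d) (Poly_Mapping.lookup p e)))"

text \<open>\<open>psubst1 sc \<ell> p\<close> is \<open>p(\<ell>)\<close> for \<open>p(\<lambda>) \<in> M[\<lambda>]\<close>, and \<open>psubst sc ls p\<close> is
  \<open>p(ls ! 0, ls ! 1, \<dots>)\<close> for \<open>p \<in> M[\<lambda>\<^sub>0, \<lambda>\<^sub>1, \<dots>]\<close> in at most \<open>length ls\<close> variables.\<close>

definition psubst1 :: "('f::field \<Rightarrow> 'm \<Rightarrow> 'm) \<Rightarrow> 'f mpol \<Rightarrow> 'm::ab_group_add poly \<Rightarrow> 'm mpol" where
  "psubst1 sc l p = (\<Sum>i\<le>degree p. pscale sc (l ^ i) (const (coeff p i)))"

definition psubst :: "('f::field \<Rightarrow> 'm \<Rightarrow> 'm) \<Rightarrow> 'f mpol list \<Rightarrow> 'm::ab_group_add mpol \<Rightarrow> 'm mpol" where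
  "psubst sc ls p =
    (\<Sum>e\<in>Poly_Mapping.keys p.
      pscale sc (\<Prod>i\<in>Poly_Mapping.keys e. (ls ! i) ^ Poly_Mapping.lookup e i)
        (const (Poly_Mapping.lookup p e)))"


section \<open>Lie conformal algebras and their modules\<close>

text \<open>An \<open>F[\<partial>]\<close>-module is a vector space (\<open>lscale\<close>) with a linear endomorphism (\<open>lder\<close>, i.e. \<open>\<partial>\<close>).
  The value \<open>lbr A a b\<close> is \<open>[a\<^sub>\<lambda> b]\<close>, a polynomial in \<open>\<lambda>\<close>.\<close>

record (overloaded) ('f, 'a) lca =
  lscale :: "'f \<Rightarrow> 'a \<Rightarrow> 'a"
  lder :: "'a \<Rightarrow> 'a"
  lbr :: "'a \<Rightarrow> 'a \<Rightarrow> 'a poly"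

record (overloaded) ('f, 'a, 'm) cmod =
  mscale :: "'f \<Rightarrow> 'm \<Rightarrow> 'm"
  mder :: "'m \<Rightarrow> 'm"
  mact :: "'a \<Rightarrow> 'm \<Rightarrow> 'm poly"

text \<open>\<open>a\<^sub>\<ell> p\<close> for \<open>p \<in> M[\<lambda>\<^sub>0, \<lambda>\<^sub>1, \<dots>]\<close>: the action is extended linearly in the coefficients.\<close>

definition act_at ::
    "('f::field, 'a, 'm::ab_group_add) cmod \<Rightarrow> 'f mpol \<Rightarrow> 'a \<Rightarrow> 'm mpol \<Rightarrow> 'm mpol" where
  "act_at M l a p =
    (\<Sum>e\<in>Poly_Mapping.keys p.
      pscale (mscale M) (Poly_Mapping.single e 1)
        (psubst1 (mscale M) l (mact M a (Poly_Mapping.lookup p e))))"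

text \<open>\<open>[a\<^sub>k b]\<^sub>\<ell> m\<close>.\<close>

definition br_act_at ::
    "('f::field, 'a::zero) lca \<Rightarrow> ('f, 'a, 'm::ab_group_add) cmod
      \<Rightarrow> 'f mpol \<Rightarrow> 'f mpol \<Rightarrow> 'a \<Rightarrow> 'a \<Rightarrow> 'm \<Rightarrow> 'm mpol" where
  "br_act_at A M k l a b m =
    (\<Sum>i\<le>degree (lbr A a b).
      pscale (mscale M) (k ^ i) (psubst1 (mscale M) l (mact M (coeff (lbr A a b) i) m)))"

definition adjoint :: "('f, 'a) lca \<Rightarrow> ('f, 'a, 'a) cmod" where
  "adjoint A = \<lparr>mscale = lscale A, mder = lder A, mact = lbr A\<rparr>"

text \<open>\<open>p(-\<lambda>-\<partial>)\<close> for \<open>p(\<lambda>) \<in> A[\<lambda>]\<close>, with \<open>\<partial>\<close> acting on the coefficients of \<open>p\<close>.\<close>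

definition pflip :: "('a::ab_group_add \<Rightarrow> 'a) \<Rightarrow> 'a poly \<Rightarrow> 'a poly" where
  "pflip D p = (\<Sum>i\<le>degree p. ((\<lambda>r. - pCons 0 r - map_poly D r) ^^ i) [:coeff p i:])"

locale sesquilinear_bracket =
  fixes A :: "('f::field, 'a::ab_group_add) lca"
  assumes vector_space: "vector_space (lscale A)"
    and der_linear: "Vector_Spaces.linear (lscale A) (lscale A) (lder A)"
    and br_add_left: "lbr A (a + b) c = lbr A a c + lbr A b c"
    and br_add_right: "lbr A a (b + c) = lbr A a b + lbr A a c"
    and br_scale_left: "lbr A (lscale A r a) b = map_poly (lscale A r) (lbr A a b)"
    and br_scale_right: "lbr A a (lscale A r b) = map_poly (lscale A r) (lbr A a b)"
    and br_der_left: "lbr A (lder A a) b = - pCons 0 (lbr A a b)"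
    and br_der_right: "lbr A a (lder A b) = map_poly (lder A) (lbr A a b) + pCons 0 (lbr A a b)"

locale lie_conformal_algebra = sesquilinear_bracket A
  for A :: "('f::field, 'a::ab_group_add) lca" +
  assumes skew: "lbr A a b = - pflip (lder A) (lbr A b a)"
    and jacobi:
      "act_at (adjoint A) (lam 0) a (psubst1 (lscale A) (lam 1) (lbr A b c)) =
        br_act_at A (adjoint A) (lam 0) (lam 0 + lam 1) a b c +
        act_at (adjoint A) (lam 1) b (psubst1 (lscale A) (lam 0) (lbr A a c))"

locale conformal_module = lie_conformal_algebra A
  for A :: "('f::field, 'a::ab_group_add) lca" +
  fixes M :: "('f, 'a, 'm::ab_group_add) cmod"
  assumes mod_vector_space: "vector_space (mscale M)"
    and mod_der_linear: "Vector_Spaces.linear (mscale M) (mscale M) (mder M)"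
    and act_add_left: "mact M (a + b) m = mact M a m + mact M b m"
    and act_add_right: "mact M a (m + n) = mact M a m + mact M a n"
    and act_scale_left: "mact M (lscale A r a) m = map_poly (mscale M r) (mact M a m)"
    and act_scale_right: "mact M a (mscale M r m) = map_poly (mscale M r) (mact M a m)"
    and act_der_left: "mact M (lder A a) m = - pCons 0 (mact M a m)"
    and act_der_right: "mact M a (mder M m) = map_poly (mder M) (mact M a m) + pCons 0 (mact M a m)"
    and act_bracket:
      "act_at M (lam 0) a (psubst1 (mscale M) (lam 1) (mact M b m)) -
       act_at M (lam 1) b (psubst1 (mscale M) (lam 0) (mact M a m)) =
       br_act_at A M (lam 0) (lam 0 + lam 1) a b m"


section \<open>The basic and the reduced complex\<close>

text \<open>A \<open>q\<close>-cochain is a function of lists of length \<open>q\<close>, extended by \<open>0\<close> to all other lists; linear maps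
  on the tensor power are multilinear functions.  For \<open>q = 0\<close> this is a value on the empty list
  in \<open>M\<close>, so that the space of \<open>0\<close>-cochains is \<open>M\<close>.\<close>

type_synonym ('a, 'm) cochain = "'a list \<Rightarrow> 'm mpol"

definition basic_cochains ::
    "('f::field, 'a::ab_group_add) lca \<Rightarrow> ('f, 'a, 'm::ab_group_add) cmod \<Rightarrow> nat
      \<Rightarrow> ('a, 'm) cochain set" where
  "basic_cochains A M q = {f.
    (\<forall>as. length as \<noteq> q \<longrightarrow> f as = 0) \<and>
    (\<forall>as. \<forall>e\<in>Poly_Mapping.keys (f as). Poly_Mapping.keys e \<subseteq> {..<q}) \<and>
    (\<forall>as i a b. length as = q \<and> i < q \<longrightarrow> f (as[i := a + b]) = f (as[i := a]) + f (as[i := b])) \<and>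
    (\<forall>as i r a. length as = q \<and> i < q \<longrightarrow>
      f (as[i := lscale A r a]) = pscale (mscale M) (const r) (f (as[i := a]))) \<and>
    (\<forall>as i. length as = q \<and> i < q \<longrightarrow>
      f (as[i := lder A (as ! i)]) = pscale (mscale M) (- lam i) (f as)) \<and>
    (\<forall>as \<pi>. length as = q \<and> \<pi> permutes {..<q} \<longrightarrow>
      psubst (mscale M) (permute_list \<pi> (map lam [0..<q])) (f (permute_list \<pi> as)) =
      pscale (mscale M) (const (of_int (sign \<pi>))) (f as))}"

definition basic_space ::
    "('f::field, 'a::ab_group_add) lca \<Rightarrow> ('f, 'a, 'm::ab_group_add) cmod \<Rightarrow> nat
      \<Rightarrow> ('f, ('a, 'm) cochain) vspace" where
  "basic_space A M q =
    \<lparr>vcarrier = basic_cochains A M q,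
     vadd = (\<lambda>f g as. f as + g as),
     vzero = (\<lambda>as. 0),
     vscale = (\<lambda>r f as. pscale (mscale M) (const r) (f as))\<rparr>"

text \<open>\<open>omit I xs\<close> leaves out the entries of \<open>xs\<close> at the positions in \<open>I\<close>.  Positions count from \<open>0\<close>;
  with respect to counting from \<open>1\<close>, the sign \<open>(-1)\<^bsup>k+1\<^esup>\<close> of the first sum becomes \<open>(-1)\<^bsup>k\<^esup>\<close>, and
  that of the second sum does not change.\<close>

definition omit :: "nat set \<Rightarrow> 'x list \<Rightarrow> 'x list" where
  "omit I xs = nths xs (- I)"

definition diff ::
    "('f::field, 'a::ab_group_add) lca \<Rightarrow> ('f, 'a, 'm::ab_group_add) cmod
      \<Rightarrow> ('a, 'm) cochain \<Rightarrow> ('a, 'm) cochain" where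
  "diff A M f as =
    (let n = length as; ls = map lam [0..<n] in
      (\<Sum>k<n. pscale (mscale M) ((-1) ^ k)
        (act_at M (lam k) (as ! k) (psubst (mscale M) (omit {k} ls) (f (omit {k} as))))) +
      (\<Sum>l<n. \<Sum>k<l. pscale (mscale M) ((-1) ^ (k + l))
        (\<Sum>i\<le>degree (lbr A (as ! k) (as ! l)). pscale (mscale M) (lam k ^ i)
          (psubst (mscale M) ((lam k + lam l) # omit {k, l} ls)
            (f (coeff (lbr A (as ! k) (as ! l)) i # omit {k, l} as))))))"

definition basic_cohomology ::
    "('f::field, 'a::ab_group_add) lca \<Rightarrow> ('f, 'a, 'm::ab_group_add) cmod \<Rightarrow> nat
      \<Rightarrow> ('f, ('a, 'm) cochain set) vspace" where
  "basic_cohomology A M = cohomology (basic_space A M) (\<lambda>q. diff A M)"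

definition cochain_der ::
    "('f::field, 'a, 'm::ab_group_add) cmod \<Rightarrow> ('a, 'm) cochain \<Rightarrow> ('a, 'm) cochain" where
  "cochain_der M f as =
    Poly_Mapping.map (mder M) (f as) + pscale (mscale M) (\<Sum>k<length as. lam k) (f as)"

definition reduced_space ::
    "('f::field, 'a::ab_group_add) lca \<Rightarrow> ('f, 'a, 'm::ab_group_add) cmod \<Rightarrow> nat
      \<Rightarrow> ('f, ('a, 'm) cochain set) vspace" where
  "reduced_space A M q = vquot (basic_space A M q) (cochain_der M ` basic_cochains A M q)"

text \<open>The induced differential maps the class of \<open>f\<close> to the class of \<open>diff f\<close>; the union below is
  over all representatives \<open>f\<close> of the given class.\<close>

definition reduced_diff ::
    "('f::field, 'a::ab_group_add) lca \<Rightarrow> ('f, 'a, 'm::ab_group_add) cmod \<Rightarrow> nat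
      \<Rightarrow> ('a, 'm) cochain set \<Rightarrow> ('a, 'm) cochain set" where
  "reduced_diff A M q X =
    (\<Union>f\<in>X. vcoset (basic_space A M (Suc q)) (cochain_der M ` basic_cochains A M (Suc q)) (diff A M f))"

definition reduced_cohomology ::
    "('f::field, 'a::ab_group_add) lca \<Rightarrow> ('f, 'a, 'm::ab_group_add) cmod \<Rightarrow> nat
      \<Rightarrow> ('f, ('a, 'm) cochain set set) vspace" where
  "reduced_cohomology A M = cohomology (reduced_space A M) (reduced_diff A M)"


section \<open>The Lie conformal algebra \<open>W(-1)\<close>\<close>

text \<open>The free \<open>F[\<partial>]\<close>-module on \<open>L\<close>, \<open>H\<close>: the pair \<open>(p, q)\<close> is \<open>p(\<partial>) L + q(\<partial>) H\<close>.\<close>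

definition gen_L :: "'f::field poly \<times> 'f poly" where "gen_L = (1, 0)"

definition gen_H :: "'f::field poly \<times> 'f poly" where "gen_H = (0, 1)"

text \<open>\<open>F[\<partial>][\<lambda>]\<close> is \<open>'f poly poly\<close> with \<open>\<lambda>\<close> as the outer variable; \<open>in_lam p\<close> is \<open>p(\<lambda>)\<close>.\<close>

definition in_lam :: "'f::field poly \<Rightarrow> 'f poly poly" where
  "in_lam p = map_poly (\<lambda>c. [:c:]) p"

text \<open>\<open>p(-\<lambda>) q(\<partial>+\<lambda>) (\<partial>+2\<lambda>)\<close>, the coefficient of \<open>c\<close> in \<open>[p(\<partial>)a\<^sub>\<lambda> q(\<partial>)b]\<close> if \<open>[a\<^sub>\<lambda> b] = (\<partial>+2\<lambda>)c\<close>.\<close>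

definition sesqui :: "'f::field poly \<Rightarrow> 'f poly \<Rightarrow> 'f poly poly" where
  "sesqui p q = (in_lam p \<circ>\<^sub>p [:0, -1:]) * (in_lam q \<circ>\<^sub>p [:[:0, 1:], 1:]) * [:[:0, 1:], 2:]"

definition W_neg1 :: "('f::field, 'f poly \<times> 'f poly) lca" where
  "W_neg1 =
    \<lparr>lscale = (\<lambda>r (p, q). (smult r p, smult r q)),
     lder = (\<lambda>(p, q). (pCons 0 p, pCons 0 q)),
     lbr = (\<lambda>(p1, p2) (q1, q2).
       map_poly (\<lambda>u. (u, 0)) (sesqui p1 q1) +
       map_poly (\<lambda>u. (0, u)) (sesqui p1 q2 + sesqui p2 q1))\<rparr>"


section \<open>\<open>W(-1)\<close> is a Lie conformal algebra\<close>

text \<open>Skew-symmetry and the Jacobi identity propagate from generators along sums, scalar multiples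
  and \<open>\<partial>\<close>, for any sesquilinear bracket; it remains to check them on \<open>L\<close> and \<open>H\<close>.\<close>

lemma keys_sum_superset:
  assumes "finite S" "Poly_Mapping.keys p \<subseteq> S" "\<And>e. g e 0 = 0"
  shows "(\<Sum>e\<in>Poly_Mapping.keys p. g e (Poly_Mapping.lookup p e)) = (\<Sum>e\<in>S. g e (Poly_Mapping.lookup p e))"
  using assms by (intro sum.mono_neutral_left) (auto simp: in_keys_iff)

lemma keys_sum_add:
  fixes g :: "'k \<Rightarrow> 'b::ab_group_add \<Rightarrow> 'c::ab_group_add"
  assumes g: "\<And>e x y. g e (x + y) = g e x + g e y"
  shows "(\<Sum>e\<in>Poly_Mapping.keys (p + q). g e (Poly_Mapping.lookup (p + q) e)) =
    (\<Sum>e\<in>Poly_Mapping.keys p. g e (Poly_Mapping.lookup p e)) + (\<Sum>e\<in>Poly_Mapping.keys q. g e (Poly_Mapping.lookup q e))"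
proof -
  have g0: "g e 0 = 0" for e using g[of e 0 0] by simp
  let ?S = "Poly_Mapping.keys p \<union> Poly_Mapping.keys q"
  note sup = keys_sum_superset[of ?S _ g, OF _ _ g0]
  have "(\<Sum>e\<in>Poly_Mapping.keys (p + q). g e (Poly_Mapping.lookup (p + q) e)) =
      (\<Sum>e\<in>?S. g e (Poly_Mapping.lookup p e + Poly_Mapping.lookup q e))"
    using sup[of "p + q"] Poly_Mapping.keys_add[of p q] by (simp add: lookup_add)
  then show ?thesis
    using sup[of p] sup[of q] by (simp add: g sum.distrib)
qed

lemma mpol_induct [case_names single add]:
  fixes p :: "'m::ab_group_add mpol"
  assumes "\<And>e m. P (Poly_Mapping.single e m)" "\<And>p q. P p \<Longrightarrow> P q \<Longrightarrow> P (p + q)"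
  shows "P p"
proof -
  have "P (\<Sum>e\<in>S. Poly_Mapping.single e (Poly_Mapping.lookup p e))" if "finite S" for S
    using that
  proof (induction S)
    case empty
    show ?case using assms(1)[of 0 0] by simp
  qed (auto simp: assms)
  moreover have "(\<Sum>e\<in>Poly_Mapping.keys p. Poly_Mapping.single e (Poly_Mapping.lookup p e)) = p"
    by (intro poly_mapping_eqI) (auto simp: lookup_sum lookup_single when_def sum.delta in_keys_iff)
  ultimately show ?thesis by (metis finite_keys)
qed

context
  fixes sc :: "'f::field \<Rightarrow> 'm::ab_group_add \<Rightarrow> 'm"
  assumes vs: "vector_space sc"
begin

interpretation vector_space sc by (rule vs)

lemma pscale_add_right: "pscale sc s (p + q) = pscale sc s p + pscale sc s q"
  unfolding pscale_def
  by (subst keys_sum_add) (auto simp: scale_right_distrib single_add sum.distrib)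

lemma pscale_add_left: "pscale sc (s + t) p = pscale sc s p + pscale sc t p"
  unfolding pscale_def
  by (rule keys_sum_add) (auto simp: scale_left_distrib single_add sum.distrib)

lemma pscale_single:
  "pscale sc (Poly_Mapping.single d r) (Poly_Mapping.single e m) = Poly_Mapping.single (d + e) (sc r m)"
  by (simp add: pscale_def)

lemma pscale_pscale: "pscale sc s (pscale sc t p) = pscale sc (s * t) p"
proof (induction s rule: mpol_induct)
  case s: (single d r)
  show ?case
  proof (induction t rule: mpol_induct)
    case t: (single e u)
    show ?case
      by (induction p rule: mpol_induct)
        (simp_all add: pscale_single pscale_add_right mult_single add.assoc)
  qed (simp_all add: pscale_add_left pscale_add_right distrib_left)
qed (simp_all add: pscale_add_left distrib_right)

lemma pscale_zero_right: "pscale sc s 0 = 0" by (simp add: pscale_def)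
lemma pscale_zero_left: "pscale sc 0 p = 0" by (simp add: pscale_def)
lemma pscale_one: "pscale sc 1 p = p"
  by (induction p rule: mpol_induct) (simp_all add: pscale_add_right pscale_single flip: single_one)

lemma pscale_minus_right: "pscale sc s (- p) = - pscale sc s p"
  using pscale_add_right[of s p "- p"] by (simp add: pscale_zero_right eq_neg_iff_add_eq_0 add.commute)
lemma pscale_minus_left: "pscale sc (- s) p = - pscale sc s p"
  using pscale_add_left[of s "- s" p] by (simp add: pscale_zero_left eq_neg_iff_add_eq_0 add.commute)

lemma pscale_sum_right: "pscale sc s (sum f I) = (\<Sum>i\<in>I. pscale sc s (f i))"
  by (induction I rule: infinite_finite_induct) (simp_all add: pscale_zero_right pscale_add_right)

lemma const_add: "const (m + n) = const m + (const n :: 'm mpol)"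
  by (simp add: const_def single_add)
lemma const_minus: "const (- m) = - (const m :: 'm mpol)"
  by (simp add: const_def single_uminus)
lemma const_diff: "const (m - n) = const m - (const n :: 'm mpol)"
  by (simp add: const_def single_diff)
lemma const_scale: "const (sc r m) = pscale sc (const r) (const m)"
  by (simp add: const_def pscale_single)

lemma psubst1_eq:
  assumes "degree p \<le> n"
  shows "psubst1 sc l p = (\<Sum>i\<le>n. pscale sc (l ^ i) (const (coeff p i)))"
  unfolding psubst1_def using assms
  by (intro sum.mono_neutral_left) (auto simp: coeff_eq_0 const_def pscale_zero_right)

lemma psubst1_add: "psubst1 sc l (p + q) = psubst1 sc l p + psubst1 sc l q"
proof -
  let ?n = "max (degree p) (degree q)"
  show ?thesis
    using degree_add_le_max[of p q]
    by (simp add: psubst1_eq[of _ ?n] const_add pscale_add_right sum.distrib)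
qed

lemma psubst1_pCons: "psubst1 sc l (pCons c p) = const c + pscale sc l (psubst1 sc l p)"
proof -
  have "psubst1 sc l (pCons c p) = (\<Sum>i\<le>Suc (degree p). pscale sc (l ^ i) (const (coeff (pCons c p) i)))"
    by (rule psubst1_eq) (rule degree_pCons_le)
  also have "\<dots> = const c + (\<Sum>i\<le>degree p. pscale sc (l ^ Suc i) (const (coeff p i)))"
    by (subst sum.atMost_Suc_shift) (simp add: pscale_one)
  finally show ?thesis by (simp add: psubst1_def pscale_sum_right pscale_pscale)
qed

lemma psubst1_zero: "psubst1 sc l 0 = 0" by (simp add: psubst1_def const_def pscale_zero_right)

lemma psubst1_minus: "psubst1 sc l (- p) = - psubst1 sc l p"
  using psubst1_add[of l p "- p"] by (simp add: psubst1_zero eq_neg_iff_add_eq_0 add.commute)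

lemma psubst1_scale: "psubst1 sc l (map_poly (sc r) p) = pscale sc (const r) (psubst1 sc l p)"
  by (induction p)
    (simp_all add: psubst1_zero pscale_zero_right map_poly_pCons psubst1_pCons pscale_add_right const_scale
      pscale_pscale mult.commute)

end

lemma (in lie_conformal_algebra) adjoint_module: "conformal_module A (adjoint A)"
proof (intro conformal_module.intro conformal_module_axioms.intro)
  show "lie_conformal_algebra A" by unfold_locales
qed (simp_all add: adjoint_def[of A] br_add_left br_add_right br_scale_left br_scale_right br_der_left
  br_der_right vector_space der_linear jacobi[unfolded adjoint_def[of A]] flip: One_nat_def)

context sesquilinear_bracket
begin

abbreviation "sc \<equiv> lscale A"
abbreviation "D \<equiv> lder A"
abbreviation "br \<equiv> lbr A"

lemmas pscale_simps =
  pscale_add_right[OF vector_space] pscale_add_left[OF vector_space] pscale_pscale[OF vector_space]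
  pscale_zero_right[OF vector_space] pscale_zero_left[OF vector_space] pscale_one[OF vector_space]
  pscale_minus_right[OF vector_space] pscale_minus_left[OF vector_space]

lemmas psubst1_simps =
  psubst1_add[OF vector_space] psubst1_pCons[OF vector_space] psubst1_zero[OF vector_space]
  psubst1_minus[OF vector_space] psubst1_scale[OF vector_space]

lemma D_add [simp]: "D (x + y) = D x + D y" and D_scale: "D (sc r x) = sc r (D x)"
  using der_linear by (auto simp: Vector_Spaces.linear_iff)

lemma D_zero [simp]: "D 0 = 0"
  using D_add[of 0 0] by simp

lemma D_minus: "D (- x) = - D x"
  using D_add[of x "- x"] by (simp add: eq_neg_iff_add_eq_0 add.commute)

lemma D_diff: "D (x - y) = D x - D y"
  using D_add[of x "- y"] by (simp add: D_minus)

lemma br_zero [simp]: "br 0 c = 0" "br c 0 = 0"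
  using br_add_left[of 0 0] br_add_right[of _ 0 0] by auto

lemma map_D_add: "Poly_Mapping.map D (p + q) = Poly_Mapping.map D p + Poly_Mapping.map D q"
  by (intro poly_mapping_eqI) (auto simp: Poly_Mapping.map.rep_eq lookup_add when_def simp flip: D_add)

lemma map_D_zero [simp]: "Poly_Mapping.map D 0 = 0"
  by (intro poly_mapping_eqI) (simp add: Poly_Mapping.map.rep_eq)

lemma map_D_single: "Poly_Mapping.map D (Poly_Mapping.single e m) = Poly_Mapping.single e (D m)"
  by simp

lemma map_D_pscale: "Poly_Mapping.map D (pscale sc s p) = pscale sc s (Poly_Mapping.map D p)"
proof (induction s rule: mpol_induct)
  case (single d r)
  show ?case
    by (induction p rule: mpol_induct)
      (simp_all add: pscale_simps map_D_add pscale_single[OF vector_space] D_scale)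
qed (simp_all add: pscale_simps map_D_add)

lemma map_poly_D_pCons: "map_poly D (pCons c p) = pCons (D c) (map_poly D p)"
  by (rule map_poly_pCons) simp

lemma psubst1_map_D: "psubst1 sc l (map_poly D p) = Poly_Mapping.map D (psubst1 sc l p)"
  by (induction p)
    (simp_all add: psubst1_simps map_poly_D_pCons map_D_add map_D_pscale const_def)

abbreviation "ac l a p \<equiv> act_at (adjoint A) l a p"

lemma ac_def: "ac l a p = (\<Sum>e\<in>Poly_Mapping.keys p.
      pscale sc (Poly_Mapping.single e 1) (psubst1 sc l (br a (Poly_Mapping.lookup p e))))"
  by (simp add: act_at_def adjoint_def)

lemma ac_add_right: "ac l a (p + q) = ac l a p + ac l a q"
  unfolding ac_def by (rule keys_sum_add) (simp add: br_add_right psubst1_simps pscale_simps)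

lemma ac_single: "ac l a (Poly_Mapping.single e m) = pscale sc (Poly_Mapping.single e 1) (psubst1 sc l (br a m))"
  by (simp add: ac_def psubst1_simps pscale_simps)

lemma ac_const: "ac l a (const m) = psubst1 sc l (br a m)"
  by (simp add: const_def ac_single pscale_simps)

lemma ac_zero: "ac l a 0 = 0" by (simp add: ac_def)

lemma ac_minus_right: "ac l a (- p) = - ac l a p"
  using ac_add_right[of l a p "- p"] by (simp add: ac_zero eq_neg_iff_add_eq_0 add.commute)

lemma ac_add_left: "ac l (a + b) p = ac l a p + ac l b p"
  by (induction p rule: mpol_induct) (simp_all add: ac_single ac_add_right br_add_left psubst1_simps pscale_simps)

lemma ac_scale_left: "ac l (sc r a) p = pscale sc (const r) (ac l a p)"
  by (induction p rule: mpol_induct)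
    (simp_all add: ac_single ac_add_right br_scale_left psubst1_simps pscale_simps mult.commute)

lemma ac_pscale: "ac l a (pscale sc s p) = pscale sc s (ac l a p)"
proof (induction s rule: mpol_induct)
  case (single d r)
  show ?case
  proof (induction p rule: mpol_induct)
    case (single e m)
    show ?case
      by (simp add: pscale_single[OF vector_space] ac_single br_scale_right psubst1_simps pscale_simps
        const_def mult_single add.commute)
  qed (simp_all add: pscale_simps ac_add_right)
qed (simp_all add: pscale_simps ac_add_right)

lemma ac_D_left: "ac l (D a) p = - pscale sc l (ac l a p)"
  by (induction p rule: mpol_induct)
    (simp_all add: ac_single ac_add_right br_der_left psubst1_simps pscale_simps mult.commute const_def)

lemma ac_D_right: "ac l a (Poly_Mapping.map D p) = Poly_Mapping.map D (ac l a p) + pscale sc l (ac l a p)"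
  by (induction p rule: mpol_induct)
    (simp_all add: ac_single ac_add_right br_der_right psubst1_simps pscale_simps mult.commute
      map_D_add psubst1_map_D map_D_pscale const_def)

definition ext :: "'f mpol \<Rightarrow> 'f mpol \<Rightarrow> 'a \<Rightarrow> 'a poly \<Rightarrow> 'a mpol" where
  "ext k l c p = (\<Sum>i\<le>degree p. pscale sc (k ^ i) (psubst1 sc l (br (coeff p i) c)))"

lemma br_act_at_ext: "br_act_at A (adjoint A) k l a b c = ext k l c (br a b)"
  by (simp add: br_act_at_def ext_def adjoint_def)

lemma ext_eq:
  assumes "degree p \<le> n"
  shows "ext k l c p = (\<Sum>i\<le>n. pscale sc (k ^ i) (psubst1 sc l (br (coeff p i) c)))"
  unfolding ext_def using assms
  by (intro sum.mono_neutral_left) (auto simp: coeff_eq_0 psubst1_simps pscale_simps)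

lemma ext_add: "ext k l c (p + q) = ext k l c p + ext k l c q"
proof -
  let ?n = "max (degree p) (degree q)"
  show ?thesis
    using degree_add_le_max[of p q]
    by (simp add: ext_eq[of _ ?n] br_add_left psubst1_simps pscale_simps sum.distrib)
qed

lemma ext_pCons: "ext k l c (pCons x p) = psubst1 sc l (br x c) + pscale sc k (ext k l c p)"
proof -
  have "ext k l c (pCons x p) =
      (\<Sum>i\<le>Suc (degree p). pscale sc (k ^ i) (psubst1 sc l (br (coeff (pCons x p) i) c)))"
    by (rule ext_eq) (rule degree_pCons_le)
  also have "\<dots> = psubst1 sc l (br x c) + (\<Sum>i\<le>degree p. pscale sc (k ^ Suc i) (psubst1 sc l (br (coeff p i) c)))"
    by (subst sum.atMost_Suc_shift) (simp add: pscale_simps)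
  finally show ?thesis
    by (simp add: ext_def pscale_sum_right[OF vector_space] pscale_simps)
qed

lemma ext_zero: "ext k l c 0 = 0"
  by (simp add: ext_def psubst1_simps pscale_simps)

lemma ext_minus: "ext k l c (- p) = - ext k l c p"
  using ext_add[of k l c p "- p"] by (simp add: ext_zero eq_neg_iff_add_eq_0 add.commute)

lemma ext_map_D: "ext k l c (map_poly D p) = - pscale sc l (ext k l c p)"
  by (induction p)
    (simp_all add: ext_zero ext_pCons map_poly_D_pCons br_der_left psubst1_simps pscale_simps mult.commute const_def)

lemma ext_scale: "ext k l c (map_poly (sc r) p) = pscale sc (const r) (ext k l c p)"
proof (induction p)
  case (pCons x p)
  interpret vector_space sc by (rule vector_space)
  show ?case
    using pCons by (simp add: ext_pCons map_poly_pCons br_scale_left psubst1_simps pscale_simps mult.commute)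
qed (simp add: ext_zero pscale_simps)

lemma ext_add_right: "ext k l (c + c') p = ext k l c p + ext k l c' p"
  by (induction p) (simp_all add: ext_zero ext_pCons br_add_right psubst1_simps pscale_simps)

lemma ext_scale_right: "ext k l (sc r c) p = pscale sc (const r) (ext k l c p)"
  by (induction p) (simp_all add: ext_zero ext_pCons br_scale_right psubst1_simps pscale_simps mult.commute)

lemma ext_D_right: "ext k l (D c) p = Poly_Mapping.map D (ext k l c p) + pscale sc l (ext k l c p)"
  by (induction p)
    (simp_all add: ext_zero ext_pCons br_der_right psubst1_simps pscale_simps mult.commute const_def
      map_D_add psubst1_map_D map_D_pscale)

definition Jac :: "'a \<Rightarrow> 'a \<Rightarrow> 'a \<Rightarrow> 'a mpol" where
  "Jac a b c = ac (lam 0) a (psubst1 sc (lam 1) (br b c)) - ext (lam 0) (lam 0 + lam 1) c (br a b)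
    - ac (lam 1) b (psubst1 sc (lam 0) (br a c))"

lemma pscale_diff: "pscale sc s (p - q) = pscale sc s p - pscale sc s q"
  using pscale_simps(1)[of s p "- q"] by (simp add: pscale_simps)

lemma map_D_diff: "Poly_Mapping.map D (p - q) = Poly_Mapping.map D p - Poly_Mapping.map D q"
  using map_D_add[of "p - q" q] by (simp add: algebra_simps)

lemmas J_simps = Jac_def ac_add_left ac_add_right ac_minus_right ac_pscale ac_const ext_add ext_minus
  psubst1_simps pscale_simps pscale_diff

lemma Jac_add: "Jac (a + a') b c = Jac a b c + Jac a' b c"
  "Jac a (b + b') c = Jac a b c + Jac a b' c"
  "Jac a b (c + c') = Jac a b c + Jac a b c'"
  by (simp_all add: J_simps br_add_left br_add_right ext_add_right)

lemma Jac_scale: "Jac (sc r a) b c = pscale sc (const r) (Jac a b c)"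
  "Jac a (sc r b) c = pscale sc (const r) (Jac a b c)"
  "Jac a b (sc r c) = pscale sc (const r) (Jac a b c)"
  by (simp_all add: J_simps br_scale_left br_scale_right ext_scale_right ext_scale ac_scale_left)

lemma Jac_D: "Jac (D a) b c = - pscale sc (lam 0) (Jac a b c)"
  "Jac a (D b) c = - pscale sc (lam 1) (Jac a b c)"
  "Jac a b (D c) = Poly_Mapping.map D (Jac a b c) + pscale sc (lam 0 + lam 1) (Jac a b c)"
  by (simp_all add: J_simps br_der_left br_der_right ext_D_right ext_map_D ac_D_left ac_D_right ext_pCons
      const_def psubst1_map_D map_D_diff map_D_add algebra_simps)

definition T :: "'a poly \<Rightarrow> 'a poly" where "T r = - pCons 0 r - map_poly D r"

lemma map_poly_D_add: "map_poly D (p + q) = map_poly D p + map_poly D q"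
  by (intro poly_eqI) (simp add: coeff_map_poly)

lemma map_poly_D_minus: "map_poly D (- p) = - map_poly D p"
  by (intro poly_eqI) (simp add: coeff_map_poly D_minus)

lemma T_add: "T (p + q) = T p + T q"
  by (intro poly_eqI) (simp add: T_def map_poly_D_add coeff_pCons split: nat.split)

lemma T_zero: "T 0 = 0" by (simp add: T_def)

lemma T_iter_add: "(T ^^ i) (p + q) = (T ^^ i) p + (T ^^ i) q"
  by (induction i) (simp_all add: T_add)

lemma T_iter_zero: "(T ^^ i) 0 = 0"
  by (induction i) (simp_all add: T_zero)

lemma T_sum: "T (sum f I) = (\<Sum>i\<in>I. T (f i))"
  by (induction I rule: infinite_finite_induct) (simp_all add: T_add T_zero)

lemma pflip_T: "pflip D p = (\<Sum>i\<le>degree p. (T ^^ i) [:coeff p i:])"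
  by (simp add: pflip_def T_def[abs_def])

lemma pflip_eq:
  assumes "degree p \<le> n"
  shows "pflip D p = (\<Sum>i\<le>n. (T ^^ i) [:coeff p i:])"
  unfolding pflip_T using assms
  by (intro sum.mono_neutral_left) (auto simp: coeff_eq_0 T_iter_zero)

lemma pflip_add: "pflip D (p + q) = pflip D p + pflip D q"
proof -
  let ?n = "max (degree p) (degree q)"
  have "[:x + y:] = [:x:] + [:y:]" for x y :: 'a by simp
  then show ?thesis
    using degree_add_le_max[of p q] by (simp add: pflip_eq[of _ ?n] T_iter_add sum.distrib del: add_pCons)
qed

lemma pflip_pCons: "pflip D (pCons x p) = [:x:] + T (pflip D p)"
proof -
  have "pflip D (pCons x p) = (\<Sum>i\<le>Suc (degree p). (T ^^ i) [:coeff (pCons x p) i:])"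
    by (rule pflip_eq) (rule degree_pCons_le)
  also have "\<dots> = [:x:] + (\<Sum>i\<le>degree p. (T ^^ Suc i) [:coeff p i:])"
    by (subst sum.atMost_Suc_shift) simp
  finally show ?thesis by (simp add: pflip_T T_sum)
qed

lemma pflip_zero: "pflip D 0 = 0" by (simp add: pflip_T)

lemma pflip_minus: "pflip D (- p) = - pflip D p"
  using pflip_add[of p "- p"] by (simp add: pflip_zero eq_neg_iff_add_eq_0 add.commute)

lemma T_map_D: "T (map_poly D p) = map_poly D (T p)"
  by (intro poly_eqI) (simp add: T_def coeff_map_poly coeff_pCons D_minus D_diff split: nat.split)

lemma pflip_map_D: "pflip D (map_poly D p) = map_poly D (pflip D p)"
  by (induction p) (simp_all add: pflip_zero pflip_pCons map_poly_D_pCons T_map_D map_poly_D_add)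

lemma map_scale_add: "map_poly (sc r) (p + q) = map_poly (sc r) p + map_poly (sc r) q"
proof -
  interpret vector_space sc by (rule vector_space)
  show ?thesis by (intro poly_eqI) (simp add: coeff_map_poly scale_right_distrib)
qed

lemma pflip_scale: "pflip D (map_poly (sc r) p) = map_poly (sc r) (pflip D p)"
proof -
  interpret vector_space sc by (rule vector_space)
  have *: "T (map_poly (sc r) q) = map_poly (sc r) (T q)" for q
    by (intro poly_eqI) (simp add: T_def coeff_map_poly coeff_pCons D_scale scale_right_diff_distrib split: nat.split)
  show ?thesis
    by (induction p) (simp_all add: pflip_zero pflip_pCons map_poly_pCons map_scale_add *)
qed

definition Skw :: "'a \<Rightarrow> 'a \<Rightarrow> 'a poly" where
  "Skw a b = br a b + pflip D (br b a)"

lemma Skw_add: "Skw (a + a') b = Skw a b + Skw a' b" "Skw a (b + b') = Skw a b + Skw a b'"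
  by (simp_all add: Skw_def br_add_left br_add_right pflip_add)

lemma Skw_scale: "Skw (sc r a) b = map_poly (sc r) (Skw a b)" "Skw a (sc r b) = map_poly (sc r) (Skw a b)"
  by (simp_all add: Skw_def br_scale_left br_scale_right pflip_scale map_scale_add)

lemma Skw_D: "Skw (D a) b = - pCons 0 (Skw a b)" "Skw a (D b) = map_poly D (Skw a b) + pCons 0 (Skw a b)"
  by (intro poly_eqI;
      simp add: Skw_def br_der_left br_der_right pflip_add pflip_map_D pflip_pCons pflip_minus T_def
        map_poly_D_add map_poly_D_minus coeff_pCons split: nat.split)+

end

lemma coeff_pair:
  fixes u v :: "'f::field poly poly"
  shows "coeff (map_poly (\<lambda>x. (x, 0)) u + map_poly (\<lambda>x. (0, x)) v :: ('f poly \<times> 'f poly) poly) n =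
    (coeff u n, coeff v n)"
proof -
  have "(\<lambda>x. (x, 0)) (0 :: 'f poly) = (0 :: 'f poly \<times> 'f poly)" "(\<lambda>x. (0, x)) (0 :: 'f poly) = (0 :: 'f poly \<times> 'f poly)"
    by (simp_all add: zero_prod_def)
  then show ?thesis by (simp add: coeff_map_poly)
qed

lemma in_lam_add: "in_lam (p + q) = in_lam p + in_lam q"
  by (intro poly_eqI) (simp add: in_lam_def coeff_map_poly)

lemma in_lam_smult: "in_lam (smult r p) = smult [:r:] (in_lam p)"
  by (intro poly_eqI) (simp add: in_lam_def coeff_map_poly mult.commute)

lemma in_lam_pCons: "in_lam (pCons r p) = pCons [:r:] (in_lam p)"
  unfolding in_lam_def by (rule map_poly_pCons) simp

lemma in_lam_zero [simp]: "in_lam 0 = 0" by (simp add: in_lam_def)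

lemma sesqui_add: "sesqui (p + p') q = sesqui p q + sesqui p' q" "sesqui p (q + q') = sesqui p q + sesqui p q'"
  by (simp_all add: sesqui_def in_lam_add pcompose_add algebra_simps)

lemma sesqui_smult: "sesqui (smult r p) q = smult [:r:] (sesqui p q)" "sesqui p (smult r q) = smult [:r:] (sesqui p q)"
  by (simp_all only: sesqui_def in_lam_smult pcompose_smult mult_smult_left mult_smult_right)

lemma sesqui_pCons: "sesqui (pCons 0 p) q = - pCons 0 (sesqui p q)"
  "sesqui p (pCons 0 q) = smult [:0, 1:] (sesqui p q) + pCons 0 (sesqui p q)"
proof -
  have 1: "([:0, -1:] * u) * v * w = - pCons 0 (u * v * w)" for u v w :: "'a poly poly"
  proof -
    have "pCons 0 (u * v * w) = [:0, 1:] * (u * v * w)" "[:0, -1 :: 'a poly:] = - [:0, 1:]" by simp_all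
    then show ?thesis by (simp only: mult.assoc mult_minus_left)
  qed
  have 2: "u * ([:[:0, 1:], 1:] * v) * w = smult [:0, 1:] (u * v * w) + pCons 0 (u * v * w)"
    for u v w :: "'a poly poly"
  proof -
    have "smult [:0, 1:] (u * v * w) + pCons 0 (u * v * w) = [:[:0, 1:], 1:] * (u * v * w)" by simp
    then show ?thesis by (simp only: mult_ac)
  qed
  show "sesqui (pCons 0 p) q = - pCons 0 (sesqui p q)"
    "sesqui p (pCons 0 q) = smult [:0, 1:] (sesqui p q) + pCons 0 (sesqui p q)"
    unfolding sesqui_def in_lam_pCons pcompose_pCons pCons_0_0 add_0_left by (rule 1 2)+
qed

lemma W_simps:
  "lscale W_neg1 r (p, q) = (smult r p, smult r q)"
  "lder W_neg1 (p, q) = (pCons 0 p, pCons 0 q)"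
  "coeff (lbr W_neg1 (p1, p2) (q1, q2)) n =
    (coeff (sesqui p1 q1) n, coeff (sesqui p1 q2 + sesqui p2 q1) n)"
  by (simp_all add: W_neg1_def coeff_pair del: coeff_add)

lemma W_sesquilinear: "sesquilinear_bracket (W_neg1 :: ('f::field, _) lca)"
proof
  fix r :: 'f and a b c :: "'f poly \<times> 'f poly"
  show "lbr W_neg1 (a + b) c = lbr W_neg1 a c + lbr W_neg1 b c" "lbr W_neg1 a (b + c) = lbr W_neg1 a b + lbr W_neg1 a c"
    by (cases a; cases b; cases c; intro poly_eqI; simp add: W_simps sesqui_add)+
  have [simp]: "lscale W_neg1 r 0 = 0" for r :: 'f by (simp add: W_simps zero_prod_def)
  have [simp]: "lder W_neg1 (0 :: 'f poly \<times> 'f poly) = 0" by (simp add: W_simps zero_prod_def)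
  show "lbr W_neg1 (lscale W_neg1 r a) b = map_poly (lscale W_neg1 r) (lbr W_neg1 a b)"
    "lbr W_neg1 a (lscale W_neg1 r b) = map_poly (lscale W_neg1 r) (lbr W_neg1 a b)"
    by (cases a; cases b; intro poly_eqI; simp add: W_simps coeff_map_poly sesqui_smult smult_add_right)+
  show "lbr W_neg1 (lder W_neg1 a) b = - pCons 0 (lbr W_neg1 a b)"
    "lbr W_neg1 a (lder W_neg1 b) = map_poly (lder W_neg1) (lbr W_neg1 a b) + pCons 0 (lbr W_neg1 a b)"
    by (cases a; cases b; intro poly_eqI;
      simp add: W_simps coeff_map_poly sesqui_pCons coeff_pCons zero_prod_def split: nat.split)+
qed (auto simp: W_simps Vector_Spaces.linear_iff vector_space_def smult_add_right smult_add_left)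

lemma W_gen:
  "lbr W_neg1 gen_L gen_L = [:lder W_neg1 gen_L, gen_L + gen_L :: 'f::field poly \<times> 'f poly:]"
  "lbr W_neg1 gen_L gen_H = [:lder W_neg1 gen_H, gen_H + gen_H :: 'f poly \<times> 'f poly:]"
  "lbr W_neg1 gen_H gen_L = [:lder W_neg1 gen_H, gen_H + gen_H :: 'f poly \<times> 'f poly:]"
  "lbr W_neg1 gen_H gen_H = (0 :: ('f poly \<times> 'f poly) poly)"
proof -
  have 1: "in_lam (1 :: 'f poly) = 1" by (simp add: one_pCons in_lam_pCons)
  have *: "sesqui 1 1 = [:[:0, 1 :: 'f:], [:2:]:]" "sesqui 0 p = 0" "sesqui p 0 = 0" for p :: "'f poly"
    by (simp_all add: sesqui_def 1 pcompose_1 numeral_poly)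
  show
    "lbr W_neg1 gen_L gen_L = [:lder W_neg1 gen_L, gen_L + gen_L :: 'f poly \<times> 'f poly:]"
    "lbr W_neg1 gen_L gen_H = [:lder W_neg1 gen_H, gen_H + gen_H :: 'f poly \<times> 'f poly:]"
    "lbr W_neg1 gen_H gen_L = [:lder W_neg1 gen_H, gen_H + gen_H :: 'f poly \<times> 'f poly:]"
    "lbr W_neg1 gen_H gen_H = (0 :: ('f poly \<times> 'f poly) poly)"
    by (rule poly_eqI, simp add: gen_L_def gen_H_def W_simps coeff_pCons zero_prod_def
      *[unfolded one_pCons] one_pCons split: nat.split)+
qed

lemma W_induct:
  fixes x :: "'f::field poly \<times> 'f poly"
  assumes "P gen_L" "P gen_H" and add: "\<And>x y. P x \<Longrightarrow> P y \<Longrightarrow> P (x + y)"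
    and scale: "\<And>r x. P x \<Longrightarrow> P (lscale W_neg1 r x)" and der: "\<And>x. P x \<Longrightarrow> P (lder W_neg1 x)"
  shows "P x"
proof -
  have 0: "P (0, 0)" using scale[of gen_L 0] assms(1) by (simp add: gen_L_def W_simps)
  have "P (p, 0)" for p
  proof (induction p)
    case (pCons r p)
    have "(pCons r p, 0) = lscale W_neg1 r gen_L + lder W_neg1 (p, 0)" by (simp add: gen_L_def W_simps)
    then show ?case using pCons assms by metis
  qed (rule 0)
  moreover have "P (0, p)" for p
  proof (induction p)
    case (pCons r p)
    have "(0, pCons r p) = lscale W_neg1 r gen_H + lder W_neg1 (0, p)" by (simp add: gen_H_def W_simps)
    then show ?case using pCons assms by metis
  qed (rule 0)
  ultimately have "P ((fst x, 0) + (0, snd x))" by (intro add)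
  then show ?thesis by simp
qed

lemma W_gen_neq: "gen_L \<noteq> gen_H" "gen_H \<noteq> gen_L" "gen_L \<noteq> 0"
  by (simp_all add: gen_L_def gen_H_def zero_prod_def)

context begin
interpretation W: sesquilinear_bracket "W_neg1 :: ('f::field, _) lca" by (rule W_sesquilinear)

lemma Skw_gen:
  fixes a b :: "'f::field poly \<times> 'f poly"
  assumes "a \<in> {gen_L, gen_H}" "b \<in> {gen_L, gen_H}"
  shows "W.Skw a b = 0"
proof -
  have *: "W.Skw a b = 0" if "W.br a b = [:W.D u, u + u:]" "W.br b a = [:W.D u, u + u:]"
    for a b u :: "'f poly \<times> 'f poly"
    unfolding W.Skw_def that
    by (rule poly_eqI)
      (simp add: W.pflip_pCons W.pflip_zero W.T_def W.map_poly_D_pCons coeff_pCons split: nat.split)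
  show ?thesis
    by (rule *[of a b "if a = gen_L then b else if b = gen_L then a else 0"])
      (use assms in \<open>auto simp: W_gen W_gen_neq\<close>)
qed

lemma Skw_zero: "W.Skw a b = 0"
proof (induction b rule: W_induct)
  case 1
  show ?case by (induction a rule: W_induct) (simp_all add: Skw_gen W.Skw_add W.Skw_scale W.Skw_D)
next
  case 2
  show ?case by (induction a rule: W_induct) (simp_all add: Skw_gen W.Skw_add W.Skw_scale W.Skw_D)
qed (simp_all add: W.Skw_add W.Skw_scale W.Skw_D)

lemma Jac_gen:
  fixes a b c :: "'f::field poly \<times> 'f poly"
  assumes "a \<in> {gen_L, gen_H}" "b \<in> {gen_L, gen_H}" "c \<in> {gen_L, gen_H}"
  shows "W.Jac a b c = 0"
proof -
  have [simp]: "const 0 = (0 :: ('f poly \<times> 'f poly) mpol)" by (simp add: const_def)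
  have *: "W.Jac a b c = 0"
    if "W.br b c = [:W.D u, u + u:]" "W.br a b = [:W.D v, v + v:]" "W.br a c = [:W.D w, w + w:]"
      "W.br a u = [:W.D t, t + t:]" "W.br v c = [:W.D t, t + t:]" "W.br b w = [:W.D t, t + t:]"
    for a b c u v w t :: "'f poly \<times> 'f poly"
    by (simp add: W.Jac_def that W.ext_pCons W.ext_zero W.psubst1_simps W.pscale_simps W.ac_add_right
        W.ac_const W.ac_pscale W.ac_zero W.br_add_left W.br_add_right W.br_der_left W.br_der_right
        W.map_poly_D_pCons const_add[OF W.vector_space] const_minus[OF W.vector_space]
        const_diff[OF W.vector_space] W.pscale_diff algebra_simps)
  let ?g = "\<lambda>a b :: 'f poly \<times> 'f poly. if a = gen_L then b else if b = gen_L then a else 0"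
  show ?thesis
    by (rule *[of b c "?g b c" a "?g a b" "?g a c" "?g a (?g b c)"])
      (use assms in \<open>auto simp: W_gen W_gen_neq\<close>)
qed

lemma Jac_zero: "W.Jac a b c = 0"
proof (induction c rule: W_induct)
  case 1
  show ?case
  proof (induction b rule: W_induct)
    case 1
    show ?case by (induction a rule: W_induct) (simp_all add: Jac_gen W.Jac_add W.Jac_scale W.Jac_D W.pscale_simps)
  next
    case 2
    show ?case by (induction a rule: W_induct) (simp_all add: Jac_gen W.Jac_add W.Jac_scale W.Jac_D W.pscale_simps)
  qed (simp_all add: W.Jac_add W.Jac_scale W.Jac_D W.pscale_simps)
next
  case 2
  show ?case
  proof (induction b rule: W_induct)
    case 1
    show ?case by (induction a rule: W_induct) (simp_all add: Jac_gen W.Jac_add W.Jac_scale W.Jac_D W.pscale_simps)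
  next
    case 2
    show ?case by (induction a rule: W_induct) (simp_all add: Jac_gen W.Jac_add W.Jac_scale W.Jac_D W.pscale_simps)
  qed (simp_all add: W.Jac_add W.Jac_scale W.Jac_D W.pscale_simps)
qed (simp_all add: W.Jac_add W.Jac_scale W.Jac_D W.pscale_simps)
end

lemma W_lca: "lie_conformal_algebra (W_neg1 :: ('f::field, _) lca)"
proof -
  interpret W: sesquilinear_bracket "W_neg1 :: ('f::field, _) lca" by (rule W_sesquilinear)
  show ?thesis
  proof
    fix a b c :: "'f poly \<times> 'f poly"
    show "lbr W_neg1 a b = - pflip (lder W_neg1) (lbr W_neg1 b a)"
      using Skw_zero[of a b] by (simp add: W.Skw_def eq_neg_iff_add_eq_0)
    show "W.ac (lam 0) a (psubst1 W.sc (lam 1) (W.br b c)) =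
       br_act_at W_neg1 (adjoint W_neg1) (lam 0) (lam 0 + lam 1) a b c +
       W.ac (lam 1) b (psubst1 W.sc (lam 0) (W.br a c))"
      using Jac_zero[of a b c] by (simp add: W.Jac_def W.br_act_at_ext algebra_simps)
  qed
qed

end

theory Submission
  imports Defs "HOL-Library.Function_Algebras"
begin

text \<open>
A cochain is determined by its values on lists of the generators \<open>L\<close> and \<open>H\<close>, and these
values are polynomials in \<open>\<partial>\<close> and the \<open>\<lambda>\<^sub>i\<close>.  Since \<open>F\<close> is infinite, nothing is lost when numbers are
substituted for all variables.  This turns a cochain into a function \<open>F\<close> of lists of points
\<open>(p, q, l)\<close>, where \<open>(p, q, l)\<close> stands for the element \<open>p L + q H\<close> taken at \<open>\<lambda> = l\<close>.  For the points
\<open>L\<^sub>l = (1, 0, l)\<close> and \<open>H\<^sub>l = (0, 1, l)\<close> the \<open>\<lambda>\<close>-bracket becomes the Lie bracket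
\<open>[L\<^sub>l, L\<^sub>m] = (l - m) L\<^sub>l\<^sub>+\<^sub>m\<close>, \<open>[L\<^sub>l, H\<^sub>m] = (l - m) H\<^sub>l\<^sub>+\<^sub>m\<close>, \<open>[H\<^sub>l, H\<^sub>m] = 0\<close>, the adjoint module becomes
a module of functions of \<open>D\<close> (the value of \<open>\<partial>\<close>), and the differential becomes the ordinary
Chevalley-Eilenberg differential (\<open>realizes_diff\<close>).  All identities can then be checked pointwise.

The Cartan formula \<open>d \<iota>\<^sub>x + \<iota>\<^sub>x d = \<theta>\<^sub>x\<close> for \<open>x = L\<^sub>l\<close> holds for every number \<open>l\<close> and is polynomial in
\<open>l\<close>.  The coefficient of \<open>l\<close> in \<open>\<theta>\<^sub>x\<close> multiplies a \<open>q\<close>-cochain that is homogeneous of degree \<open>n\<close> in \<open>\<partial>\<close>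
and the \<open>\<lambda>\<^sub>i\<close> by \<open>n + 2 - q\<close> (\<open>lin_coeff_lie\<close>); so the coefficient of \<open>l\<close> in \<open>\<iota>\<^sub>x\<close> is a homotopy that
kills all cohomology outside the weight zero part \<open>n = q - 2\<close> (\<open>cocycle_weight_zero\<close>).  If \<open>a\<close> of the
arguments are \<open>L\<close> and \<open>b\<close> are \<open>H\<close>, skew-symmetry makes the exponents of the \<open>\<lambda>\<^sub>i\<close> within each of the
two groups distinct, so that the degree is at least \<open>a (a - 1) / 2 + b (b - 1) / 2\<close>.  For this to be
at most \<open>a + b - 2\<close>, both \<open>a\<close> and \<open>b\<close> have to be \<open>1\<close> or \<open>2\<close>, and equality holds
(\<open>weight_zero_support\<close>).  Hence the weight zero subcomplex lives in degrees \<open>2, 3, 4\<close>, with dimensions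
\<open>2, 4, 2\<close>; a basis is given by Vandermonde polynomials times the value \<open>L\<close> or \<open>H\<close>.  Its differential
has rank one in degree \<open>2\<close> and in degree \<open>3\<close> (\<open>cd_bas\<close>), which leaves the dimensions \<open>1, 2, 1\<close> of the
basic cohomology.

At \<open>l = 0\<close> the Cartan formula reads \<open>d \<iota>\<^sub>0 + \<iota>\<^sub>0 d = \<partial>\<close> (\<open>homotopy\<close>), so \<open>\<partial>\<close> acts by zero on the basic
cohomology.  As \<open>\<partial>\<close> is injective on cochains, the long exact sequence of
\<open>0 \<rightarrow> \<partial>C \<rightarrow> C \<rightarrow> C/\<partial>C \<rightarrow> 0\<close> splits into short ones, and the reduced cohomology in degree \<open>q\<close> is the sum of
the basic cohomology in degrees \<open>q\<close> and \<open>q + 1\<close>.  A basic cocycle \<open>g\<close> of degree \<open>q + 1\<close> contributes the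
reduced class of \<open>\<iota>\<^sub>0 g\<close>, because \<open>d \<iota>\<^sub>0 g = \<partial>g\<close> (\<open>basis_reduced\<close>).
\<close>

section \<open>The Chevalley-Eilenberg complex of families\<close>

text \<open>The point \<open>(p, q, l)\<close> stands for \<open>p L + q H\<close> at \<open>\<lambda> = l\<close>.  In \<open>F xs D b\<close> the number \<open>D\<close> is the value of
  \<open>\<partial>\<close>, and \<open>b\<close> selects a component of the value in the free module: \<open>L\<close> for \<open>False\<close>, \<open>H\<close> for \<open>True\<close>.\<close>

type_synonym 'f point = "'f \<times> 'f \<times> 'f"
type_synonym 'f fam = "'f point list \<Rightarrow> 'f \<Rightarrow> bool \<Rightarrow> 'f"

text \<open>The bracket is \<open>(l - m)\<close> times the product \<open>(p + q \<epsilon>) (p' + q' \<epsilon>)\<close> of dual numbers (\<open>\<epsilon>\<^sup>2 = 0\<close>), because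
  \<open>\<partial> + 2 l\<close> has the value \<open>l - m\<close> at \<open>\<partial> = - (l + m)\<close>, the number by which \<open>\<partial>\<close> acts in a slot of a cochain
  with parameter \<open>l + m\<close>.\<close>

fun br :: "'f::field_char_0 point \<Rightarrow> 'f point \<Rightarrow> 'f point" where
  "br (p, q, l) (p', q', m) = ((l - m) * p * p', (l - m) * (p * q' + q * p'), l + m)"

text \<open>\<open>L\<^sub>\<lambda> \<phi>(\<partial>) v = (\<partial> + 2 \<lambda>) \<phi>(\<partial> + \<lambda>) v\<close>, and \<open>H\<close> moreover maps \<open>L\<close> to \<open>H\<close> and \<open>H\<close> to \<open>0\<close>.\<close>

fun act :: "'f::field_char_0 point \<Rightarrow> ('f \<Rightarrow> bool \<Rightarrow> 'f) \<Rightarrow> 'f \<Rightarrow> bool \<Rightarrow> 'f" where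
  "act (p, q, l) \<phi> D b = (D + 2 * l) * (p * \<phi> (D + l) b + (if b then q * \<phi> (D + l) False else 0))"

definition ins :: "'f point \<Rightarrow> 'f fam \<Rightarrow> 'f fam" where
  "ins x F xs = F (x # xs)"

text \<open>With \<open>ins x\<close> as the contraction \<open>\<iota>\<^sub>x\<close>, Lie derivative \<open>\<theta>\<^sub>x\<close> and differential are defined by recursion on the list of arguments, through the
  identities \<open>\<iota>\<^sub>y \<theta>\<^sub>x = \<theta>\<^sub>x \<iota>\<^sub>y - \<iota>\<^bsub>[x, y]\<^esub>\<close> and \<open>\<iota>\<^sub>x d = \<theta>\<^sub>x - d \<iota>\<^sub>x\<close>.  The Cartan calculus, including
  \<open>d\<^sup>2 = 0\<close>, then follows by inductions without any sums over positions.  The usual formula for the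
  differential is \<open>cd_explicit\<close>.\<close>

primrec lie_rec :: "'f point list \<Rightarrow> 'f::field_char_0 point \<Rightarrow> 'f fam \<Rightarrow> 'f \<Rightarrow> bool \<Rightarrow> 'f" where
  "lie_rec [] x F = act x (F [])"
| "lie_rec (y # ys) x F = (\<lambda>D b. lie_rec ys x (ins y F) D b - F (br x y # ys) D b)"

definition lie :: "'f::field_char_0 point \<Rightarrow> 'f fam \<Rightarrow> 'f fam" where
  "lie x F xs = lie_rec xs x F"

primrec cd_rec :: "'f point list \<Rightarrow> 'f::field_char_0 fam \<Rightarrow> 'f \<Rightarrow> bool \<Rightarrow> 'f" where
  "cd_rec [] F = (\<lambda>D b. 0)"
| "cd_rec (x # xs) F = (\<lambda>D b. lie x F xs D b - cd_rec xs (ins x F) D b)"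

definition cd :: "'f::field_char_0 fam \<Rightarrow> 'f fam" where
  "cd F xs = cd_rec xs F"

lemma lie_Nil: "lie x F [] = act x (F [])"
  and lie_Cons: "lie x F (y # ys) D b = lie x (ins y F) ys D b - F (br x y # ys) D b"
  and cd_Nil: "cd F [] D b = 0"
  and cd_Cons: "cd F (x # xs) D b = lie x F xs D b - cd (ins x F) xs D b"
  by (simp_all add: lie_def cd_def)

lemma ins_lie: "ins y (lie x F) = (\<lambda>ys D b. lie x (ins y F) ys D b - ins (br x y) F ys D b)"
  and ins_cd: "ins x (cd F) = (\<lambda>xs D b. lie x F xs D b - cd (ins x F) xs D b)"
  by (intro ext, simp add: ins_def lie_Cons cd_Cons)+

lemma ins_lin: "ins y (\<lambda>xs D b. c * F xs D b + e * G xs D b) = (\<lambda>xs D b. c * ins y F xs D b + e * ins y G xs D b)"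
  by (intro ext) (simp add: ins_def)

lemma lie_lin: "lie x (\<lambda>xs D b. c * F xs D b + e * G xs D b) xs D b = c * lie x F xs D b + e * lie x G xs D b"
proof (induction xs arbitrary: F G)
  case Nil
  show ?case by (cases x) (simp add: lie_Nil algebra_simps)
next
  case (Cons y ys)
  from Cons[of "ins y F" "ins y G"] show ?case
    by (simp add: lie_Cons ins_lin algebra_simps)
qed

lemma cd_lin: "cd (\<lambda>xs D b. c * F xs D b + e * G xs D b) xs D b = c * cd F xs D b + e * cd G xs D b"
proof (induction xs arbitrary: F G)
  case Nil
  show ?case by (simp add: cd_Nil)
next
  case (Cons y ys)
  from Cons[of "ins y F" "ins y G"] show ?case
    by (simp add: cd_Cons ins_lin lie_lin algebra_simps)
qed

lemma lie_diff: "lie x (\<lambda>xs D b. F xs D b - G xs D b) xs D b = lie x F xs D b - lie x G xs D b"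
  using lie_lin[of x 1 F "-1" G xs D b] by simp

lemma cd_diff: "cd (\<lambda>xs D b. F xs D b - G xs D b) xs D b = cd F xs D b - cd G xs D b"
  using cd_lin[of 1 F "-1" G xs D b] by simp

text \<open>\<open>F\<close> is linear in the first two coordinates of every point; it need not be linear in the third.\<close>

definition multilin :: "'f::field_char_0 fam \<Rightarrow> bool" where
  "multilin F \<longleftrightarrow> (\<forall>xs p q l ys D b.
     F (xs @ (p, q, l) # ys) D b = p * F (xs @ (1, 0, l) # ys) D b + q * F (xs @ (0, 1, l) # ys) D b)"

definition alternating :: "'f::field_char_0 fam \<Rightarrow> bool" where
  "alternating F \<longleftrightarrow> (\<forall>xs x y ys D b. F (xs @ x # y # ys) D b = - F (xs @ y # x # ys) D b)"

lemma multilinD: "multilin F \<Longrightarrow>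
  F (xs @ (p, q, l) # ys) D b = p * F (xs @ (1, 0, l) # ys) D b + q * F (xs @ (0, 1, l) # ys) D b"
  unfolding multilin_def by blast

lemma multilinD_hd: "multilin F \<Longrightarrow> F ((p, q, l) # ys) D b = p * F ((1, 0, l) # ys) D b + q * F ((0, 1, l) # ys) D b"
  using multilinD[of F "[]" p q l ys D b] by simp

lemma multilin_ins: assumes "multilin F" shows "multilin (ins x F)"
  unfolding multilin_def[of "ins x F"] ins_def
proof (intro allI)
  fix xs p q l ys D b
  show "F (x # xs @ (p, q, l) # ys) D b = p * F (x # xs @ (1, 0, l) # ys) D b + q * F (x # xs @ (0, 1, l) # ys) D b"
    using multilinD[OF assms, of "x # xs" p q l ys D b] by simp
qed

lemma alternatingD: "alternating F \<Longrightarrow> F (xs @ x # y # ys) D b = - F (xs @ y # x # ys) D b"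
  unfolding alternating_def by blast

lemma alternatingD_hd: "alternating F \<Longrightarrow> F (x # y # ys) D b = - F (y # x # ys) D b"
  using alternatingD[of F "[]" x y ys D b] by simp

lemma alternating_ins: assumes "alternating F" shows "alternating (ins x F)"
  unfolding alternating_def[of "ins x F"] ins_def
proof (intro allI)
  fix xs y z ys D b
  show "F (x # xs @ y # z # ys) D b = - F (x # xs @ z # y # ys) D b"
    using alternatingD[OF assms, of "x # xs" y z ys D b] by simp
qed

lemma multilin_ins_expand:
  assumes "multilin F"
  shows "ins (p, q, l) F = (\<lambda>xs D b. p * ins (1, 0, l) F xs D b + q * ins (0, 1, l) F xs D b)"
  by (intro ext) (simp add: ins_def multilinD_hd[OF assms, of p q])

text \<open>All three iterated brackets have the same parameter \<open>l + l' + l''\<close>, so that linearity in the slot turns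
  the Jacobi identity of the coefficients into one for the values of \<open>F\<close>.\<close>

lemma multilin_jacobi:
  assumes "multilin F"
  shows "F (br (br x y) z # zs) D b = F (br x (br y z) # zs) D b - F (br y (br x z) # zs) D b"
proof -
  obtain p q l p' q' l' p'' q'' l'' where [simp]: "x = (p, q, l)" "y = (p', q', l')" "z = (p'', q'', l'')"
    by (metis surj_pair)
  show ?thesis
    apply (simp only: br.simps \<open>x = _\<close> \<open>y = _\<close> \<open>z = _\<close>)
    apply (subst (1 2 3) multilinD_hd[OF assms])
    apply (simp add: algebra_simps)
    done
qed

lemma multilin_br_swap:
  assumes "multilin F"
  shows "F (br x y # zs) D b = - F (br y x # zs) D b"
proof -
  obtain p q l p' q' l' where [simp]: "x = (p, q, l)" "y = (p', q', l')"
    by (metis surj_pair)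
  show ?thesis
    apply (simp only: br.simps \<open>x = _\<close> \<open>y = _\<close>)
    apply (subst (1 2) multilinD_hd[OF assms])
    apply (simp add: algebra_simps)
    done
qed

lemma act_bracket:
  "act x (\<lambda>D b. act y \<phi> D b) D b - act y (\<lambda>D b. act x \<phi> D b) D b = act (br x y) \<phi> D b"
  by (cases x; cases y) (simp add: algebra_simps)

text \<open>\<open>[\<theta>\<^sub>x, \<theta>\<^sub>y] = \<theta>\<^bsub>[x, y]\<^esub>\<close>: peeling off one argument \<open>z\<close> leaves the induction hypothesis and the Jacobi
  identity for \<open>x\<close>, \<open>y\<close>, \<open>z\<close>.\<close>

lemma lie_commutator:
  "multilin F \<Longrightarrow> lie x (lie y F) zs D b - lie y (lie x F) zs D b = lie (br x y) F zs D b"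
proof (induction zs arbitrary: F)
  case Nil
  show ?case using act_bracket[of x y "F []" D b] by (simp add: lie_Nil)
next
  case (Cons z zs)
  have "lie x (lie y F) (z # zs) D b - lie y (lie x F) (z # zs) D b
      = (lie x (lie y (ins z F)) zs D b - lie y (lie x (ins z F)) zs D b)
        + F (br y (br x z) # zs) D b - F (br x (br y z) # zs) D b"
    by (simp add: lie_Cons[of _ "lie _ _"] ins_lie lie_diff lie_Cons[of _ F])
  then show ?case
    using Cons multilin_ins[OF Cons.prems] multilin_jacobi[OF Cons.prems, of x y z zs D b]
    by (simp add: lie_Cons)
qed

lemma act_zero: "act x (\<lambda>D b. 0) D b = 0"
  by (cases x) simp

text \<open>Contracting both sides with \<open>y\<close> and using \<open>lie_commutator\<close> reduces the claim to \<open>\<iota>\<^sub>y F\<close>.\<close>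

lemma cd_lie: "multilin F \<Longrightarrow> cd (lie x F) ys D b = lie x (cd F) ys D b"
proof (induction ys arbitrary: F)
  case Nil
  have "cd F [] = (\<lambda>D b. 0)" by (intro ext) (simp add: cd_Nil)
  then show ?case by (simp add: cd_Nil lie_Nil act_zero)
next
  case (Cons y ys)
  have "cd (lie x F) (y # ys) D b
      = lie y (lie x F) ys D b - (cd (lie x (ins y F)) ys D b - cd (ins (br x y) F) ys D b)"
    by (simp add: cd_Cons[of "lie _ _"] ins_lie cd_diff)
  also have "\<dots> = lie x (lie y F) ys D b - lie (br x y) F ys D b
       - (lie x (cd (ins y F)) ys D b - cd (ins (br x y) F) ys D b)"
    using lie_commutator[OF Cons.prems, of x y ys D b] Cons.IH[OF multilin_ins[OF Cons.prems]]
    by (simp add: algebra_simps)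
  also have "\<dots> = lie x (cd F) (y # ys) D b"
    by (simp add: lie_Cons[of _ "cd _"] ins_cd lie_diff cd_Cons)
  finally show ?case .
qed

lemma cd_zero: "cd (\<lambda>xs D b. 0) xs D b = 0"
  using cd_lin[of 0 "\<lambda>xs D b. 0" 0 "\<lambda>xs D b. 0" xs D b] by simp

text \<open>\<open>\<iota>\<^sub>x d d = \<theta>\<^sub>x d - d \<theta>\<^sub>x + d d \<iota>\<^sub>x = d d \<iota>\<^sub>x\<close>, which vanishes by induction.\<close>

lemma cd_cd: "multilin F \<Longrightarrow> cd (cd F) xs D b = 0"
proof (induction xs arbitrary: F)
  case (Cons x xs)
  then show ?case
    by (simp add: cd_Cons[of "cd F"] ins_cd cd_diff cd_lie multilin_ins)
qed (simp add: cd_Nil)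

lemma lie_lin_left:
  "multilin F \<Longrightarrow> lie (p, q, l) F xs D b = p * lie (1, 0, l) F xs D b + q * lie (0, 1, l) F xs D b"
proof (induction xs arbitrary: F)
  case Nil
  show ?case by (simp add: lie_Nil algebra_simps)
next
  case (Cons y ys)
  obtain p' q' m where y: "y = (p', q', m)" by (cases y)
  have "F (br (p, q, l) y # ys) D b = p * F (br (1, 0, l) y # ys) D b + q * F (br (0, 1, l) y # ys) D b"
    unfolding y br.simps by (subst (1 2 3) multilinD_hd[OF Cons.prems]) (simp add: algebra_simps)
  then show ?case using Cons.IH[OF multilin_ins[OF Cons.prems]] by (simp add: lie_Cons algebra_simps)
qed

lemma multilin_lie: assumes "multilin F" shows "multilin (lie x F)"
  unfolding multilin_def
proof (intro allI)
  fix xs p q l ys D b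
  show "lie x F (xs @ (p, q, l) # ys) D b =
    p * lie x F (xs @ (1, 0, l) # ys) D b + q * lie x F (xs @ (0, 1, l) # ys) D b"
    using assms
  proof (induction xs arbitrary: F)
    case Nil
    obtain p' q' m where x: "x = (p', q', m)" by (cases x)
    have "F (br x (p, q, l) # ys) D b = p * F (br x (1, 0, l) # ys) D b + q * F (br x (0, 1, l) # ys) D b"
      unfolding x br.simps by (subst (1 2 3) multilinD_hd[OF Nil]) (simp add: algebra_simps)
    then show ?case
      by (simp add: lie_Cons multilin_ins_expand[OF Nil, of p q] lie_lin) (simp add: algebra_simps)
  next
    case (Cons z zs)
    show ?case using Cons.IH[OF multilin_ins[OF Cons.prems, of z]] multilinD[OF Cons.prems, of "br x z # zs" p q]
      by (simp add: lie_Cons algebra_simps)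
  qed
qed

lemma multilin_cd: assumes "multilin F" shows "multilin (cd F)"
  unfolding multilin_def
proof (intro allI)
  fix xs p q l ys D b
  show "cd F (xs @ (p, q, l) # ys) D b =
    p * cd F (xs @ (1, 0, l) # ys) D b + q * cd F (xs @ (0, 1, l) # ys) D b"
    using assms
  proof (induction xs arbitrary: F)
    case Nil
    show ?case
      by (simp add: cd_Cons multilin_ins_expand[OF Nil, of p q] cd_lin lie_lin_left[OF Nil, of p q])
        (simp add: algebra_simps)
  next
    case (Cons z zs)
    show ?case using Cons.IH[OF multilin_ins[OF Cons.prems, of z]] multilinD[OF multilin_lie[OF Cons.prems], of z zs p q]
      by (simp add: cd_Cons algebra_simps)
  qed
qed

lemma lie_uminus: "lie x (\<lambda>xs D b. - F xs D b) xs D b = - lie x F xs D b"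
  using lie_lin[of x "-1" F 0 F xs D b] by simp

lemma cd_uminus: "cd (\<lambda>xs D b. - F xs D b) xs D b = - cd F xs D b"
  using cd_lin[of "-1" F 0 F xs D b] by simp

lemma alternating_ins_ins: "alternating F \<Longrightarrow> ins x (ins y F) = (\<lambda>xs D b. - ins y (ins x F) xs D b)"
  by (intro ext) (auto simp: ins_def intro: alternatingD_hd)

lemma alternating_lie: assumes "alternating F" shows "alternating (lie x F)"
  unfolding alternating_def
proof (intro allI)
  fix xs y z ys D b
  show "lie x F (xs @ y # z # ys) D b = - lie x F (xs @ z # y # ys) D b"
    using assms
  proof (induction xs arbitrary: F)
    case Nil
    show ?case
      using alternatingD_hd[OF Nil, of "br x y" z ys D b] alternatingD_hd[OF Nil, of "br x z" y ys D b]
      by (simp add: lie_Cons alternating_ins_ins[OF Nil, of z y] lie_uminus) (simp add: ins_def)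
  next
    case (Cons w ws)
    show ?case
      using Cons.IH[OF alternating_ins[OF Cons.prems, of w]] alternatingD[OF Cons.prems, of "br x w # ws" y z]
      by (simp add: lie_Cons)
  qed
qed

lemma alternating_cd: assumes "alternating F" "multilin F" shows "alternating (cd F)"
  unfolding alternating_def
proof (intro allI)
  fix xs y z ys D b
  show "cd F (xs @ y # z # ys) D b = - cd F (xs @ z # y # ys) D b"
    using assms
  proof (induction xs arbitrary: F)
    case Nil
    show ?case
      using multilin_br_swap[OF Nil(2), of y z ys D b]
      by (simp add: cd_Cons lie_Cons alternating_ins_ins[OF Nil(1), of z y] cd_uminus)
  next
    case (Cons w ws)
    show ?case
      using Cons.IH[OF alternating_ins[OF Cons.prems(1), of w] multilin_ins[OF Cons.prems(2)]]
        alternatingD[OF alternating_lie[OF Cons.prems(1)], of w ws y z]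
      by (simp add: cd_Cons)
  qed
qed

text \<open>The operator \<open>\<partial>\<close> on cochains, in terms of families.\<close>

definition fder :: "'f::field_char_0 fam \<Rightarrow> 'f fam" where
  "fder F xs D b = (D + (\<Sum>(p, q, l)\<leftarrow>xs. l)) * F xs D b"

text \<open>At \<open>l = 0\<close> the bracket with \<open>L\<^sub>0\<close> multiplies a point with parameter \<open>m\<close> by \<open>- m\<close>.\<close>

lemma lie_0_fder: "multilin F \<Longrightarrow> lie (1, 0, 0) F xs D b = fder F xs D b"
proof (induction xs arbitrary: F)
  case Nil
  show ?case by (simp add: lie_Nil fder_def)
next
  case (Cons y ys)
  obtain p q l where y: "y = (p, q, l)" by (cases y)
  have "F (br (1, 0, 0) y # ys) D b = - l * F (y # ys) D b"
    unfolding y br.simps by (subst (1 2) multilinD_hd[OF Cons.prems]) (simp add: algebra_simps)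
  then show ?case
    using Cons.IH[OF multilin_ins[OF Cons.prems, of y]] ins_def[of y F ys]
    by (simp add: lie_Cons fder_def y algebra_simps)
qed

text \<open>A family is homogeneous of degree \<open>n\<close> in \<open>\<partial>\<close> and the \<open>\<lambda>\<^sub>i\<close> iff replacing all these numbers by their
  multiples with \<open>t\<close> amounts to multiplication by \<open>t\<^sup>n\<close>.\<close>

definition dilate :: "'f::field_char_0 \<Rightarrow> 'f point list \<Rightarrow> 'f point list" where
  "dilate t = map (\<lambda>(p, q, l). (p, q, t * l))"

definition dilate_fam :: "'f::field_char_0 \<Rightarrow> 'f fam \<Rightarrow> 'f fam" where
  "dilate_fam t F xs D b = F (dilate t xs) (t * D) b"

lemma dilate_simps: "dilate t [] = []" "dilate t ((p, q, l) # xs) = (p, q, t * l) # dilate t xs"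
  by (simp_all add: dilate_def)

lemma ins_dilate_fam: "ins (p, q, l) (dilate_fam t F) = dilate_fam t (ins (p, q, t * l) F)"
  by (intro ext) (simp add: ins_def dilate_fam_def dilate_simps)

lemma lie_dilate: "multilin F \<Longrightarrow> lie (p, q, t * l) F (dilate t xs) (t * D) b = t * lie (p, q, l) (dilate_fam t F) xs D b"
proof (induction xs arbitrary: F)
  case Nil
  show ?case by (simp add: lie_Nil dilate_fam_def dilate_simps algebra_simps)
next
  case (Cons y ys)
  obtain p' q' m where y: "y = (p', q', m)" by (cases y)
  have "F (br (p, q, t * l) (p', q', t * m) # dilate t ys) (t * D) b
      = t * dilate_fam t F (br (p, q, l) (p', q', m) # ys) D b"
    unfolding br.simps dilate_fam_def dilate_simps
    by (subst (1 2) multilinD_hd[OF Cons.prems]) (simp add: algebra_simps)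
  then show ?case
    using Cons.IH[OF multilin_ins[OF Cons.prems]]
    by (simp add: y dilate_simps lie_Cons ins_dilate_fam algebra_simps)
qed

text \<open>Action and bracket contain one linear factor each, so the differential raises the degree by one.\<close>

lemma cd_dilate: "multilin F \<Longrightarrow> cd F (dilate t xs) (t * D) b = t * cd (dilate_fam t F) xs D b"
proof (induction xs arbitrary: F)
  case Nil
  show ?case by (simp add: cd_Nil dilate_simps)
next
  case (Cons y ys)
  obtain p' q' m where y: "y = (p', q', m)" by (cases y)
  show ?case
    using Cons.IH[OF multilin_ins[OF Cons.prems]]
    by (simp add: y dilate_simps cd_Cons ins_dilate_fam lie_dilate[OF Cons.prems]) (simp add: algebra_simps)
qed

section \<open>Families as generating functions of modes\<close>

text \<open>The mode \<open>(g, n)\<close> stands for the coefficient of \<open>\<lambda>\<^sup>n\<close> in the slot of the generator \<open>g\<close> (\<open>L\<close> for \<open>False\<close>,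
  \<open>H\<close> for \<open>True\<close>), and \<open>C ps k b\<close> is the coefficient of \<open>\<partial>\<^sup>k\<close> in the component \<open>b\<close>.\<close>

type_synonym 'f modes = "(bool \<times> nat) list \<Rightarrow> nat \<Rightarrow> bool \<Rightarrow> 'f"

lemma power_sum_eq_zero:
  fixes a :: "nat \<Rightarrow> 'f::field_char_0"
  assumes "\<And>x. (\<Sum>n\<le>N. x ^ n * a n) = 0" "n \<le> N"
  shows "a n = 0"
proof -
  let ?p = "\<Sum>n\<le>N. monom (a n) n"
  have "poly ?p x = 0" for x
    using assms(1)[of x] by (simp add: poly_sum poly_monom mult.commute)
  then have "?p = 0" using poly_all_0_iff_0[of ?p] by blast
  moreover have "coeff ?p n = a n"
    using assms(2) by (simp add: coeff_sum)
  ultimately show ?thesis by simp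
qed

definition mode_ins :: "bool \<times> nat \<Rightarrow> 'f modes \<Rightarrow> 'f modes" where
  "mode_ins g C ps = C (g # ps)"

text \<open>The polynomial with coefficients \<open>C\<close>, truncated at the exponent \<open>N\<close> in each variable and extended
  linearly to all points.\<close>

primrec gen :: "nat \<Rightarrow> 'f point list \<Rightarrow> 'f::field_char_0 modes \<Rightarrow> 'f \<Rightarrow> bool \<Rightarrow> 'f" where
  "gen N [] C = (\<lambda>D b. \<Sum>k\<le>N. D ^ k * C [] k b)"
| "gen N (x # xs) C = (case x of (p, q, l) \<Rightarrow> \<lambda>D b. \<Sum>n\<le>N. l ^ n *
     (p * gen N xs (mode_ins (False, n) C) D b + q * gen N xs (mode_ins (True, n) C) D b))"

definition gfun :: "nat \<Rightarrow> 'f::field_char_0 modes \<Rightarrow> 'f fam" where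
  "gfun N C xs = gen N xs C"

lemma gfun_Nil: "gfun N C [] D b = (\<Sum>k\<le>N. D ^ k * C [] k b)"
  and gfun_Cons: "gfun N C ((p, q, l) # xs) D b = (\<Sum>n\<le>N. l ^ n *
     (p * gfun N (mode_ins (False, n) C) xs D b + q * gfun N (mode_ins (True, n) C) xs D b))"
  by (simp_all add: gfun_def)

lemma gfun_cong:
  assumes "\<And>ps k b. length ps = length xs \<Longrightarrow> \<forall>p\<in>set ps. snd p \<le> N \<Longrightarrow> k \<le> N \<Longrightarrow> C ps k b = C' ps k b"
  shows "gfun N C xs D b = gfun N C' xs D b"
  using assms
proof (induction xs arbitrary: C C')
  case Nil
  then show ?case by (simp add: gfun_Nil)
next
  case (Cons x xs)
  obtain p q l where x: "x = (p, q, l)" by (cases x)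
  have "gfun N (mode_ins (g, n) C) xs D b = gfun N (mode_ins (g, n) C') xs D b" if "n \<le> N" for g n
    by (rule Cons.IH) (use that in \<open>auto simp: mode_ins_def intro!: Cons.prems\<close>)
  then show ?case by (simp add: x gfun_Cons)
qed

lemma gfun_lin: "gfun N (\<lambda>ps k b. c * C ps k b + e * C' ps k b) xs D b = c * gfun N C xs D b + e * gfun N C' xs D b"
proof (induction xs arbitrary: C C')
  case Nil
  show ?case by (simp add: gfun_Nil sum_distrib_left algebra_simps flip: sum.distrib)
next
  case (Cons x xs)
  obtain p q l where x: "x = (p, q, l)" by (cases x)
  have *: "mode_ins g (\<lambda>ps k b. c * C ps k b + e * C' ps k b) = (\<lambda>ps k b. c * mode_ins g C ps k b + e * mode_ins g C' ps k b)" for g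
    by (intro ext) (simp add: mode_ins_def)
  show ?case
    by (simp add: x gfun_Cons * Cons sum_distrib_left algebra_simps flip: sum.distrib)
qed

lemma gfun_scale: "gfun N (\<lambda>ps k b. c * C ps k b) xs D b = c * gfun N C xs D b"
  using gfun_lin[of N c C 0 C xs D b] by simp

lemma gfun_zero: "gfun N (\<lambda>ps k b. 0) xs D b = 0"
  using gfun_scale[of N 0 "\<lambda>ps k b. 0" xs D b] by simp

lemma gfun_add: "gfun N (\<lambda>ps k b. C ps k b + C' ps k b) xs D b = gfun N C xs D b + gfun N C' xs D b"
  using gfun_lin[of N 1 C 1 C' xs D b] by simp

lemma gfun_sum: "gfun N (\<lambda>ps k b. \<Sum>i\<in>I. C i ps k b) xs D b = (\<Sum>i\<in>I. gfun N (C i) xs D b)"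
  by (induction I rule: infinite_finite_induct) (simp_all add: gfun_zero gfun_add)

lemma gfun_length:
  assumes "\<And>ps k b. length ps = length xs \<Longrightarrow> C ps k b = 0"
  shows "gfun N C xs D b = 0"
  using gfun_cong[of xs N C "\<lambda>ps k b. 0" D b] assms by (simp add: gfun_zero)

text \<open>Truncating beyond the support of \<open>C\<close> changes nothing; this allows a common \<open>N\<close> for several families.\<close>

lemma gfun_bound:
  assumes "\<And>ps k b. C ps k b \<noteq> 0 \<Longrightarrow> (\<forall>p\<in>set ps. snd p \<le> N) \<and> k \<le> N" "N \<le> N'"
  shows "gfun N' C xs D b = gfun N C xs D b"
  using assms(1)
proof (induction xs arbitrary: C)
  case Nil
  show ?case unfolding gfun_Nil
    by (rule sum.mono_neutral_right) (use assms(2) Nil in \<open>fastforce+\<close>)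
next
  case (Cons x xs)
  obtain p q l where x: "x = (p, q, l)" by (cases x)
  have IH: "gfun N' (mode_ins g C) xs D b = gfun N (mode_ins g C) xs D b" for g
    by (rule Cons.IH) (use Cons.prems in \<open>fastforce simp: mode_ins_def\<close>)
  have "gfun N (mode_ins (g, n) C) xs D b = 0" if "\<not> n \<le> N" for g n
    by (rule gfun_length) (use that Cons.prems in \<open>fastforce simp: mode_ins_def\<close>)
  then show ?case unfolding x gfun_Cons IH
    by (intro sum.mono_neutral_right) (use assms(2) in auto)
qed

lemma multilin_gfun: "multilin (gfun N C)"
  unfolding multilin_def
proof (intro allI)
  fix xs p q l ys D b
  show "gfun N C (xs @ (p, q, l) # ys) D b =
    p * gfun N C (xs @ (1, 0, l) # ys) D b + q * gfun N C (xs @ (0, 1, l) # ys) D b"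
  proof (induction xs arbitrary: C)
    case Nil
    show ?case by (simp add: gfun_Cons sum_distrib_left algebra_simps flip: sum.distrib)
  next
    case (Cons x xs)
    obtain p' q' l' where x: "x = (p', q', l')" by (cases x)
    show ?case
      by (simp add: x gfun_Cons Cons[of "mode_ins _ _"] sum_distrib_left flip: sum.distrib) (simp add: algebra_simps)
  qed
qed

definition alt_modes :: "'f::field_char_0 modes \<Rightarrow> bool" where
  "alt_modes C \<longleftrightarrow> (\<forall>ps x y qs k b. C (ps @ x # y # qs) k b = - C (ps @ y # x # qs) k b)"

lemma alt_modesD: "alt_modes C \<Longrightarrow> C (ps @ x # y # qs) k b = - C (ps @ y # x # qs) k b"
  unfolding alt_modes_def by blast

lemma alt_modes_mode_ins: assumes "alt_modes C" shows "alt_modes (mode_ins g C)"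
  unfolding alt_modes_def[of "mode_ins g C"] mode_ins_def
proof (intro allI)
  fix ps x y qs k b
  show "C (g # ps @ x # y # qs) k b = - C (g # ps @ y # x # qs) k b"
    using alt_modesD[OF assms, of "g # ps" x y qs k b] by simp
qed

primrec swap_at :: "nat \<Rightarrow> 'x list \<Rightarrow> 'x list" where
  "swap_at 0 xs = (case xs of x # y # zs \<Rightarrow> y # x # zs | _ \<Rightarrow> xs)"
| "swap_at (Suc i) xs = (case xs of x # zs \<Rightarrow> x # swap_at i zs | [] \<Rightarrow> [])"

lemma swap_at_append: "swap_at (length xs) (xs @ x # y # ys) = xs @ y # x # ys"
  by (induction xs) simp_all

lemma split_at2:
  assumes "Suc i < length xs"
  shows "\<exists>as u v bs. xs = as @ u # v # bs \<and> length as = i"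
proof (intro exI conjI)
  show "xs = take i xs @ xs ! i # xs ! Suc i # drop (Suc (Suc i)) xs"
    using assms by (simp add: Cons_nth_drop_Suc)
  show "length (take i xs) = i" using assms by simp
qed

text \<open>Exchanging two arguments of the polynomial exchanges the modes of its coefficients; this makes the
  skew-symmetry of families and that of modes equivalent.\<close>

lemma gfun_swap_at: "Suc i < length xs \<Longrightarrow> gfun N (\<lambda>ps. C (swap_at i ps)) xs D b = gfun N C (swap_at i xs) D b"
proof (induction i arbitrary: xs C)
  case 0
  obtain x y ys where xs: "xs = x # y # ys" using 0 by (cases xs; cases "tl xs") auto
  obtain p q l p' q' l' where xy: "x = (p, q, l)" "y = (p', q', l')"
    by (metis surj_pair)
  let ?G = "\<lambda>g n h m. gfun N (mode_ins (h, m) (mode_ins (g, n) C)) ys D b"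
  have m: "mode_ins (h, m) (mode_ins (g, n) (\<lambda>ps. C (swap_at 0 ps))) = mode_ins (g, n) (mode_ins (h, m) C)" for g n h m
    by (intro ext) (simp add: mode_ins_def)
  have "gfun N (\<lambda>ps. C (swap_at 0 ps)) xs D b = (\<Sum>n\<le>N. \<Sum>m\<le>N. l ^ n * l' ^ m *
      (p * p' * ?G False m False n + p * q' * ?G True m False n +
       q * p' * ?G False m True n + q * q' * ?G True m True n))"
    unfolding xs xy gfun_Cons m sum_distrib_left sum.distrib[symmetric]
    by (intro sum.cong refl) (simp add: algebra_simps)
  also have "\<dots> = (\<Sum>m\<le>N. \<Sum>n\<le>N. l ^ n * l' ^ m *
      (p * p' * ?G False m False n + p * q' * ?G True m False n +
       q * p' * ?G False m True n + q * q' * ?G True m True n))"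
    by (rule sum.swap)
  also have "\<dots> = gfun N C (y # x # ys) D b"
    unfolding xy gfun_Cons sum_distrib_left sum.distrib[symmetric]
    by (intro sum.cong refl) (simp add: algebra_simps)
  finally show ?case by (simp add: xs)
next
  case (Suc i)
  then obtain x ys where xs: "xs = x # ys" "Suc i < length ys" by (cases xs) auto
  obtain p q l where x: "x = (p, q, l)" by (cases x)
  have "mode_ins g (\<lambda>ps. C (swap_at (Suc i) ps)) = (\<lambda>ps. mode_ins g C (swap_at i ps))" for g
    by (intro ext) (simp add: mode_ins_def)
  then show ?case using Suc.IH[OF xs(2)] by (simp add: xs x gfun_Cons)
qed

lemma alternating_gfun: assumes "alt_modes C" shows "alternating (gfun N C)"
  unfolding alternating_def
proof (intro allI)
  fix xs :: "'a point list" and x y ys D b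
  let ?i = "length xs"
  have "gfun N C (xs @ x # y # ys) D b = gfun N (\<lambda>ps. C (swap_at ?i ps)) (xs @ y # x # ys) D b"
    by (subst gfun_swap_at) (simp_all add: swap_at_append)
  also have "\<dots> = gfun N (\<lambda>ps k b. - 1 * C ps k b) (xs @ y # x # ys) D b"
  proof (rule gfun_cong)
    fix ps :: "(bool \<times> nat) list" and k b
    assume "length ps = length (xs @ y # x # ys)"
    then obtain ps1 g h ps2 where ps: "ps = ps1 @ g # h # ps2" "length ps1 = ?i"
      using split_at2[of ?i ps] by auto
    have "swap_at ?i ps = ps1 @ h # g # ps2" using swap_at_append[of ps1 g h ps2] ps by simp
    then show "C (swap_at ?i ps) k b = - 1 * C ps k b"
      using alt_modesD[OF assms, of ps1 h g ps2 k b] ps by simp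
  qed
  also have "\<dots> = - gfun N C (xs @ y # x # ys) D b"
    using gfun_scale[of N "-1" C] by simp
  finally show "gfun N C (xs @ x # y # ys) D b = - gfun N C (xs @ y # x # ys) D b" .
qed

text \<open>Over an infinite field a polynomial function determines its coefficients; the induction splits off one
  variable at a time.\<close>

lemma gfun_unique:
  assumes "\<And>xs D b. length xs = q \<Longrightarrow> gfun N C xs D b = 0"
    "length ps = q" "\<forall>p\<in>set ps. snd p \<le> N" "k \<le> N"
  shows "C ps k b = 0"
  using assms
proof (induction q arbitrary: C ps)
  case 0
  show ?case
    using power_sum_eq_zero[where N = N and a = "\<lambda>k. C [] k b" and n = k] 0(1)[of "[]" _ b] 0(2,4) by (simp add: gfun_Nil)
next
  case (Suc q)
  obtain g n qs where ps: "ps = (g, n) # qs" "length qs = q" "n \<le> N" "\<forall>p\<in>set qs. snd p \<le> N"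
    using Suc.prems by (cases ps) auto
  have "gfun N (mode_ins (g, n) C) xs D b = 0" if xs: "length xs = q" for xs D b
  proof -
    have "(\<Sum>n\<le>N. l ^ n * gfun N (mode_ins (g, n) C) xs D b) = 0" for l
      using Suc.prems(1)[of "(if g then 0 else 1, if g then 1 else 0, l) # xs" D b] xs
      by (cases g) (simp_all add: gfun_Cons)
    from power_sum_eq_zero[OF this ps(3)] show ?thesis .
  qed
  from Suc.IH[OF this ps(2,4) Suc.prems(4)] show ?case by (simp add: ps mode_ins_def)
qed

text \<open>\<open>g\<close> is a polynomial function whose coefficient at \<open>x\<close> is \<open>a\<close>, that is, \<open>a\<close> is its derivative at \<open>0\<close>.\<close>

definition lin_coeff :: "('f::field_char_0 \<Rightarrow> 'f) \<Rightarrow> 'f \<Rightarrow> bool" where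
  "lin_coeff g a \<longleftrightarrow> (\<exists>p. (\<forall>x. g x = poly p x) \<and> coeff p 1 = a)"

lemma lin_coeff_unique:
  assumes "lin_coeff g a" "lin_coeff g c"
  shows "a = c"
proof -
  obtain p r where *: "\<forall>x. g x = poly p x" "coeff p 1 = a" "\<forall>x. g x = poly r x" "coeff r 1 = c"
    using assms unfolding lin_coeff_def by auto
  then have "poly p = poly r" by auto
  then have "p = r" by (simp only: poly_eq_poly_eq_iff)
  then show ?thesis using * by simp
qed

lemma lin_coeff_const: "lin_coeff (\<lambda>x. c) 0"
  unfolding lin_coeff_def by (rule exI[of _ "[:c:]"]) (simp add: coeff_pCons)

lemma lin_coeff_id: "lin_coeff (\<lambda>x. x) 1"
  unfolding lin_coeff_def by (rule exI[of _ "[:0, 1:]"]) (simp add: coeff_pCons)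

lemma lin_coeff_add:
  assumes "lin_coeff g a" "lin_coeff h c"
  shows "lin_coeff (\<lambda>x. g x + h x) (a + c)"
proof -
  obtain p r where "\<forall>x. g x = poly p x" "coeff p 1 = a" "\<forall>x. h x = poly r x" "coeff r 1 = c"
    using assms unfolding lin_coeff_def by auto
  then show ?thesis unfolding lin_coeff_def
    by (intro exI[of _ "p + r"]) simp
qed

lemma lin_coeff_mult:
  assumes "lin_coeff g a" "lin_coeff h c"
  shows "lin_coeff (\<lambda>x. g x * h x) (g 0 * c + a * h 0)"
proof -
  obtain p r where "\<forall>x. g x = poly p x" "coeff p 1 = a" "\<forall>x. h x = poly r x" "coeff r 1 = c"
    using assms unfolding lin_coeff_def by auto
  then show ?thesis unfolding lin_coeff_def
    by (intro exI[of _ "p * r"]) (simp add: coeff_mult poly_0_coeff_0)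
qed

lemma lin_coeff_scale: "lin_coeff g a \<Longrightarrow> lin_coeff (\<lambda>x. c * g x) (c * a)"
  using lin_coeff_mult[OF lin_coeff_const[of c], of g a] by simp

lemma lin_coeff_diff: "lin_coeff g a \<Longrightarrow> lin_coeff h c \<Longrightarrow> lin_coeff (\<lambda>x. g x - h x) (a - c)"
  using lin_coeff_add[OF _ lin_coeff_scale[of h c "-1"], of g a] by simp

lemma lin_coeff_sum: "(\<And>i. i \<in> I \<Longrightarrow> lin_coeff (g i) (a i)) \<Longrightarrow> lin_coeff (\<lambda>x. \<Sum>i\<in>I. g i x) (\<Sum>i\<in>I. a i)"
  by (induction I rule: infinite_finite_induct) (auto intro: lin_coeff_add lin_coeff_const)

lemma lin_coeff_power: "lin_coeff (\<lambda>x. (D + x) ^ k) (of_nat k * D ^ (k - 1))"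
proof (induction k)
  case 0
  show ?case using lin_coeff_const[of 1] by simp
next
  case (Suc k)
  have "lin_coeff (\<lambda>x. D + x) (0 + 1)" by (intro lin_coeff_add lin_coeff_const lin_coeff_id)
  from lin_coeff_mult[OF this Suc] show ?case by (cases k) (simp_all add: algebra_simps)
qed

lemma lin_coeff_power_sum: "1 \<le> N \<Longrightarrow> lin_coeff (\<lambda>x. \<Sum>n\<le>N. x ^ n * a n) (a 1)"
  unfolding lin_coeff_def
  by (rule exI[of _ "\<Sum>n\<le>N. monom (a n) n"]) (simp add: poly_sum poly_monom coeff_sum mult.commute)

lemma lie_zero: "lie x (\<lambda>xs D b. 0) xs D b = 0"
  using lie_lin[of x 0 "\<lambda>xs D b. 0" 0 "\<lambda>xs D b. 0" xs D b] by simp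

lemma lie_sum: "lie x (\<lambda>xs D b. \<Sum>i\<in>I. c i * F i xs D b) xs D b = (\<Sum>i\<in>I. c i * lie x (F i) xs D b)"
proof (induction I rule: infinite_finite_induct)
  case (insert i I)
  then show ?case
    using lie_lin[of x "c i" "F i" 1 "\<lambda>xs D b. \<Sum>i\<in>I. c i * F i xs D b" xs D b] by simp
qed (simp_all add: lie_zero)

lemma cd_sum: "cd (\<lambda>xs D b. \<Sum>i\<in>I. c i * F i xs D b) xs D b = (\<Sum>i\<in>I. c i * cd (F i) xs D b)"
proof (induction I rule: infinite_finite_induct)
  case (insert i I)
  then show ?case
    using cd_lin[of "c i" "F i" 1 "\<lambda>xs D b. \<Sum>i\<in>I. c i * F i xs D b" xs D b] by simp
qed (simp_all add: cd_zero)

definition exp_sum :: "(bool \<times> nat) list \<Rightarrow> nat" where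
  "exp_sum ps = sum_list (map snd ps)"

lemma exp_sum_simps [simp]: "exp_sum [] = 0" "exp_sum (p # ps) = snd p + exp_sum ps"
  by (simp_all add: exp_sum_def)

text \<open>The eigenvalue of the Virasoro operator \<open>L\<^sub>0\<close>: the degree, plus the conformal weight \<open>2\<close> of the value, minus
  one for each argument.\<close>

definition weigh :: "'f::field_char_0 modes \<Rightarrow> 'f modes" where
  "weigh C ps k b = (of_nat (exp_sum ps + k) + 2 - of_nat (length ps)) * C ps k b"

lemma mode_ins_weigh: "mode_ins (g, n) (weigh C) = (\<lambda>ps k b. 1 * weigh (mode_ins (g, n) C) ps k b + (of_nat n - 1) * mode_ins (g, n) C ps k b)"
  by (intro ext) (simp add: weigh_def mode_ins_def algebra_simps)

lemma ins_gfun: "ins (p, q, l) (gfun N C) = (\<lambda>xs D b. \<Sum>n\<le>N. l ^ n *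
     (p * gfun N (mode_ins (False, n) C) xs D b + q * gfun N (mode_ins (True, n) C) xs D b))"
  by (intro ext) (simp add: ins_def gfun_Cons)

text \<open>The coefficient of \<open>x\<close> in \<open>\<theta>\<close> is the Euler operator up to a shift.  For \<open>\<partial>\<^sup>k\<close> it comes from
  \<open>(D + 2 x) (D + x)\<^sup>k = D\<^sup>k\<^sup>+\<^sup>1 + (k + 2) D\<^sup>k x + \<dots>\<close>, and for the exponent \<open>n\<close> of a slot from
  \<open>- (x - l) (x + l)\<^sup>n = l\<^sup>n\<^sup>+\<^sup>1 + (n - 1) l\<^sup>n x + \<dots>\<close>.\<close>

lemma lin_coeff_lie: "lin_coeff (\<lambda>x. lie (1, 0, x) (gfun N C) xs D b) (gfun N (weigh C) xs D b)"
proof (induction xs arbitrary: C)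
  case Nil
  have *: "lin_coeff (\<lambda>x. (D + 2 * x) * (D + x) ^ k) (D * (of_nat k * D ^ (k - 1)) + 2 * D ^ k)" for k
  proof -
    have "lin_coeff (\<lambda>x. D + 2 * x) (0 + 2 * 1)" by (intro lin_coeff_add lin_coeff_const lin_coeff_scale lin_coeff_id)
    from lin_coeff_mult[OF this lin_coeff_power[of D k]] show ?thesis by simp
  qed
  have "lin_coeff (\<lambda>x. \<Sum>k\<le>N. C [] k b * ((D + 2 * x) * (D + x) ^ k))
          (\<Sum>k\<le>N. C [] k b * (D * (of_nat k * D ^ (k - 1)) + 2 * D ^ k))"
    by (intro lin_coeff_sum lin_coeff_scale *)
  moreover have "(\<lambda>x. \<Sum>k\<le>N. C [] k b * ((D + 2 * x) * (D + x) ^ k)) = (\<lambda>x. lie (1, 0, x) (gfun N C) [] D b)"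
    by (intro ext) (simp add: lie_Nil gfun_Nil sum_distrib_left mult_ac)
  moreover have "(\<Sum>k\<le>N. C [] k b * (D * (of_nat k * D ^ (k - 1)) + 2 * D ^ k)) = gfun N (weigh C) [] D b"
    unfolding gfun_Nil
  proof (intro sum.cong refl)
    fix k show "C [] k b * (D * (of_nat k * D ^ (k - 1)) + 2 * D ^ k) = D ^ k * weigh C [] k b"
      by (cases k) (simp_all add: weigh_def algebra_simps)
  qed
  ultimately show ?case by (simp only:)
next
  case (Cons y ys)
  obtain p q l where y: "y = (p, q, l)" by (cases y)
  let ?G = "\<lambda>g n. gfun N (mode_ins (g, n) C) ys D b"
  let ?W_neg1 = "\<lambda>g n. gfun N (weigh (mode_ins (g, n) C)) ys D b"
  have "lin_coeff (\<lambda>x. lie (1, 0, x) (ins y (gfun N C)) ys D b)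
      (\<Sum>n\<le>N. l ^ n * (p * ?W_neg1 False n + q * ?W_neg1 True n))"
  proof -
    have "lie (1, 0, x) (ins y (gfun N C)) ys D b = (\<Sum>n\<le>N. l ^ n *
        (p * lie (1, 0, x) (gfun N (mode_ins (False, n) C)) ys D b + q * lie (1, 0, x) (gfun N (mode_ins (True, n) C)) ys D b))" for x
      unfolding y ins_gfun lie_sum lie_lin ..
    then show ?thesis by (simp only:) (intro lin_coeff_sum lin_coeff_scale lin_coeff_add Cons.IH)
  qed
  note 1 = this
  have "lin_coeff (\<lambda>x. gfun N C (br (1, 0, x) y # ys) D b)
      (\<Sum>n\<le>N. (1 - of_nat n) * l ^ n * (p * ?G False n + q * ?G True n))"
  proof -
    have *: "lin_coeff (\<lambda>x. (x - l) * (l + x) ^ n) ((1 - of_nat n) * l ^ n)" for n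
    proof -
      have "lin_coeff (\<lambda>x. x - l) (1 - 0)" by (intro lin_coeff_diff lin_coeff_const lin_coeff_id)
      from lin_coeff_mult[OF this lin_coeff_power[of l n]] show ?thesis
        by (cases n) (simp_all add: algebra_simps)
    qed
    have "gfun N C (br (1, 0, x) y # ys) D b = (\<Sum>n\<le>N. (p * ?G False n + q * ?G True n) * ((x - l) * (l + x) ^ n))" for x
      unfolding y br.simps gfun_Cons by (intro sum.cong refl) (simp add: algebra_simps)
    moreover have "lin_coeff (\<lambda>x. \<Sum>n\<le>N. (p * ?G False n + q * ?G True n) * ((x - l) * (l + x) ^ n))
        (\<Sum>n\<le>N. (p * ?G False n + q * ?G True n) * ((1 - of_nat n) * l ^ n))"
      by (intro lin_coeff_sum lin_coeff_scale *)
    ultimately show ?thesis by (simp add: mult_ac)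
  qed
  note 2 = this
  have "lin_coeff (\<lambda>x. lie (1, 0, x) (gfun N C) (y # ys) D b)
      ((\<Sum>n\<le>N. l ^ n * (p * ?W_neg1 False n + q * ?W_neg1 True n)) -
       (\<Sum>n\<le>N. (1 - of_nat n) * l ^ n * (p * ?G False n + q * ?G True n)))"
    unfolding lie_Cons by (rule lin_coeff_diff[OF 1 2])
  moreover have "(\<Sum>n\<le>N. l ^ n * (p * ?W_neg1 False n + q * ?W_neg1 True n)) -
       (\<Sum>n\<le>N. (1 - of_nat n) * l ^ n * (p * ?G False n + q * ?G True n)) = gfun N (weigh C) (y # ys) D b"
    unfolding y gfun_Cons mode_ins_weigh gfun_lin sum_subtractf[symmetric]
    by (intro sum.cong refl) (simp add: algebra_simps)
  ultimately show ?case by (simp only:)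
qed

section \<open>Reduction to weight zero\<close>

definition fscale :: "'f::field_char_0 \<Rightarrow> 'f fam \<Rightarrow> 'f fam" where
  "fscale c F = (\<lambda>xs D b. c * F xs D b)"

lemma fscale_apply [simp]: "fscale c F xs D b = c * F xs D b"
  by (simp add: fscale_def)

lemma fam_apply [simp]:
  fixes F G :: "'f::field_char_0 fam"
  shows "(F + G) xs D b = F xs D b + G xs D b" "(F - G) xs D b = F xs D b - G xs D b"
    "(- F) xs D b = - F xs D b" "(0 :: 'f fam) xs D b = 0"
  by simp_all

lemma sum_fam_apply:
  fixes F :: "'i \<Rightarrow> 'f::field_char_0 fam"
  shows "sum F I xs D b = (\<Sum>i\<in>I. F i xs D b)"
  by (induction I rule: infinite_finite_induct) simp_all

lemma vector_space_fscale: "vector_space (fscale :: 'f::field_char_0 \<Rightarrow> _)"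
  by unfold_locales (auto simp: fun_eq_iff algebra_simps)

lemma cd_hom: "cd (F + G) = cd F + cd G" "cd (F - G) = cd F - cd G" "cd (fscale c F) = fscale c (cd F)" "cd 0 = 0"
proof -
  have eq: "F + G = (\<lambda>xs D b. 1 * F xs D b + 1 * G xs D b)" "F - G = (\<lambda>xs D b. 1 * F xs D b + (- 1) * G xs D b)"
    "fscale c F = (\<lambda>xs D b. c * F xs D b + 0 * F xs D b)" "0 = (\<lambda>xs D b. 0)"
    by (simp_all add: fun_eq_iff)
  show "cd (F + G) = cd F + cd G" unfolding eq(1) by (intro ext) (simp only: cd_lin, simp)
  show "cd (F - G) = cd F - cd G" unfolding eq(2) by (intro ext) (simp only: cd_lin, simp)
  show "cd (fscale c F) = fscale c (cd F)" unfolding eq(3) by (intro ext) (simp only: cd_lin, simp)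
  show "cd 0 = 0" unfolding eq(4) by (intro ext) (rule cd_zero)
qed

lemma cd_sum_fam: "cd (sum F I) = (\<Sum>i\<in>I. cd (F i))"
  by (induction I rule: infinite_finite_induct) (simp_all only: sum.infinite sum.empty sum.insert cd_hom not_False_eq_True)

text \<open>The modes \<open>C\<close> are concentrated on \<open>q\<close> arguments, with all exponents at most \<open>N\<close>.\<close>

definition supp :: "nat \<Rightarrow> nat \<Rightarrow> 'f::field_char_0 modes \<Rightarrow> bool" where
  "supp q N C \<longleftrightarrow> (\<forall>ps k b. C ps k b \<noteq> 0 \<longrightarrow> length ps = q \<and> (\<forall>p\<in>set ps. snd p \<le> N) \<and> k \<le> N)"

lemma suppD: "supp q N C \<Longrightarrow> C ps k b \<noteq> 0 \<Longrightarrow> length ps = q \<and> (\<forall>p\<in>set ps. snd p \<le> N) \<and> k \<le> N"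
  unfolding supp_def by blast

lemma supp_mono: "supp q N C \<Longrightarrow> N \<le> N' \<Longrightarrow> supp q N' C"
  unfolding supp_def by fastforce

text \<open>These are exactly the families of basic \<open>q\<close>-cochains, by \<open>cochain_of_image\<close>.\<close>

definition Coch :: "nat \<Rightarrow> 'f::field_char_0 fam set" where
  "Coch q = {gfun N C | N C. alt_modes C \<and> supp q N C}"

lemma CochI: "alt_modes C \<Longrightarrow> supp q N C \<Longrightarrow> gfun N C \<in> Coch q"
  unfolding Coch_def by blast

lemma gfun_supp_mono: "supp q N C \<Longrightarrow> N \<le> N' \<Longrightarrow> gfun N' C = gfun N C"
  by (intro ext gfun_bound) (auto dest: suppD)

lemma CochE:
  assumes "F \<in> Coch q"
  obtains N C where "M \<le> N" "alt_modes C" "supp q N C" "F = gfun N C"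
proof -
  from assms obtain N C where NC: "alt_modes C" "supp q N C" "F = gfun N C" unfolding Coch_def by blast
  have "gfun (max M N) C = gfun N C" by (rule gfun_supp_mono[OF NC(2)]) simp
  then show thesis
    using that[of "max M N" C] NC(1,3) supp_mono[OF NC(2), of "max M N"] by simp
qed

lemma alt_modes_lin:
  assumes "alt_modes C" "alt_modes C'"
  shows "alt_modes (\<lambda>ps k b. c * C ps k b + e * C' ps k b)"
  unfolding alt_modes_def
proof (intro allI)
  fix ps x y qs k b
  show "c * C (ps @ x # y # qs) k b + e * C' (ps @ x # y # qs) k b =
    - (c * C (ps @ y # x # qs) k b + e * C' (ps @ y # x # qs) k b)"
    using alt_modesD[OF assms(1), of ps x y qs k b] alt_modesD[OF assms(2), of ps x y qs k b] by simp
qed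

lemma supp_lin: "supp q N C \<Longrightarrow> supp q N C' \<Longrightarrow> supp q N (\<lambda>ps k b. c * C ps k b + e * C' ps k b)"
  unfolding supp_def by (metis add.right_neutral mult_zero_right)

lemma Coch_lin: assumes "F \<in> Coch q" "G \<in> Coch q" shows "fscale c F + fscale e G \<in> Coch q"
proof -
  obtain N C where 1: "alt_modes C" "supp q N C" "F = gfun N C" using assms(1) by (rule CochE)
  obtain N' C' where 2: "N \<le> N'" "alt_modes C'" "supp q N' C'" "G = gfun N' C'" using assms(2) by (rule CochE)
  have "fscale c F + fscale e G = gfun N' (\<lambda>ps k b. c * C ps k b + e * C' ps k b)"
    by (intro ext) (simp add: 1 2 gfun_lin gfun_supp_mono[OF 1(2) 2(1), symmetric])
  moreover have "supp q N' (\<lambda>ps k b. c * C ps k b + e * C' ps k b)"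
    by (rule supp_lin[OF supp_mono[OF 1(2) 2(1)] 2(3)])
  ultimately show ?thesis using CochI[OF alt_modes_lin[OF 1(1) 2(2)], of q N' c e] by (simp only:)
qed

lemma zero_Coch: "0 \<in> Coch q"
proof -
  have "gfun 0 (\<lambda>ps k b. 0) = (0 :: 'a fam)" by (intro ext) (simp add: gfun_zero)
  moreover have "gfun 0 (\<lambda>ps k b. 0) \<in> (Coch q :: 'a fam set)" by (rule CochI) (auto simp: alt_modes_def supp_def)
  ultimately show ?thesis by (simp only:)
qed

lemma fscale_simps: "fscale 1 F = F" "fscale 0 F = 0" "fscale (- 1) F = - F"
  by (simp_all add: fun_eq_iff)

lemma Coch_add: "F \<in> Coch q \<Longrightarrow> G \<in> Coch q \<Longrightarrow> F + G \<in> Coch q"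
  using Coch_lin[of F q G 1 1] by (simp add: fscale_simps)

lemma Coch_fscale: "F \<in> Coch q \<Longrightarrow> fscale c F \<in> Coch q"
  using Coch_lin[of F q F c 0] by (simp add: fscale_simps)

lemma multilin_Coch: "F \<in> Coch q \<Longrightarrow> multilin F"
  and alternating_Coch: "F \<in> Coch q \<Longrightarrow> alternating F"
  unfolding Coch_def using multilin_gfun alternating_gfun by blast+

lemma Coch_length: "F \<in> Coch q \<Longrightarrow> length xs \<noteq> q \<Longrightarrow> F xs D b = 0"
  unfolding Coch_def by (auto intro!: gfun_length dest: suppD)

lemma supp_mode_ins: "supp (Suc q) N C \<Longrightarrow> supp q N (mode_ins g C)"
  unfolding supp_def mode_ins_def by fastforce

lemma gfun_mode_ins_Coch: "alt_modes C \<Longrightarrow> supp (Suc q) N C \<Longrightarrow> gfun N (mode_ins g C) \<in> Coch q"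
  by (intro CochI alt_modes_mode_ins supp_mode_ins)

text \<open>Setting a parameter to \<open>0\<close> picks the modes with exponent \<open>0\<close> in that slot.\<close>

lemma ins0_Coch: assumes "F \<in> Coch (Suc q)" shows "ins (1, 0, 0) F \<in> Coch q"
proof -
  obtain N C where 1: "alt_modes C" "supp (Suc q) N C" "F = gfun N C" using assms by (rule CochE)
  have "ins (1, 0, 0) F = gfun N (mode_ins (False, 0) C)"
    by (intro ext) (simp add: 1 ins_gfun sum.atMost_shift)
  then show ?thesis using gfun_mode_ins_Coch[OF 1(1,2)] by simp
qed

definition hom_part :: "nat \<Rightarrow> 'f::field_char_0 modes \<Rightarrow> 'f modes" where
  "hom_part n C ps k b = (if exp_sum ps + k = n then C ps k b else 0)"

lemma alt_modes_hom_part: "alt_modes C \<Longrightarrow> alt_modes (hom_part n C)"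
  unfolding alt_modes_def
proof (intro allI)
  fix ps x y qs k b
  assume "\<forall>ps x y qs k b. C (ps @ x # y # qs) k b = - C (ps @ y # x # qs) k b"
  then have "C (ps @ x # y # qs) k b = - C (ps @ y # x # qs) k b" by blast
  then show "hom_part n C (ps @ x # y # qs) k b = - hom_part n C (ps @ y # x # qs) k b"
    by (simp add: hom_part_def exp_sum_def add.left_commute)
qed

lemma supp_hom_part: "supp q N C \<Longrightarrow> supp q N (hom_part n C)"
  unfolding supp_def hom_part_def by auto

lemma exp_sum_bound: "\<forall>p\<in>set ps. snd p \<le> N \<Longrightarrow> exp_sum ps \<le> length ps * N"
  by (induction ps) auto

lemma gfun_dilate: "gfun N C (dilate t xs) (t * D) b = gfun N (\<lambda>ps k b. t ^ (exp_sum ps + k) * C ps k b) xs D b"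
proof (induction xs arbitrary: C)
  case Nil
  show ?case by (simp add: gfun_Nil dilate_simps power_mult_distrib mult_ac)
next
  case (Cons x xs)
  obtain p q l where x: "x = (p, q, l)" by (cases x)
  have "mode_ins (g, n) (\<lambda>ps k b. t ^ (exp_sum ps + k) * C ps k b) =
      (\<lambda>ps k b. t ^ n * (t ^ (exp_sum ps + k) * mode_ins (g, n) C ps k b))" for g n
    by (intro ext) (simp add: mode_ins_def power_add mult_ac)
  then show ?case
    unfolding x dilate_simps gfun_Cons Cons.IH
    by (simp add: gfun_scale power_mult_distrib algebra_simps)
qed

text \<open>The dilated family is a polynomial in \<open>t\<close> whose coefficients are the homogeneous components.\<close>

lemma gfun_hom_parts:
  assumes "supp q N C" "(q + 1) * N \<le> M"
  shows "gfun N C (dilate t xs) (t * D) b = (\<Sum>n\<le>M. t ^ n * gfun N (hom_part n C) xs D b)"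
proof -
  have "t ^ (exp_sum ps + k) * C ps k b = (\<Sum>n\<le>M. t ^ n * hom_part n C ps k b)" for ps k b
  proof (cases "C ps k b = 0")
    case False
    from suppD[OF assms(1) this] have "length ps = q" "\<forall>p\<in>set ps. snd p \<le> N" "k \<le> N" by auto
    with exp_sum_bound[of ps N] assms(2) have "exp_sum ps + k \<le> M" by simp
    then have "(\<Sum>n\<le>M. t ^ n * hom_part n C ps k b) = (\<Sum>n\<in>{exp_sum ps + k}. t ^ n * hom_part n C ps k b)"
      by (intro sum.mono_neutral_right) (auto simp: hom_part_def)
    then show ?thesis by (simp add: hom_part_def)
  next
    case True
    then have "hom_part n C ps k b = 0" for n by (simp add: hom_part_def)
    with True show ?thesis by simp
  qed
  then show ?thesis
    unfolding gfun_dilate by (simp add: gfun_sum gfun_scale)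
qed

lemma dilate_1: "dilate 1 xs = xs"
  by (induction xs) (auto simp: dilate_simps)

text \<open>The cochains of weight zero: homogeneous of degree \<open>q - 2\<close>.  The equation avoids a truncated difference,
  so there are only zero cochains for \<open>q < 2\<close>.\<close>

definition Coch0 :: "nat \<Rightarrow> 'f::field_char_0 fam set" where
  "Coch0 q = {gfun N C | N C. alt_modes C \<and> supp q N C \<and> (\<forall>ps k b. C ps k b \<noteq> 0 \<longrightarrow> exp_sum ps + k + 2 = q)}"

lemma Coch0_Coch: "F \<in> Coch0 q \<Longrightarrow> F \<in> Coch q"
  unfolding Coch0_def Coch_def by blast

lemma Coch0_dilate: "F \<in> Coch0 (n + 2) \<Longrightarrow> F (dilate t xs) (t * D) b = t ^ n * F xs D b"
proof -
  assume "F \<in> Coch0 (n + 2)"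
  then obtain N C where NC: "F = gfun N C" "\<forall>ps k b. C ps k b \<noteq> 0 \<longrightarrow> exp_sum ps + k + 2 = n + 2"
    unfolding Coch0_def by blast
  have "(\<lambda>ps k b. t ^ (exp_sum ps + k) * C ps k b) = (\<lambda>ps k b. t ^ n * C ps k b)"
  proof (intro ext)
    fix ps k b show "t ^ (exp_sum ps + k) * C ps k b = t ^ n * C ps k b"
      using NC(2)[rule_format, of ps k b] by (cases "C ps k b = 0") auto
  qed
  then show ?thesis by (simp add: NC(1) gfun_dilate gfun_scale)
qed

lemma zero_Coch0: "0 \<in> Coch0 q"
proof -
  have "gfun 0 (\<lambda>ps k b. 0) = (0 :: 'a fam)" by (intro ext) (simp add: gfun_zero)
  moreover have "gfun 0 (\<lambda>ps k b. 0) \<in> (Coch0 q :: 'a fam set)" unfolding Coch0_def mem_Collect_eq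
    by (rule exI[of _ 0], rule exI[of _ "\<lambda>ps k b. 0"]) (simp add: alt_modes_def supp_def)
  ultimately show ?thesis by (simp only:)
qed

lemma hom_part_Coch0: "alt_modes C \<Longrightarrow> supp (n + 2) N C \<Longrightarrow> gfun N (hom_part n C) \<in> Coch0 (n + 2)"
  unfolding Coch0_def mem_Collect_eq
  by (rule exI[of _ N], rule exI[of _ "hom_part n C"])
    (auto simp: alt_modes_hom_part supp_hom_part hom_part_def split: if_splits)

text \<open>There are no cochains in degree \<open>-1\<close>, hence the separate case.\<close>

definition Cobd :: "nat \<Rightarrow> 'f::field_char_0 fam set" where
  "Cobd q = (case q of 0 \<Rightarrow> {0} | Suc p \<Rightarrow> cd ` Coch p)"

lemma Cobd_fscale: "F \<in> Cobd q \<Longrightarrow> fscale c F \<in> Cobd q"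
  unfolding Cobd_def by (cases q) (auto simp: Coch_fscale cd_hom(3)[symmetric] fun_eq_iff intro!: imageI)

lemma Cobd_add: "F \<in> Cobd q \<Longrightarrow> G \<in> Cobd q \<Longrightarrow> F + G \<in> Cobd q"
  unfolding Cobd_def by (cases q) (auto simp: Coch_add cd_hom(1)[symmetric])

lemma zero_Cobd: "0 \<in> Cobd q"
  using zero_Coch cd_hom(4) unfolding Cobd_def by (cases q) (auto simp: image_iff intro!: bexI[OF _ zero_Coch])

lemma Cobd_sum: "(\<And>i. i \<in> I \<Longrightarrow> F i \<in> Cobd q) \<Longrightarrow> sum F I \<in> Cobd q"
  by (induction I rule: infinite_finite_induct) (auto intro: Cobd_add zero_Cobd)

text \<open>Compare coefficients of \<open>t\<close> in \<open>cd_dilate\<close>.\<close>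

lemma cocycle_hom_part:
  assumes "supp q N C" "cd (gfun N C) = 0"
  shows "cd (gfun N (hom_part n C)) = 0"
proof (intro ext, simp only: fam_apply)
  fix xs D b
  let ?M = "max n ((q + 1) * N)"
  \<comment> \<open>the factor \<open>t\<close> of \<open>cd_dilate\<close> shifts the index by one\<close>
  have "(\<Sum>m\<le>Suc ?M. t ^ m * (case m of 0 \<Rightarrow> 0 | Suc n \<Rightarrow> cd (gfun N (hom_part n C)) xs D b)) = 0" for t
  proof -
    have "dilate_fam t (gfun N C) = (\<lambda>xs D b. \<Sum>n\<le>?M. t ^ n * gfun N (hom_part n C) xs D b)"
      unfolding dilate_fam_def by (intro ext gfun_hom_parts[OF assms(1)]) simp
    then have "0 = t * (\<Sum>n\<le>?M. t ^ n * cd (gfun N (hom_part n C)) xs D b)"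
      using cd_dilate[OF multilin_gfun, of N C t xs D b] assms(2) by (simp add: cd_sum)
    also have "\<dots> = (\<Sum>m\<le>Suc ?M. t ^ m * (case m of 0 \<Rightarrow> 0 | Suc n \<Rightarrow> cd (gfun N (hom_part n C)) xs D b))"
      unfolding sum.atMost_Suc_shift by (simp add: sum_distrib_left mult_ac)
    finally show ?thesis by simp
  qed
  from power_sum_eq_zero[OF this, of "Suc n"] show "cd (gfun N (hom_part n C)) xs D b = 0" by simp
qed

text \<open>The coefficient of \<open>x\<close> in \<open>d \<iota>\<^sub>x F = \<theta>\<^sub>x F\<close>, valid for cocycles, expresses the non-zero multiple
  \<open>(n + 2 - q) F\<close> of \<open>F\<close> as the differential of the coefficient of \<open>x\<close> in \<open>\<iota>\<^sub>x F\<close>, which is the mode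
  \<open>(False, 1)\<close> inserted into \<open>C\<close>.\<close>

lemma hom_cocycle_Cobd:
  assumes C: "alt_modes C" "supp q N C" "1 \<le> N" and n: "\<And>ps k b. C ps k b \<noteq> 0 \<Longrightarrow> exp_sum ps + k = n"
    and cd: "cd (gfun N C) = 0" and w: "n + 2 \<noteq> q"
  shows "gfun N C \<in> Cobd q"
proof -
  let ?w = "of_nat n + 2 - of_nat q :: 'a"
  let ?T = "gfun N (mode_ins (False, 1) C)"
  have "of_nat (n + 2) - of_nat q \<noteq> (0 :: 'a)"
    using w by (simp only: right_minus_eq of_nat_eq_iff) simp
  then have w0: "?w \<noteq> 0" by (simp add: add.commute)
  have weigh: "weigh C = (\<lambda>ps k b. ?w * C ps k b)"
  proof (intro ext)
    fix ps k b
    show "weigh C ps k b = ?w * C ps k b"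
      using suppD[OF C(2), of ps k b] n[of ps k b] by (cases "C ps k b = 0") (auto simp: weigh_def)
  qed
  have "?w * gfun N C xs D b = cd ?T xs D b" for xs D b
  proof -
    have "lie (1, 0, x) (gfun N C) xs D b = cd (ins (1, 0, x) (gfun N C)) xs D b" for x
      using cd_Cons[of "gfun N C" "(1, 0, x)" xs D b] cd by simp
    also have "\<dots> x = (\<Sum>m\<le>N. x ^ m * cd (gfun N (mode_ins (False, m) C)) xs D b)" for x
      unfolding ins_gfun by (simp add: cd_sum)
    finally have "lin_coeff (\<lambda>x. lie (1, 0, x) (gfun N C) xs D b) (cd ?T xs D b)"
      using lin_coeff_power_sum[OF C(3)] by simp
    with lin_coeff_lie[of N C xs D b] have "gfun N (weigh C) xs D b = cd ?T xs D b" by (rule lin_coeff_unique)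
    then show ?thesis by (simp add: weigh gfun_scale)
  qed
  then have *: "gfun N C = fscale (1 / ?w) (cd ?T)"
    using w0 by (intro ext) (simp add: field_simps)
  show ?thesis
  proof (cases q)
    case 0
    have "mode_ins (False, 1) C = (\<lambda>ps k b. 0)"
      using suppD[OF C(2)] 0 by (intro ext) (fastforce simp: mode_ins_def)
    then have "?T = 0" by (intro ext) (simp add: gfun_zero)
    then have "cd ?T = 0" by (simp only: cd_hom(4))
    then have "gfun N C = 0" unfolding * by (simp add: fun_eq_iff)
    then show ?thesis by (simp add: Cobd_def 0)
  next
    case (Suc p)
    then have "?T \<in> Coch p" using C by (intro gfun_mode_ins_Coch) auto
    then show ?thesis unfolding * by (intro Cobd_fscale) (simp add: Cobd_def Suc)
  qed
qed

lemma hom_part_idem: "hom_part n C ps k b \<noteq> 0 \<Longrightarrow> exp_sum ps + k = n"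
  by (auto simp: hom_part_def split: if_splits)

text \<open>Only the homogeneous component of weight zero escapes \<open>hom_cocycle_Cobd\<close>.\<close>

theorem cocycle_weight_zero:
  assumes "F \<in> Coch q" "cd F = 0"
  obtains G where "G \<in> Coch0 q" "cd G = 0" "F - G \<in> Cobd q"
proof -
  obtain N C where NC: "1 \<le> N" "alt_modes C" "supp q N C" "F = gfun N C" using assms(1) by (rule CochE)
  let ?M = "(q + 1) * N"
  let ?F = "\<lambda>n. gfun N (hom_part n C)"
  let ?G = "\<Sum>n\<in>{n. n \<le> ?M \<and> n + 2 = q}. ?F n"
  have cyc: "cd (?F n) = 0" for n
    using assms(2) by (intro cocycle_hom_part[OF NC(3)]) (simp add: NC(4))
  have F: "F = (\<Sum>n\<le>?M. ?F n)"
    using gfun_hom_parts[OF NC(3) order_refl, of 1] by (intro ext) (simp add: NC(4) dilate_1 sum_fam_apply)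
  have "{..?M} = {n. n \<le> ?M \<and> n + 2 = q} \<union> {n. n \<le> ?M \<and> n + 2 \<noteq> q}" by auto
  then have "F - ?G = (\<Sum>n\<in>{n. n \<le> ?M \<and> n + 2 \<noteq> q}. ?F n)"
    unfolding F by (simp only: ) (subst sum.union_disjoint, auto)
  also have "\<dots> \<in> Cobd q"
    by (intro Cobd_sum hom_cocycle_Cobd[OF alt_modes_hom_part[OF NC(2)] supp_hom_part[OF NC(3)] NC(1)])
      (auto dest: hom_part_idem simp: cyc)
  finally have "F - ?G \<in> Cobd q" .
  moreover have "?G \<in> Coch0 q"
  proof (cases "\<exists>n. n + 2 = q")
    case True
    then obtain n where n: "q = n + 2" by auto
    have "n \<le> ?M" using NC(1) n by (cases N) auto
    then have "{m. m \<le> ?M \<and> m + 2 = q} = {n}" using n by auto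
    then have "?G = ?F n" by simp
    then show ?thesis using hom_part_Coch0[OF NC(2)] NC(3) n by simp
  next
    case False
    then have "{m. m \<le> ?M \<and> m + 2 = q} = {}" by auto
    then show ?thesis by (simp only: sum.empty zero_Coch0)
  qed
  moreover have "cd ?G = 0" by (simp add: cd_sum_fam cyc)
  ultimately show thesis using that by blast
qed

text \<open>The differential preserves the weight, so the component of weight zero of a primitive is a primitive.
  Together with \<open>cocycle_weight_zero\<close> this shows that the cohomology is that of the subcomplex of weight
  zero.\<close>

lemma weight_zero_boundary:
  assumes G: "G \<in> Coch0 (Suc p)" and k: "k \<in> Coch p" "G = cd k"
  obtains h where "h \<in> Coch0 p" "G = cd h"
proof -
  obtain N C where NC: "alt_modes C" "supp p N C" "k = gfun N C" using k(1) by (rule CochE)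
  let ?M = "p + (p + 1) * N"
  let ?F = "\<lambda>n. gfun N (hom_part n C)"
  have *: "cd k (dilate t xs) (t * D) b = t * (\<Sum>n\<le>?M. t ^ n * cd (?F n) xs D b)" for t xs D b
  proof -
    have "dilate_fam t (gfun N C) = (\<lambda>xs D b. \<Sum>n\<le>?M. t ^ n * gfun N (hom_part n C) xs D b)"
      unfolding dilate_fam_def by (intro ext gfun_hom_parts[OF NC(2)]) simp
    then show ?thesis using cd_dilate[OF multilin_gfun, of N C t xs D b] by (simp add: cd_sum NC(3))
  qed
  have **: "cd k (dilate t xs) (t * D) b = (\<Sum>m\<le>Suc ?M. t ^ m * (case m of 0 \<Rightarrow> 0 | Suc n \<Rightarrow> cd (?F n) xs D b))" for t xs D b
    unfolding * sum.atMost_Suc_shift by (simp add: sum_distrib_left mult_ac)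
  show thesis
  proof (cases p)
    case 0
    have "G = 0"
      using G unfolding Coch0_def 0 by (intro ext) (auto intro!: gfun_length)
    then show thesis using that[OF zero_Coch0] cd_hom(4) by simp
  next
    case (Suc n)
    have "G = (case n of 0 \<Rightarrow> 0 | Suc m \<Rightarrow> cd (?F m))"
    proof (intro ext)
      fix xs D b
      have "(\<Sum>m\<le>Suc ?M. t ^ m * ((case m of 0 \<Rightarrow> 0 | Suc n \<Rightarrow> cd (?F n) xs D b) - (if m = n then G xs D b else 0))) = 0" for t
      proof -
        have "(\<Sum>m\<le>Suc ?M. t ^ m * (if m = n then G xs D b else 0)) = t ^ n * G xs D b"
          using Suc by (simp add: if_distrib[of "\<lambda>y. _ * y"] cong: if_cong) 
        moreover have "cd k (dilate t xs) (t * D) b = t ^ n * G xs D b"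
          using Coch0_dilate[of G n t xs D b] G k(2) Suc by simp
        ultimately show ?thesis using **[of t xs D b] by (simp add: algebra_simps sum_subtractf)
      qed
      from power_sum_eq_zero[OF this, of n] show "G xs D b = (case n of 0 \<Rightarrow> 0 | Suc m \<Rightarrow> cd (?F m)) xs D b"
        using Suc by (simp split: nat.splits)
    qed
    then show thesis
      using that[of "case n of 0 \<Rightarrow> 0 | Suc m \<Rightarrow> ?F m"] zero_Coch0 cd_hom(4) hom_part_Coch0[OF NC(1), of _ N] NC(2) Suc
      by (cases n) auto
  qed
qed

section \<open>The cochains of weight zero\<close>

text \<open>The inversions of a list of modes are counted with respect to some total order of the modes.  The one
  chosen makes the lists in \<open>canon\<close> below increasing, which gives them sign one.\<close>

definition mode_key :: "bool \<times> nat \<Rightarrow> nat" where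
  "mode_key p = 2 * snd p + of_bool (fst p)"

lemma mode_key_inj: "mode_key x = mode_key y \<longleftrightarrow> x = y"
proof
  assume *: "mode_key x = mode_key y"
  have "even (mode_key p) = (\<not> fst p)" for p by (simp add: mode_key_def)
  then have "fst x = fst y" using * by metis
  with * show "x = y" by (simp add: mode_key_def prod_eq_iff)
qed simp

primrec inversions :: "(bool \<times> nat) list \<Rightarrow> nat" where
  "inversions [] = 0"
| "inversions (p # ps) = length (filter (\<lambda>r. mode_key r < mode_key p) ps) + inversions ps"

definition inv_sign :: "(bool \<times> nat) list \<Rightarrow> 'f::field_char_0" where
  "inv_sign ps = (- 1) ^ inversions ps"

lemma inv_sign_inv_sign [simp]: "inv_sign ps * inv_sign ps = (1 :: 'f::field_char_0)"
  by (simp add: inv_sign_def flip: power_mult_distrib)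

lemma inv_sign_swap: "x \<noteq> y \<Longrightarrow> inv_sign (ps @ x # y # qs) = - (inv_sign (ps @ y # x # qs) :: 'f::field_char_0)"
proof -
  assume "x \<noteq> y"
  have "even (inversions (ps @ x # y # qs)) = odd (inversions (ps @ y # x # qs))"
  proof (induction ps)
    case Nil
    have "mode_key x < mode_key y \<or> mode_key y < mode_key x"
      using mode_key_inj[of x y] \<open>x \<noteq> y\<close> by linarith
    then show ?case by auto
  next
    case (Cons p ps)
    then show ?case by auto
  qed
  then show ?thesis unfolding inv_sign_def by (cases "even (inversions (ps @ y # x # qs))") simp_all
qed

text \<open>Adjacent transpositions generate all permutations.\<close>

lemma swap_invariant_mset:
  assumes "\<And>ps x y qs. \<Phi> (ps @ x # y # qs) = \<Phi> (ps @ y # x # qs)" "mset xs = mset ys"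
  shows "\<Phi> xs = \<Phi> ys"
  using assms
proof (induction xs arbitrary: ys \<Phi>)
  case Nil
  then show ?case by simp
next
  case (Cons x xs)
  have "x \<in> set ys" using Cons.prems(2) by (metis list.set_intros(1) set_mset_mset)
  then obtain as bs where ys: "ys = as @ x # bs" by (meson split_list)
  have front: "\<Phi> (ps @ as @ x # bs) = \<Phi> (ps @ x # as @ bs)" for ps
  proof (induction as arbitrary: ps)
    case (Cons a as)
    have "\<Phi> (ps @ (a # as) @ x # bs) = \<Phi> (ps @ a # x # as @ bs)"
      using Cons[of "ps @ [a]"] by simp
    also have "\<dots> = \<Phi> (ps @ x # a # as @ bs)" by (rule \<open>\<And>ps x y qs. \<Phi> (ps @ x # y # qs) = \<Phi> (ps @ y # x # qs)\<close>)
    finally show ?case by simp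
  qed simp
  have "\<Phi> (x # xs) = \<Phi> (x # as @ bs)"
  proof (rule Cons.IH[of "\<lambda>zs. \<Phi> (x # zs)"])
    show "\<Phi> (x # ps @ y # z # qs) = \<Phi> (x # ps @ z # y # qs)" for ps y z qs
      using Cons.prems(1)[of "x # ps"] by simp
    show "mset xs = mset (as @ bs)" using Cons.prems(2) by (simp add: ys)
  qed
  then show ?case using front[of "[]"] by (simp add: ys)
qed

text \<open>\<open>C\<close> times the sign is invariant under adjacent transpositions.\<close>

lemma alt_modes_mset:
  assumes "alt_modes C" "mset ps = mset cs"
  shows "C ps k b = C cs k b * inv_sign cs * inv_sign ps"
proof -
  have "C ps k b * inv_sign ps = C cs k b * inv_sign cs"
  proof (rule swap_invariant_mset[where \<Phi> = "\<lambda>ps. C ps k b * inv_sign ps", OF _ assms(2)])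
    show "C (ps @ x # y # qs) k b * inv_sign (ps @ x # y # qs) = C (ps @ y # x # qs) k b * inv_sign (ps @ y # x # qs)" for ps x y qs
      using alt_modesD[OF assms(1), of ps x y qs k b] inv_sign_swap[of x y ps qs, where 'f = 'a] by (cases "x = y") simp_all
  qed
  then have "C ps k b * (inv_sign ps * inv_sign ps) = C cs k b * inv_sign cs * inv_sign ps" by (simp only: mult.assoc[symmetric])
  then show ?thesis by simp
qed

lemma alt_modes_distinct:
  assumes "alt_modes C" "\<not> distinct ps"
  shows "C ps k b = 0"
proof -
  obtain as x bs cs where ps: "ps = as @ [x] @ bs @ [x] @ cs" using not_distinct_decomp[OF assms(2)] by blast
  have "C (as @ x # bs @ x # cs) k b = 0"
  proof (induction bs arbitrary: as)
    case Nil
    have "C (as @ x # x # cs) k b = - C (as @ x # x # cs) k b" by (rule alt_modesD[OF assms(1)])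
    then have "2 * C (as @ x # x # cs) k b = 0" by (metis add.right_inverse mult_2)
    then show ?case by simp
  next
    case (Cons y bs)
    show ?case
      using alt_modesD[OF assms(1), of as x y "bs @ x # cs" k b] Cons[of "as @ [y]"] by simp
  qed
  then show ?thesis by (simp add: ps)
qed

text \<open>The smallest possible sum of \<open>a\<close> distinct natural numbers is \<open>0 + \<dots> + (a - 1)\<close>.\<close>

lemma sum_ge_card: "finite A \<Longrightarrow> card A * card A \<le> 2 * \<Sum>A + card A" for A :: "nat set"
proof (induction A rule: finite_linorder_max_induct)
  case (insert b A)
  have "card A \<le> b" using card_mono[of "{..<b}" A] insert by auto
  moreover have "b \<notin> A" using insert by auto
  ultimately show ?case using insert by simp
qed simp

lemma card_sum_small: "finite A \<Longrightarrow> card A = 1 \<Longrightarrow> \<Sum>A = 0 \<Longrightarrow> A = {0}"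
  "finite A \<Longrightarrow> card A = 2 \<Longrightarrow> \<Sum>A = 1 \<Longrightarrow> A = {0, 1}" for A :: "nat set"
  by (auto simp: card_1_singleton_iff card_2_iff)

text \<open>The hypotheses add up to \<open>(a - 1) (a - 2) + (b - 1) (b - 2) + 2 k \<le> 0\<close>, a sum of non-negative integers.\<close>

lemma weight_zero_exponents:
  fixes a b s t k :: nat
  assumes "a * a \<le> 2 * s + a" "b * b \<le> 2 * t + b" "s + t + k + 2 = a + b"
  shows "k = 0 \<and> ((a = 1 \<and> s = 0) \<or> (a = 2 \<and> s = 1)) \<and> ((b = 1 \<and> t = 0) \<or> (b = 2 \<and> t = 1))"
proof -
  have pos: "(int a - 1) * (int a - 2) \<ge> 0" "(int b - 1) * (int b - 2) \<ge> 0"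
    by (cases "a = 0"; cases "a = 1"; auto intro: mult_nonneg_nonneg)
      (cases "b = 0"; cases "b = 1"; auto intro: mult_nonneg_nonneg)
  have le: "int a * int a \<le> 2 * int s + int a" "int b * int b \<le> 2 * int t + int b" "int s + int t + int k + 2 = int a + int b"
  proof -
    have "int (a * a) \<le> int (2 * s + a)" "int (b * b) \<le> int (2 * t + b)" "int (s + t + k + 2) = int (a + b)"
      using assms by (simp_all only: of_nat_le_iff)
    then show "int a * int a \<le> 2 * int s + int a" "int b * int b \<le> 2 * int t + int b" "int s + int t + int k + 2 = int a + int b"
      by simp_all
  qed
  have "(int a - 1) * (int a - 2) + (int b - 1) * (int b - 2) + 2 * int k \<le> 0"
    using le by (simp add: algebra_simps)
  with pos have "k = 0" "(int a - 1) * (int a - 2) = 0" "(int b - 1) * (int b - 2) = 0" by linarith+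
  then have k: "k = 0" and a: "a = 1 \<or> a = 2" and b: "b = 1 \<or> b = 2" by auto
  then show ?thesis using assms by auto
qed

text \<open>The possible sets of modes of a cochain of weight zero, listed in increasing order.\<close>

definition canon :: "(bool \<times> nat) list list" where
  "canon = [[(False, 0), (True, 0)],
    [(False, 0), (True, 0), (False, 1)], [(False, 0), (True, 0), (True, 1)],
    [(False, 0), (True, 0), (False, 1), (True, 1)]]"

lemma weight_zero_support:
  assumes "distinct ps" "exp_sum ps + k + 2 = length ps"
  shows "k = 0 \<and> (\<exists>cs\<in>set canon. mset ps = mset cs)"
proof -
  define A where "A = {n. (False, n) \<in> set ps}"
  define B where "B = {n. (True, n) \<in> set ps}"
  have set_ps: "set ps = Pair False ` A \<union> Pair True ` B"
    unfolding A_def B_def by (auto simp: image_iff) (metis (full_types) surj_pair)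
  have fin: "finite A" "finite B"
  proof -
    have "finite (Pair False ` A)" by (rule finite_subset[of _ "set ps"]) (simp_all add: set_ps[symmetric] A_def image_subset_iff)
    moreover have "finite (Pair True ` B)" by (rule finite_subset[of _ "set ps"]) (simp_all add: set_ps[symmetric] B_def image_subset_iff)
    ultimately
    show "finite A" "finite B" by (auto dest!: finite_imageD intro: inj_onI)
  qed
  have disj: "Pair False ` A \<inter> Pair True ` B = {}" by auto
  have "exp_sum ps = (\<Sum>p\<in>set ps. snd p)"
    using assms(1) by (simp add: exp_sum_def sum_list_distinct_conv_sum_set)
  also have "\<dots> = \<Sum>A + \<Sum>B"
    unfolding set_ps using fin disj by (subst sum.union_disjoint) (auto simp: sum.reindex inj_on_def)
  finally have 1: "exp_sum ps = \<Sum>A + \<Sum>B" .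
  have "length ps = card (set ps)" using assms(1) by (simp add: distinct_card)
  also have "\<dots> = card A + card B"
    unfolding set_ps using fin disj by (subst card_Un_disjoint) (auto simp: card_image inj_on_def)
  finally have 2: "length ps = card A + card B" .
  note * = weight_zero_exponents[OF sum_ge_card[OF fin(1)] sum_ge_card[OF fin(2)]
    assms(2)[unfolded 1 2]]
  from * have AB: "A = {0} \<or> A = {0, 1}" "B = {0} \<or> B = {0, 1}"
    using card_sum_small[OF fin(1)] card_sum_small[OF fin(2)] by auto
  have "\<exists>cs\<in>set canon. Pair False ` A \<union> Pair True ` B = set cs \<and> distinct cs" (is ?P)
    using AB
  proof (elim disjE)
    assume "A = {0}" "B = {0}"
    then show ?P by (intro bexI[of _ "[(False, 0), (True, 0)]"]) (auto simp: canon_def)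
  next
    assume "A = {0, 1}" "B = {0}"
    then show ?P by (intro bexI[of _ "[(False, 0), (True, 0), (False, 1)]"]) (auto simp: canon_def)
  next
    assume "A = {0}" "B = {0, 1}"
    then show ?P by (intro bexI[of _ "[(False, 0), (True, 0), (True, 1)]"]) (auto simp: canon_def)
  next
    assume "A = {0, 1}" "B = {0, 1}"
    then show ?P by (intro bexI[of _ "[(False, 0), (True, 0), (False, 1), (True, 1)]"]) (auto simp: canon_def)
  qed
  then show ?thesis using * assms(1) by (auto simp: set_eq_iff_mset_eq_distinct set_ps[symmetric])
qed

definition bas_modes :: "(bool \<times> nat) list \<Rightarrow> bool \<Rightarrow> 'f::field_char_0 modes" where
  "bas_modes cs v ps k b = (if k = 0 \<and> b = v \<and> mset ps = mset cs then inv_sign ps else 0)"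

text \<open>The skew-symmetric polynomial in which the modes \<open>cs\<close> and their permutations occur, with the value \<open>L\<close>
  or \<open>H\<close> according to \<open>v\<close>: a product of Vandermonde polynomials in the parameters of the \<open>L\<close>'s and of the \<open>H\<close>'s.\<close>

definition bas :: "(bool \<times> nat) list \<Rightarrow> bool \<Rightarrow> 'f::field_char_0 fam" where
  "bas cs v = gfun 1 (bas_modes cs v)"

lemma canon_facts:
  assumes "cs \<in> set canon"
  shows "distinct cs" "inv_sign cs = (1 :: 'f::field_char_0)" "\<forall>p\<in>set cs. snd p \<le> 1" "exp_sum cs + 2 = length cs"
    "length cs \<in> {2, 3, 4}"
proof -
  have "distinct cs \<and> inv_sign cs = (1 :: 'f) \<and> (\<forall>p\<in>set cs. snd p \<le> 1) \<and> exp_sum cs + 2 = length cs \<and> length cs \<in> {2, 3, 4}"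
    using assms unfolding canon_def list.set insert_iff empty_iff
    by (elim disjE) (simp_all add: inv_sign_def mode_key_def)
  then show "distinct cs" "inv_sign cs = (1 :: 'f)" "\<forall>p\<in>set cs. snd p \<le> 1" "exp_sum cs + 2 = length cs"
    "length cs \<in> {2, 3, 4}" by blast+
qed

lemma alt_modes_bas_modes:
  assumes "distinct cs" shows "alt_modes (bas_modes cs v :: 'f::field_char_0 modes)"
  unfolding alt_modes_def
proof (intro allI)
  fix ps x y qs k b
  show "bas_modes cs v (ps @ x # y # qs) k b = - (bas_modes cs v (ps @ y # x # qs) k b :: 'f)"
  proof (cases "mset (ps @ x # y # qs) = mset cs")
    case True
    then have "distinct (ps @ x # y # qs)" using assms mset_eq_imp_distinct_iff by blast
    then have "x \<noteq> y" by auto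
    from inv_sign_swap[OF this, of ps qs, where 'f = 'f] show ?thesis
      by (simp add: bas_modes_def add_mset_commute)
  qed (simp add: bas_modes_def add_mset_commute)
qed

lemma mset_exp_sum: "mset ps = mset cs \<Longrightarrow> exp_sum ps = exp_sum cs"
  unfolding exp_sum_def by (metis mset_map sum_mset_sum_list)

lemma bas_Coch0:
  assumes "cs \<in> set canon"
  shows "bas cs v \<in> Coch0 (length cs)"
  unfolding Coch0_def mem_Collect_eq
proof (rule exI[of _ 1], rule exI[of _ "bas_modes cs v"], intro conjI allI impI)
  show "supp (length cs) 1 (bas_modes cs v)"
    unfolding supp_def using canon_facts(3)[OF assms]
    by (auto simp: bas_modes_def split: if_splits dest: mset_eq_length mset_eq_setD)
  show "exp_sum ps + k + 2 = length cs" if "bas_modes cs v ps k b \<noteq> 0" for ps k b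
  proof -
    have "k = 0" "mset ps = mset cs" using that by (auto simp: bas_modes_def split: if_splits)
    with mset_exp_sum[of ps cs] canon_facts(4)[OF assms] show ?thesis by simp
  qed
qed (use canon_facts(1)[OF assms] in \<open>auto simp: bas_def alt_modes_bas_modes\<close>)

text \<open>Alternating modes are supported on lists without repetition, so by \<open>weight_zero_support\<close> on permutations
  of the lists in \<open>canon\<close>, and are determined by their values on these lists.\<close>

lemma Coch0_expand:
  assumes "F \<in> Coch0 q"
  obtains c where "F = (\<Sum>cs\<leftarrow>canon. if length cs = q then fscale (c cs False) (bas cs False) + fscale (c cs True) (bas cs True) else 0)"
proof -
  obtain N C where NC: "alt_modes C" "supp q N C" "\<And>ps k b. C ps k b \<noteq> 0 \<Longrightarrow> exp_sum ps + k + 2 = q" "F = gfun N C"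
    using assms unfolding Coch0_def by blast
  let ?N = "max 1 N"
  let ?c = "\<lambda>cs b. if length cs = q then C cs 0 b else 0"
  have exp: "C ps k b = (\<Sum>cs\<leftarrow>canon. ?c cs False * bas_modes cs False ps k b + ?c cs True * bas_modes cs True ps k b)" for ps k b
  proof (cases "distinct ps \<and> exp_sum ps + k + 2 = length ps \<and> length ps = q")
    case True
    then obtain cs where cs: "k = 0" "cs \<in> set canon" "mset ps = mset cs" using weight_zero_support by blast
    have "mset ps = mset ds \<longleftrightarrow> ds = cs" if "ds \<in> set canon" for ds
      using cs that by (auto simp: canon_def add_eq_conv_ex)
    then have "(\<Sum>ds\<leftarrow>canon. ?c ds False * bas_modes ds False ps k b + ?c ds True * bas_modes ds True ps k b)
      = (\<Sum>ds\<leftarrow>canon. if ds = cs then ?c cs b * inv_sign ps else 0)"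
      using cs(1) by (intro arg_cong[of _ _ sum_list] map_cong) (auto simp: bas_modes_def)
    also have "\<dots> = ?c cs b * inv_sign ps" using cs(2) by (auto simp: canon_def)
    also have "\<dots> = C ps k b"
      using alt_modes_mset[OF NC(1) cs(3), of k b] canon_facts(2)[OF cs(2), where 'f = 'a] True cs mset_eq_length[OF cs(3)] by simp
    finally show ?thesis by simp
  next
    case False
    have "C ps k b = 0"
    proof (rule ccontr)
      assume *: "C ps k b \<noteq> 0"
      then have "distinct ps" using alt_modes_distinct[OF NC(1)] by blast
      with * NC(3)[OF *] suppD[OF NC(2) *] False show "False" by simp
    qed
    moreover have z: "?c cs v * bas_modes cs v ps k b = 0" if cs: "cs \<in> set canon" for cs v
    proof (rule ccontr)
      assume "\<not> ?thesis"
      then have *: "mset ps = mset cs" "k = 0" "length cs = q" by (auto simp: bas_modes_def split: if_splits)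
      then have "distinct ps" "exp_sum ps = exp_sum cs" "length ps = length cs"
        using canon_facts(1)[OF cs] mset_eq_imp_distinct_iff mset_exp_sum mset_eq_length by blast+
      with * canon_facts(4)[OF cs] False show False by auto
    qed
    moreover have "(\<Sum>cs\<leftarrow>canon. ?c cs False * bas_modes cs False ps k b + ?c cs True * bas_modes cs True ps k b)
        = (\<Sum>cs\<leftarrow>canon. 0)"
      by (intro arg_cong[of _ _ sum_list] map_cong refl) (simp only: z add_0)
    ultimately show ?thesis by simp
  qed
  have bas: "gfun ?N (bas_modes cs v) = bas cs v" if "cs \<in> set canon" for cs v
    unfolding bas_def using that canon_facts(3)
    by (intro gfun_supp_mono[of "length cs"])
      (auto simp: supp_def bas_modes_def split: if_splits dest: mset_eq_length mset_eq_setD)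
  have "F = gfun ?N C" unfolding NC(4) by (rule gfun_supp_mono[OF NC(2), symmetric]) simp
  also have "\<dots> = gfun ?N (\<lambda>ps k b. \<Sum>cs\<leftarrow>canon. ?c cs False * bas_modes cs False ps k b + ?c cs True * bas_modes cs True ps k b)"
    using exp by (intro arg_cong[of _ _ "gfun ?N"] ext)
  also have "\<dots> = (\<Sum>cs\<leftarrow>canon. fscale (?c cs False) (bas cs False) + fscale (?c cs True) (bas cs True))"
  proof -
    have "gfun ?N (\<lambda>ps k b. \<Sum>cs\<leftarrow>ccs. ?c cs False * bas_modes cs False ps k b + ?c cs True * bas_modes cs True ps k b) xs D b
      = (\<Sum>cs\<leftarrow>ccs. ?c cs False * gfun ?N (bas_modes cs False) xs D b + ?c cs True * gfun ?N (bas_modes cs True) xs D b)" for ccs xs D b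
      by (induction ccs) (simp_all only: list.map sum_list.Nil sum_list.Cons gfun_add gfun_scale gfun_zero)
    note 1 = this
    have "(\<Sum>cs\<leftarrow>ccs. fscale (?c cs False) (bas cs False) + fscale (?c cs True) (bas cs True)) xs D b
      = (\<Sum>cs\<leftarrow>ccs. ?c cs False * bas cs False xs D b + ?c cs True * bas cs True xs D b)" for ccs xs D b
      by (induction ccs) simp_all
    note 2 = this
    show ?thesis
    proof (intro ext, unfold 1 2)
      show "(\<Sum>cs\<leftarrow>canon. ?c cs False * gfun ?N (bas_modes cs False) xs D b + ?c cs True * gfun ?N (bas_modes cs True) xs D b)
        = (\<Sum>cs\<leftarrow>canon. ?c cs False * bas cs False xs D b + ?c cs True * bas cs True xs D b)" for xs D b
        by (intro arg_cong[of _ _ sum_list] map_cong refl) (simp only: bas)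
    qed
  qed
  also have "\<dots> = (\<Sum>cs\<leftarrow>canon. if length cs = q then fscale (C cs 0 False) (bas cs False) + fscale (C cs 0 True) (bas cs True) else 0)"
    by (intro arg_cong[of _ _ sum_list] map_cong) (auto simp: fscale_simps)
  finally show thesis by (rule that[of "\<lambda>cs. C cs 0"])
qed

section \<open>Substituting numbers into cochains\<close>

definition mon_ev :: "(nat \<Rightarrow>\<^sub>0 nat) \<Rightarrow> (nat \<Rightarrow> 'f) \<Rightarrow> 'f::field_char_0" where
  "mon_ev e \<mu> = (\<Prod>i\<in>Poly_Mapping.keys e. \<mu> i ^ Poly_Mapping.lookup e i)"

lemma mon_ev_superset:
  "finite S \<Longrightarrow> Poly_Mapping.keys e \<subseteq> S \<Longrightarrow> mon_ev e \<mu> = (\<Prod>i\<in>S. \<mu> i ^ Poly_Mapping.lookup e i)"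
  unfolding mon_ev_def by (rule prod.mono_neutral_left) (auto simp: in_keys_iff)

lemma mon_ev_add: "mon_ev (d + e) \<mu> = mon_ev d \<mu> * mon_ev e \<mu>"
proof -
  let ?S = "Poly_Mapping.keys d \<union> Poly_Mapping.keys e"
  have "mon_ev (d + e) \<mu> = (\<Prod>i\<in>?S. \<mu> i ^ Poly_Mapping.lookup (d + e) i)"
    by (intro mon_ev_superset) (auto dest: set_mp[OF Poly_Mapping.keys_add])
  also have "\<dots> = mon_ev d \<mu> * mon_ev e \<mu>"
    by (simp add: mon_ev_superset[of ?S d] mon_ev_superset[of ?S e] lookup_add power_add prod.distrib)
  finally show ?thesis .
qed

lemma mon_ev_zero [simp]: "mon_ev 0 \<mu> = 1"
  by (simp add: mon_ev_def)

lemma mon_ev_single: "mon_ev (Poly_Mapping.single i n) \<mu> = \<mu> i ^ n"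
  by (simp add: mon_ev_def)

text \<open>The coefficients are mapped to numbers by an additive \<open>h\<close>: the identity for \<open>F[\<lambda>\<^sub>0, \<lambda>\<^sub>1, \<dots>]\<close>, and a component
  at \<open>\<partial> = D\<close> for coefficients in \<open>W(-1)\<close>.\<close>

definition ev_by :: "('m::ab_group_add \<Rightarrow> 'f::field_char_0) \<Rightarrow> 'm mpol \<Rightarrow> (nat \<Rightarrow> 'f) \<Rightarrow> 'f" where
  "ev_by h p \<mu> = (\<Sum>e\<in>Poly_Mapping.keys p. mon_ev e \<mu> * h (Poly_Mapping.lookup p e))"

lemma ev_by_add:
  assumes "\<And>x y. h (x + y) = h x + h y"
  shows "ev_by h (p + q) \<mu> = ev_by h p \<mu> + ev_by h q \<mu>"
  unfolding ev_by_def by (rule keys_sum_add) (simp add: assms algebra_simps)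

lemma ev_by_single:
  assumes "h 0 = 0"
  shows "ev_by h (Poly_Mapping.single e m) \<mu> = mon_ev e \<mu> * h m"
  using assms by (cases "m = 0") (simp_all add: ev_by_def)

lemma ev_by_mult:
  fixes p q :: "'m::comm_ring_1 mpol"
  assumes "\<And>x y. h (x + y) = h x + h y" "h 0 = 0" "\<And>x y. h (x * y) = h x * h y"
  shows "ev_by h (p * q) \<mu> = ev_by h p \<mu> * ev_by h q \<mu>"
proof (induction p rule: mpol_induct)
  case p: (single d r)
  show ?case
    by (induction q rule: mpol_induct)
      (simp_all add: mult_single ev_by_single[of h, OF assms(2)] assms(3) mon_ev_add ev_by_add[of h, OF assms(1)] algebra_simps)
qed (simp_all add: ev_by_add[of h, OF assms(1)] algebra_simps)

definition ev :: "'f::field_char_0 mpol \<Rightarrow> (nat \<Rightarrow> 'f) \<Rightarrow> 'f" where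
  "ev p \<mu> = ev_by (\<lambda>x. x) p \<mu>"

lemma ev_add: "ev (p + q) \<mu> = ev p \<mu> + ev q \<mu>"
  and ev_mult: "ev (p * q) \<mu> = ev p \<mu> * ev q \<mu>"
  and ev_single: "ev (Poly_Mapping.single e r) \<mu> = mon_ev e \<mu> * r"
  and ev_lam: "ev (lam i) \<mu> = \<mu> i"
  and ev_const: "ev (const r) \<mu> = r"
  by (simp_all add: ev_def ev_by_add ev_by_mult ev_by_single lam_def const_def mon_ev_single)

lemma ev_zero: "ev 0 \<mu> = 0"
  by (simp add: ev_def ev_by_def)

lemma ev_one: "ev 1 \<mu> = 1"
  using ev_const[of 1 \<mu>] by (simp add: const_def)

lemma ev_minus: "ev (- p) \<mu> = - ev p \<mu>"
  using ev_add[of p "- p" \<mu>] by (simp add: ev_zero eq_neg_iff_add_eq_0 add.commute)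

lemma ev_power: "ev (p ^ n) \<mu> = ev p \<mu> ^ n"
  by (induction n) (simp_all add: ev_one ev_mult)

lemma ev_prod: "ev (prod f I) \<mu> = (\<Prod>i\<in>I. ev (f i) \<mu>)"
  by (induction I rule: infinite_finite_induct) (simp_all add: ev_one ev_mult)

lemma ev_sum: "ev (sum f I) \<mu> = (\<Sum>i\<in>I. ev (f i) \<mu>)"
  by (induction I rule: infinite_finite_induct) (simp_all add: ev_zero ev_add)

lemmas ev_simps = ev_add ev_mult ev_lam ev_const ev_zero ev_one ev_minus ev_power

definition comp_at :: "bool \<Rightarrow> 'f::field_char_0 \<Rightarrow> 'f poly \<times> 'f poly \<Rightarrow> 'f" where
  "comp_at b D m = poly (if b then snd m else fst m) D"

lemma comp_at_add: "comp_at b D (m + n) = comp_at b D m + comp_at b D n"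
  and comp_at_zero: "comp_at b D 0 = 0"
  and comp_at_scale: "comp_at b D (lscale W_neg1 r m) = r * comp_at b D m"
  and comp_at_der: "comp_at b D (lder W_neg1 m) = D * comp_at b D m"
  by (simp_all add: comp_at_def W_neg1_def split: prod.splits)

definition ev_comp :: "bool \<Rightarrow> ('f::field_char_0 poly \<times> 'f poly) mpol \<Rightarrow> (nat \<Rightarrow> 'f) \<Rightarrow> 'f \<Rightarrow> 'f" where
  "ev_comp b p \<mu> D = ev_by (comp_at b D) p \<mu>"

lemma ev_comp_add: "ev_comp b (p + q) \<mu> D = ev_comp b p \<mu> D + ev_comp b q \<mu> D"
  by (simp add: ev_comp_def ev_by_add comp_at_add)

lemma ev_comp_single: "ev_comp b (Poly_Mapping.single e m) \<mu> D = mon_ev e \<mu> * comp_at b D m"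
  by (simp add: ev_comp_def ev_by_single comp_at_zero)

lemma ev_comp_zero: "ev_comp b 0 \<mu> D = 0"
  by (simp add: ev_comp_def ev_by_def)

lemma ev_comp_const: "ev_comp b (const m) \<mu> D = comp_at b D m"
  by (simp add: const_def ev_comp_single)

lemma ev_comp_minus: "ev_comp b (- p) \<mu> D = - ev_comp b p \<mu> D"
  using ev_comp_add[of b p "- p" \<mu> D] by (simp add: ev_comp_zero eq_neg_iff_add_eq_0 add.commute)

lemma ev_comp_sum: "ev_comp b (sum f I) \<mu> D = (\<Sum>i\<in>I. ev_comp b (f i) \<mu> D)"
  by (induction I rule: infinite_finite_induct) (simp_all add: ev_comp_zero ev_comp_add)

lemma W_vector_space: "vector_space (lscale (W_neg1 :: ('f::field_char_0, _) lca))"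
  using W_sesquilinear by (rule sesquilinear_bracket.vector_space)

lemma adjoint_W_simps [simp]:
  "mscale (adjoint W_neg1) = lscale W_neg1" "mder (adjoint W_neg1) = lder W_neg1" "mact (adjoint W_neg1) = lbr W_neg1"
  by (simp_all add: adjoint_def)

lemma ev_comp_pscale: "ev_comp b (pscale (lscale W_neg1) s p) \<mu> D = ev s \<mu> * ev_comp b p \<mu> D"
proof (induction s rule: mpol_induct)
  case (single d r)
  show ?case
    by (induction p rule: mpol_induct)
      (simp_all add: pscale_single[OF W_vector_space] pscale_add_right[OF W_vector_space]
        ev_comp_single ev_comp_add ev_single mon_ev_add comp_at_scale algebra_simps)
qed (simp_all add: pscale_add_left[OF W_vector_space] ev_comp_add ev_add algebra_simps)

lemma ev_comp_psubst: "ev_comp b (psubst (lscale W_neg1) ls p) \<mu> D = ev_comp b p (\<lambda>i. ev (ls ! i) \<mu>) D"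
proof -
  have "ev_comp b (psubst (lscale W_neg1) ls p) \<mu> D = (\<Sum>e\<in>Poly_Mapping.keys p.
      (\<Prod>i\<in>Poly_Mapping.keys e. ev (ls ! i) \<mu> ^ Poly_Mapping.lookup e i) * comp_at b D (Poly_Mapping.lookup p e))"
    unfolding psubst_def by (simp add: ev_comp_sum ev_comp_pscale ev_comp_const ev_prod ev_power)
  then show ?thesis by (simp add: ev_comp_def ev_by_def mon_ev_def)
qed

lemma ev_comp_psubst1: "ev_comp b (psubst1 (lscale W_neg1) l p) \<mu> D = (\<Sum>i\<le>degree p. ev l \<mu> ^ i * comp_at b D (coeff p i))"
  unfolding psubst1_def by (simp add: ev_comp_sum ev_comp_pscale ev_comp_const ev_power)

lemma ev_comp_map_der: "ev_comp b (Poly_Mapping.map (lder W_neg1) p) \<mu> D = D * ev_comp b p \<mu> D"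
proof -
  interpret W: sesquilinear_bracket "W_neg1 :: ('a, _) lca" by (rule W_sesquilinear)
  show ?thesis
    by (induction p rule: mpol_induct)
      (simp_all only: W.map_D_add W.map_D_single ev_comp_add ev_comp_single comp_at_der, simp_all add: algebra_simps)
qed

text \<open>In a slot of a cochain \<open>\<partial>\<close> acts as \<open>- \<lambda>\<close>, so \<open>p(\<partial>) L + q(\<partial>) H\<close> has the coordinates \<open>p(- l)\<close> and \<open>q(- l)\<close>.\<close>

definition point :: "'f::field_char_0 poly \<times> 'f poly \<Rightarrow> 'f \<Rightarrow> 'f point" where
  "point a l = (poly (fst a) (- l), poly (snd a) (- l), l)"

lemma poly_in_lam: "poly (poly (in_lam q) u) D = poly q (poly u D)"
  by (induction q) (simp_all add: in_lam_pCons)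

lemma poly_sesqui: "poly (poly (sesqui p q) [:x:]) D = poly p (- x) * poly q (D + x) * (D + 2 * x)"
proof -
  have "poly (poly (sesqui p q) [:x:]) D =
      poly (poly (in_lam p) (poly [:0, -1:] [:x:])) D * poly (poly (in_lam q) (poly [:[:0, 1:], 1:] [:x:])) D
        * poly (poly [:[:0, 1:], 2:] [:x:]) D"
    unfolding sesqui_def by (simp add: poly_pcompose algebra_simps)
  also have "\<dots> = poly p (poly (poly [:0, -1:] [:x:]) D) * poly q (poly (poly [:[:0, 1:], 1:] [:x:]) D)
        * poly (poly [:[:0, 1:], 2:] [:x:]) D"
    by (simp only: poly_in_lam)
  finally show ?thesis by (simp add: numeral_poly algebra_simps)
qed

lemma poly_poly_sum:
  fixes P :: "'f::field_char_0 poly poly"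
  assumes "\<And>i. i > n \<Longrightarrow> coeff P i = 0"
  shows "(\<Sum>i\<le>n. x ^ i * poly (coeff P i) D) = poly (poly P [:x:]) D"
proof -
  have "degree P \<le> n" using assms by (intro degree_le) auto
  then have "poly P [:x:] = (\<Sum>i\<le>n. coeff P i * [:x:] ^ i)"
    by (subst poly_altdef) (intro sum.mono_neutral_left, auto simp: coeff_eq_0)
  then show ?thesis by (simp add: poly_sum mult.commute)
qed

text \<open>The \<open>\<lambda>\<close>-bracket of the adjoint module at \<open>\<lambda> = x\<close> and \<open>\<partial> = D\<close> is the action on families.\<close>

lemma lbr_eval:
  "(\<Sum>i\<le>degree (lbr W_neg1 a m). x ^ i * comp_at b D (coeff (lbr W_neg1 a m) i)) =
    act (point a x) (\<lambda>D b. comp_at b D m) D b"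
proof -
  obtain p1 p2 q1 q2 where am: "a = (p1, p2)" "m = (q1, q2)" by (metis surj_pair)
  let ?P = "if b then sesqui p1 q2 + sesqui p2 q1 else sesqui p1 q1"
  \<comment> \<open>\<open>?P\<close> is the component of the bracket as a polynomial in \<open>\<lambda>\<close> over \<open>F[\<partial>]\<close>; its degree may be smaller than that of the bracket\<close>
  have c: "comp_at b D (coeff (lbr W_neg1 a m) i) = poly (coeff ?P i) D" for i
    by (simp add: am W_simps comp_at_def)
  have "coeff ?P i = 0" if "i > degree (lbr W_neg1 a m)" for i
    using coeff_eq_0[OF that] by (simp add: am W_simps zero_prod_def)
  then have "(\<Sum>i\<le>degree (lbr W_neg1 a m). x ^ i * poly (coeff ?P i) D) = poly (poly ?P [:x:]) D"
    by (rule poly_poly_sum)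
  also have "\<dots> = act (point a x) (\<lambda>D b. comp_at b D m) D b"
    by (simp add: am point_def comp_at_def poly_sesqui algebra_simps)
  finally show ?thesis unfolding c .
qed

lemma act_lin: "act x (\<lambda>D b. c * \<phi> D b + e * \<psi> D b) D b = c * act x \<phi> D b + e * act x \<psi> D b"
  by (cases x) (simp add: algebra_simps)

lemma ev_comp_act_at: "ev_comp b (act_at (adjoint W_neg1) l a p) \<mu> D = act (point a (ev l \<mu>)) (\<lambda>D b. ev_comp b p \<mu> D) D b"
proof -
  interpret W: sesquilinear_bracket "W_neg1 :: ('a, _) lca" by (rule W_sesquilinear)
  show ?thesis
  proof (induction p rule: mpol_induct)
    case (single e m)
    show ?case
      using act_lin[of "point a (ev l \<mu>)" "mon_ev e \<mu>" "\<lambda>D b. comp_at b D m" 0 "\<lambda>D b. 0" D b]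
      by (simp add: W.ac_single ev_comp_pscale ev_comp_psubst1 lbr_eval ev_single ev_comp_single)
  next
    case (add p q)
    then show ?case
      using act_lin[of "point a (ev l \<mu>)" 1 "\<lambda>D b. ev_comp b p \<mu> D" 1 "\<lambda>D b. ev_comp b q \<mu> D" D b]
      by (simp add: W.ac_add_right ev_comp_add)
  qed
qed

text \<open>The bracket in a slot of a cochain: there \<open>\<partial>\<close> takes the value \<open>- (x + y)\<close>.\<close>

lemma br_point:
  assumes "multilin F"
  shows "(\<Sum>i\<le>degree (lbr W_neg1 a m). x ^ i * F (point (coeff (lbr W_neg1 a m) i) (x + y) # zs) D b) =
    F (br (point a x) (point m y) # zs) D b"
proof -
  let ?c = "\<lambda>b i. comp_at b (- (x + y)) (coeff (lbr W_neg1 a m) i)"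
  have point: "point c l = (comp_at False (- l) c, comp_at True (- l) c, l)" for c :: "'a poly \<times> 'a poly" and l
    by (simp add: point_def comp_at_def)
  have "(\<Sum>i\<le>degree (lbr W_neg1 a m). x ^ i * F (point (coeff (lbr W_neg1 a m) i) (x + y) # zs) D b)
    = (\<Sum>i\<le>degree (lbr W_neg1 a m). x ^ i * ?c False i) * F ((1, 0, x + y) # zs) D b +
      (\<Sum>i\<le>degree (lbr W_neg1 a m). x ^ i * ?c True i) * F ((0, 1, x + y) # zs) D b"
    unfolding point[of _ "x + y"] sum_distrib_right sum.distrib[symmetric]
    by (intro sum.cong refl) (subst multilinD_hd[OF assms], simp add: algebra_simps)
  also have "\<dots> = F (br (point a x) (point m y) # zs) D b"
    unfolding lbr_eval point[of a] point[of m] br.simps act.simps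
    by (subst (3) multilinD_hd[OF assms]) (simp add: algebra_simps)
  finally show ?thesis .
qed

section \<open>Polynomials and their coefficients\<close>

definition gen_point :: "bool \<Rightarrow> 'f::field_char_0 \<Rightarrow> 'f point" where
  "gen_point g l = (of_bool (\<not> g), of_bool g, l)"

lemma multilin_gens_eq:
  assumes "multilin F" "multilin G"
    and "\<And>gs ls D b. length gs = length xs \<Longrightarrow> length ls = length xs \<Longrightarrow> F (map2 gen_point gs ls) D b = G (map2 gen_point gs ls) D b"
  shows "F xs D b = G xs D b"
  using assms
proof (induction xs arbitrary: F G D b)
  case Nil
  then show ?case using Nil(3)[of "[]" "[]"] by simp
next
  case (Cons x xs)
  obtain p q l where x: "x = (p, q, l)" by (cases x)
  have "ins (gen_point g l) F xs D b = ins (gen_point g l) G xs D b" for g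
  proof (rule Cons.IH[OF multilin_ins[OF Cons.prems(1)] multilin_ins[OF Cons.prems(2)]])
    fix gs :: "bool list" and ls :: "'a list" and D b
    assume "length gs = length xs" "length ls = length xs"
    then show "ins (gen_point g l) F (map2 gen_point gs ls) D b = ins (gen_point g l) G (map2 gen_point gs ls) D b"
      using Cons.prems(3)[of "g # gs" "l # ls" D b] by (simp add: ins_def)
  qed
  from this[of False] this[of True] show ?case
    by (simp add: x ins_def gen_point_def multilinD_hd[OF Cons.prems(1), of p q] multilinD_hd[OF Cons.prems(2), of p q])
qed

definition expo_box :: "nat \<Rightarrow> nat \<Rightarrow> nat list set" where
  "expo_box n N = {es. set es \<subseteq> {..N} \<and> length es = n}"

lemma finite_expo_box: "finite (expo_box n N)"
  unfolding expo_box_def by (rule finite_lists_length_eq) simp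

lemma expo_box_Suc: "expo_box (Suc n) N = (\<lambda>(e, es). e # es) ` ({..N} \<times> expo_box n N)"
  unfolding expo_box_def by (auto simp: length_Suc_conv image_iff)

text \<open>On generators the nested sums in \<open>gfun\<close> run over all exponent vectors in a box.\<close>

lemma gfun_gens:
  assumes "length gs = n" "length ls = n"
  shows "gfun N C (map2 gen_point gs ls) D b =
    (\<Sum>es\<in>expo_box n N. (\<Prod>i<n. (ls ! i) ^ (es ! i)) * (\<Sum>k\<le>N. D ^ k * C (zip gs es) k b))"
  using assms
proof (induction n arbitrary: gs ls C)
  case 0
  have "expo_box 0 N = {[]}" by (auto simp: expo_box_def)
  with 0 show ?case by (simp add: gfun_Nil)
next
  case (Suc n)
  obtain g gs' where gs: "gs = g # gs'" "length gs' = n" using Suc.prems(1) by (cases gs) auto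
  obtain l ls' where ls: "ls = l # ls'" "length ls' = n" using Suc.prems(2) by (cases ls) auto
  have "gfun N C (map2 gen_point gs ls) D b = (\<Sum>e\<le>N. l ^ e * gfun N (mode_ins (g, e) C) (map2 gen_point gs' ls') D b)"
    by (cases g) (simp_all add: gs ls gen_point_def gfun_Cons)
  also have "\<dots> = (\<Sum>e\<le>N. \<Sum>es\<in>expo_box n N. (\<Prod>i<Suc n. (ls ! i) ^ ((e # es) ! i)) * (\<Sum>k\<le>N. D ^ k * C (zip gs (e # es)) k b))"
    unfolding Suc.IH[OF gs(2) ls(2)] prod.lessThan_Suc_shift
    by (simp add: gs ls mode_ins_def sum_distrib_left mult.assoc)
  also have "\<dots> = (\<Sum>(e, es)\<in>{..N} \<times> expo_box n N. (\<Prod>i<Suc n. (ls ! i) ^ ((e # es) ! i)) * (\<Sum>k\<le>N. D ^ k * C (zip gs (e # es)) k b))"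
    by (rule sum.cartesian_product)
  also have "\<dots> = (\<Sum>es\<in>expo_box (Suc n) N. (\<Prod>i<Suc n. (ls ! i) ^ (es ! i)) * (\<Sum>k\<le>N. D ^ k * C (zip gs es) k b))"
    unfolding expo_box_Suc by (subst sum.reindex) (auto simp: inj_on_def intro!: sum.cong)
  finally show ?case .
qed

definition vars_below :: "nat \<Rightarrow> 'm::zero mpol \<Rightarrow> bool" where
  "vars_below n p \<longleftrightarrow> (\<forall>e\<in>Poly_Mapping.keys p. Poly_Mapping.keys e \<subseteq> {..<n})"

definition degrees_le :: "nat \<Rightarrow> ('f::field_char_0 poly \<times> 'f poly) mpol \<Rightarrow> bool" where
  "degrees_le N p \<longleftrightarrow> (\<forall>e\<in>Poly_Mapping.keys p. (\<forall>i. Poly_Mapping.lookup e i \<le> N) \<and>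
     degree (fst (Poly_Mapping.lookup p e)) \<le> N \<and> degree (snd (Poly_Mapping.lookup p e)) \<le> N)"

lemma degrees_le_mono: "degrees_le N p \<Longrightarrow> N \<le> N' \<Longrightarrow> degrees_le N' p"
  unfolding degrees_le_def by (meson le_trans)

lemma degrees_le_exists: "\<exists>N. degrees_le N p"
proof -
  have exp: "\<exists>N. \<forall>i. Poly_Mapping.lookup e i \<le> N" for e :: "nat \<Rightarrow>\<^sub>0 nat"
  proof -
    have "\<forall>i. Poly_Mapping.lookup e i \<le> (\<Sum>i\<in>Poly_Mapping.keys e. Poly_Mapping.lookup e i)"
    proof
      fix i show "Poly_Mapping.lookup e i \<le> (\<Sum>i\<in>Poly_Mapping.keys e. Poly_Mapping.lookup e i)"
        by (cases "i \<in> Poly_Mapping.keys e") (auto intro: member_le_sum simp: in_keys_iff)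
    qed
    then show ?thesis by blast
  qed
  then have "\<forall>e :: nat \<Rightarrow>\<^sub>0 nat. \<exists>N. \<forall>i. Poly_Mapping.lookup e i \<le> N" by blast
  from choice[OF this] obtain M :: "(nat \<Rightarrow>\<^sub>0 nat) \<Rightarrow> nat" where M: "\<And>e i. Poly_Mapping.lookup e i \<le> M e" by blast
  let ?n = "\<lambda>e. M e + degree (fst (Poly_Mapping.lookup p e)) + degree (snd (Poly_Mapping.lookup p e))"
  have "degrees_le (\<Sum>e\<in>Poly_Mapping.keys p. ?n e) p"
    unfolding degrees_le_def
  proof (intro ballI)
    fix e assume "e \<in> Poly_Mapping.keys p"
    then have "?n e \<le> (\<Sum>e\<in>Poly_Mapping.keys p. ?n e)" by (intro member_le_sum) auto
    then show "(\<forall>i. Poly_Mapping.lookup e i \<le> (\<Sum>e\<in>Poly_Mapping.keys p. ?n e)) \<and>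
      degree (fst (Poly_Mapping.lookup p e)) \<le> (\<Sum>e\<in>Poly_Mapping.keys p. ?n e) \<and>
      degree (snd (Poly_Mapping.lookup p e)) \<le> (\<Sum>e\<in>Poly_Mapping.keys p. ?n e)"
      using M[of e] by (meson add_leE le_trans)
  qed
  then show ?thesis ..
qed

definition exponent :: "nat list \<Rightarrow> (nat \<Rightarrow>\<^sub>0 nat)" where
  "exponent es = Poly_Mapping.nth es"

lemma lookup_exponent: "Poly_Mapping.lookup (exponent es) i = (if i < length es then es ! i else 0)"
  unfolding exponent_def by (simp add: nth.rep_eq nth_default_def)

lemma inj_exponent: "inj_on exponent (expo_box n N)"
proof (rule inj_onI)
  fix es fs assume *: "es \<in> expo_box n N" "fs \<in> expo_box n N" "exponent es = exponent fs"
  then have "length es = n" "length fs = n" by (auto simp: expo_box_def)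
  then show "es = fs"
    using arg_cong[OF *(3), of Poly_Mapping.lookup] by (intro nth_equalityI) (auto simp: fun_eq_iff lookup_exponent split: if_splits)
qed

lemma exponent_expo_box:
  assumes "Poly_Mapping.keys e \<subseteq> {..<n}" "\<forall>i. Poly_Mapping.lookup e i \<le> N"
  shows "e \<in> exponent ` expo_box n N"
proof (rule image_eqI)
  show "map (Poly_Mapping.lookup e) [0..<n] \<in> expo_box n N" using assms(2) by (auto simp: expo_box_def)
  show "e = exponent (map (Poly_Mapping.lookup e) [0..<n])"
    using assms(1) by (intro poly_mapping_eqI) (auto simp: lookup_exponent in_keys_iff subset_iff)
qed

text \<open>The coefficients of the polynomials \<open>P gs\<close>, one for each list \<open>gs\<close> of generators.\<close>

definition modes_of :: "nat \<Rightarrow> (bool list \<Rightarrow> ('f::field_char_0 poly \<times> 'f poly) mpol) \<Rightarrow> 'f modes" where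
  "modes_of n P ps k b = (if length ps = n then
     coeff ((if b then snd else fst) (Poly_Mapping.lookup (P (map fst ps)) (exponent (map snd ps)))) k else 0)"

lemma mon_ev_exponent: "length es = n \<Longrightarrow> mon_ev (exponent es) \<mu> = (\<Prod>i<n. \<mu> i ^ (es ! i))"
  by (subst mon_ev_superset[of "{..<n}"]) (auto simp: lookup_exponent in_keys_iff split: if_splits)

lemma gfun_modes_of:
  assumes "length gs = n" "length ls = n" "vars_below n (P gs)" "degrees_le N (P gs)"
  shows "gfun N (modes_of n P) (map2 gen_point gs ls) D b = ev_comp b (P gs) ((!) ls) D"
proof -
  let ?p = "P gs"
  have "ev_comp b ?p ((!) ls) D = (\<Sum>e\<in>exponent ` expo_box n N. mon_ev e ((!) ls) * comp_at b D (Poly_Mapping.lookup ?p e))"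
    unfolding ev_comp_def ev_by_def
  proof (rule sum.mono_neutral_left)
    show "Poly_Mapping.keys ?p \<subseteq> exponent ` expo_box n N"
      using assms(3,4) by (auto simp: vars_below_def degrees_le_def intro!: exponent_expo_box)
  qed (auto simp: finite_expo_box in_keys_iff comp_at_zero)
  also have "\<dots> = (\<Sum>es\<in>expo_box n N. mon_ev (exponent es) ((!) ls) * comp_at b D (Poly_Mapping.lookup ?p (exponent es)))"
    by (subst sum.reindex[OF inj_exponent]) simp
  also have "\<dots> = (\<Sum>es\<in>expo_box n N. (\<Prod>i<n. (ls ! i) ^ (es ! i)) * (\<Sum>k\<le>N. D ^ k * modes_of n P (zip gs es) k b))"
  proof (rule sum.cong[OF refl])
    fix es assume "es \<in> expo_box n N"
    then have es: "length es = n" by (simp add: expo_box_def)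
    let ?u = "(if b then snd else fst) (Poly_Mapping.lookup ?p (exponent es))"
    have deg: "degree ?u \<le> N"
      using assms(4) by (cases "exponent es \<in> Poly_Mapping.keys ?p") (auto simp: degrees_le_def in_keys_iff)
    have "comp_at b D (Poly_Mapping.lookup ?p (exponent es)) = poly ?u D" by (simp add: comp_at_def)
    also have "\<dots> = (\<Sum>k\<le>N. D ^ k * coeff ?u k)"
      unfolding poly_altdef mult.commute[of "coeff _ _"]
      by (rule sum.mono_neutral_left) (use deg in \<open>auto simp: coeff_eq_0\<close>)
    finally show "mon_ev (exponent es) ((!) ls) * comp_at b D (Poly_Mapping.lookup ?p (exponent es)) =
        (\<Prod>i<n. (ls ! i) ^ (es ! i)) * (\<Sum>k\<le>N. D ^ k * modes_of n P (zip gs es) k b)"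
      using es assms(1) by (simp add: mon_ev_exponent modes_of_def)
  qed
  finally show ?thesis using gfun_gens[OF assms(1,2), of N "modes_of n P"] by simp
qed

text \<open>A polynomial with coefficients in \<open>W(-1)\<close> that vanishes at all numbers is zero: for the constant family
  \<open>P\<close>, this is \<open>gfun_unique\<close>.\<close>

lemma ev_comp_eq_zero:
  assumes "\<And>\<mu> D b. ev_comp b p \<mu> D = 0"
  shows "p = 0"
proof (rule ccontr)
  assume "p \<noteq> 0"
  then obtain e where e: "e \<in> Poly_Mapping.keys p" by (metis all_not_in_conv keys_eq_empty)
  obtain n where n: "vars_below n p"
  proof -
    have "finite (\<Union>e\<in>Poly_Mapping.keys p. Poly_Mapping.keys e)" by simp
    then obtain n where "(\<Union>e\<in>Poly_Mapping.keys p. Poly_Mapping.keys e) \<subseteq> {..<n}"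
      using finite_nat_iff_bounded by blast
    then show thesis by (intro that[of n]) (auto simp: vars_below_def)
  qed
  obtain N where N: "degrees_le N p" using degrees_le_exists by blast
  let ?C = "modes_of n (\<lambda>gs. p)"
  have "gfun N ?C xs D b = 0" if "length xs = n" for xs D b
  proof (rule multilin_gens_eq[OF multilin_gfun, of "\<lambda>xs D b. 0"])
    show "multilin (\<lambda>xs D b. 0 :: 'a)" by (simp add: multilin_def)
    show "gfun N ?C (map2 gen_point gs ls) D b = 0" if "length gs = length xs" "length ls = length xs" for gs ls D b
      using gfun_modes_of[of gs n ls "\<lambda>gs. p" N D b] that \<open>length xs = n\<close> n N assms by simp
  qed
  from gfun_unique[OF this] have C0: "?C ps k b = 0"
    if "length ps = n" "\<forall>p\<in>set ps. snd p \<le> N" "k \<le> N" for ps k b using that by blast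
  obtain es where es: "es \<in> expo_box n N" "e = exponent es"
    using exponent_expo_box[of e n N] n N e by (auto simp: vars_below_def degrees_le_def)
  have len: "length es = n" and le: "set es \<subseteq> {..N}" using es by (auto simp: expo_box_def)
  let ?u = "\<lambda>b. (if b then snd else fst) (Poly_Mapping.lookup p e)"
  have "coeff (?u b) k = 0" for b k
  proof (cases "k \<le> N")
    case True
    have "\<forall>p\<in>set (zip (replicate n False) es). snd p \<le> N" using le by (auto dest: set_zip_rightD)
    from C0[OF _ this True, of b] show ?thesis
      using len by (simp add: modes_of_def es(2))
  next
    case False
    have "degree (?u b) \<le> N" using N e by (simp add: degrees_le_def)
    with False show ?thesis by (simp add: coeff_eq_0)
  qed
  from this[of False] this[of True] have "Poly_Mapping.lookup p e = 0"
    by (simp add: prod_eq_iff poly_eq_iff)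
  with e show False by (simp add: in_keys_iff)
qed

lemma ev_comp_inj:
  assumes "\<And>\<mu> D b. ev_comp b p \<mu> D = ev_comp b q \<mu> D"
  shows "p = q"
proof -
  have "p + - q = 0" by (rule ev_comp_eq_zero) (simp only: ev_comp_add ev_comp_minus assms, simp)
  then show ?thesis by simp
qed

lemma mon_ev_cong: "Poly_Mapping.keys e \<subseteq> {..<n} \<Longrightarrow> (\<And>i. i < n \<Longrightarrow> \<mu> i = \<nu> i) \<Longrightarrow> mon_ev e \<mu> = mon_ev e \<nu>"
  unfolding mon_ev_def by (intro prod.cong) auto

lemma ev_comp_cong:
  assumes "vars_below n p" "\<And>i. i < n \<Longrightarrow> \<mu> i = \<nu> i"
  shows "ev_comp b p \<mu> D = ev_comp b p \<nu> D"
  unfolding ev_comp_def ev_by_def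
proof (rule sum.cong[OF refl])
  fix e assume "e \<in> Poly_Mapping.keys p"
  then have "Poly_Mapping.keys e \<subseteq> {..<n}" using assms(1) by (simp add: vars_below_def)
  then show "mon_ev e \<mu> * comp_at b D (Poly_Mapping.lookup p e) = mon_ev e \<nu> * comp_at b D (Poly_Mapping.lookup p e)"
    using mon_ev_cong[OF _ assms(2)] by simp
qed

text \<open>A polynomial function that does not depend on a variable does not contain it: setting the variables from
  \<open>n\<close> on to zero deletes exactly the monomials that contain one of them.\<close>

lemma vars_belowI:
  fixes p :: "('f::field_char_0 poly \<times> 'f poly) mpol"
  assumes "\<And>\<mu> \<nu> D b. (\<And>i. i < n \<Longrightarrow> \<mu> i = \<nu> i) \<Longrightarrow> ev_comp b p \<mu> D = ev_comp b p \<nu> D"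
  shows "vars_below n p"
proof -
  let ?S = "{e \<in> Poly_Mapping.keys p. Poly_Mapping.keys e \<subseteq> {..<n}}"
  let ?p = "\<Sum>e\<in>?S. Poly_Mapping.single e (Poly_Mapping.lookup p e)"
  have "p = ?p"
  proof (rule ev_comp_inj)
    fix \<mu> :: "nat \<Rightarrow> 'f" and D b
    let ?\<nu> = "\<lambda>i. if i < n then \<mu> i else 0"
    have "ev_comp b p \<mu> D = ev_comp b p ?\<nu> D" by (rule assms) simp
    also have "\<dots> = (\<Sum>e\<in>?S. mon_ev e ?\<nu> * comp_at b D (Poly_Mapping.lookup p e))"
      unfolding ev_comp_def ev_by_def
    proof (rule sum.mono_neutral_right)
      show "\<forall>e\<in>Poly_Mapping.keys p - ?S. mon_ev e ?\<nu> * comp_at b D (Poly_Mapping.lookup p e) = 0"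
      proof
        fix e assume "e \<in> Poly_Mapping.keys p - ?S"
        then obtain i where "i \<in> Poly_Mapping.keys e" "\<not> i < n" by auto
        then have "mon_ev e ?\<nu> = 0" unfolding mon_ev_def by (intro prod_zero) (auto simp: in_keys_iff intro!: bexI[of _ i])
        then show "mon_ev e ?\<nu> * comp_at b D (Poly_Mapping.lookup p e) = 0" by simp
      qed
    qed auto
    also have "\<dots> = (\<Sum>e\<in>?S. mon_ev e \<mu> * comp_at b D (Poly_Mapping.lookup p e))"
      by (intro sum.cong refl arg_cong2[of _ _ _ _ "(*)"] mon_ev_cong[of _ n]) auto
    also have "\<dots> = ev_comp b ?p \<mu> D" by (simp add: ev_comp_sum ev_comp_single)
    finally show "ev_comp b p \<mu> D = ev_comp b ?p \<mu> D" .
  qed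
  moreover have "Poly_Mapping.keys ?p \<subseteq> ?S"
  proof
    fix e assume "e \<in> Poly_Mapping.keys ?p"
    then have "(\<Sum>d\<in>?S. Poly_Mapping.lookup (Poly_Mapping.single d (Poly_Mapping.lookup p d)) e) \<noteq> 0"
      by (simp add: in_keys_iff lookup_sum)
    then obtain d where "d \<in> ?S" "Poly_Mapping.lookup (Poly_Mapping.single d (Poly_Mapping.lookup p d)) e \<noteq> 0"
      by (meson sum.not_neutral_contains_not_neutral)
    then show "e \<in> ?S" by (auto simp: lookup_single when_def split: if_splits)
  qed
  ultimately have "Poly_Mapping.keys p \<subseteq> ?S" by metis
  then show ?thesis by (auto simp: vars_below_def)
qed

text \<open>Polynomial functions are closed under products; this is why they are introduced for scalar values,
  the two components of a value in \<open>W(-1)\<close> being treated separately (\<open>poly_fun_ev_comp\<close>).\<close>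

definition poly_fun :: "((nat \<Rightarrow> 'f) \<Rightarrow> 'f::field_char_0 \<Rightarrow> 'f) \<Rightarrow> bool" where
  "poly_fun \<phi> \<longleftrightarrow> (\<exists>p :: 'f poly mpol. \<forall>\<mu> D. \<phi> \<mu> D = ev_by (\<lambda>u. poly u D) p \<mu>)"

lemma poly_fun_const: "poly_fun (\<lambda>\<mu> D. c)"
  unfolding poly_fun_def by (rule exI[of _ "Poly_Mapping.single 0 [:c:]"]) (simp add: ev_by_single)

lemma poly_fun_D: "poly_fun (\<lambda>\<mu> D. D)"
  unfolding poly_fun_def by (rule exI[of _ "Poly_Mapping.single 0 [:0, 1:]"]) (simp add: ev_by_single)

lemma poly_fun_var: "poly_fun (\<lambda>\<mu> D. \<mu> i)"
  unfolding poly_fun_def by (rule exI[of _ "Poly_Mapping.single (Poly_Mapping.single i 1) [:1:]"]) (simp add: ev_by_single mon_ev_single)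

lemma poly_fun_add: "poly_fun \<phi> \<Longrightarrow> poly_fun \<psi> \<Longrightarrow> poly_fun (\<lambda>\<mu> D. \<phi> \<mu> D + \<psi> \<mu> D)"
  unfolding poly_fun_def by (elim exE) (rule_tac x = "p + pa" in exI, simp add: ev_by_add)

lemma poly_fun_mult: "poly_fun \<phi> \<Longrightarrow> poly_fun \<psi> \<Longrightarrow> poly_fun (\<lambda>\<mu> D. \<phi> \<mu> D * \<psi> \<mu> D)"
  unfolding poly_fun_def by (elim exE) (rule_tac x = "p * pa" in exI, simp add: ev_by_mult)

lemma poly_fun_power: "poly_fun \<phi> \<Longrightarrow> poly_fun (\<lambda>\<mu> D. \<phi> \<mu> D ^ k)"
  by (induction k) (auto intro: poly_fun_mult poly_fun_const[of 1])

lemma poly_fun_sum: "(\<And>i. i \<in> I \<Longrightarrow> poly_fun (\<phi> i)) \<Longrightarrow> poly_fun (\<lambda>\<mu> D. \<Sum>i\<in>I. \<phi> i \<mu> D)"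
  by (induction I rule: infinite_finite_induct) (auto intro: poly_fun_add poly_fun_const[of 0])

lemma poly_fun_poly: "poly_fun \<phi> \<Longrightarrow> poly_fun (\<lambda>\<mu> D. poly u (\<phi> \<mu> D))"
  by (induction u) (auto intro: poly_fun_add poly_fun_const poly_fun_mult)

lemma poly_fun_gfun: "poly_fun (\<lambda>\<mu> D. gfun N C (map (\<lambda>(a, i). point a (\<mu> i)) ais) D b)"
proof (induction ais arbitrary: C)
  case Nil
  show ?case by (simp add: gfun_Nil) (intro poly_fun_sum poly_fun_mult poly_fun_power poly_fun_D poly_fun_const)
next
  case (Cons ai ais)
  obtain a i where ai: "ai = (a, i)" by (cases ai)
  have neg: "poly_fun (\<lambda>\<mu> D. - \<mu> i)" using poly_fun_mult[OF poly_fun_const[of "-1"] poly_fun_var[of i]] by simp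
  show ?case
    by (simp add: ai point_def[of a] gfun_Cons[of N C])
      (intro poly_fun_sum poly_fun_mult poly_fun_power poly_fun_add poly_fun_var poly_fun_poly neg Cons)
qed

lemma ev_by_map:
  assumes "f 0 = 0" "h 0 = 0"
  shows "ev_by h (Poly_Mapping.map f p) \<mu> = ev_by (\<lambda>u. h (f u)) p \<mu>"
proof -
  have "Poly_Mapping.lookup (Poly_Mapping.map f p) e = f (Poly_Mapping.lookup p e)" for e
    using assms(1) by (simp add: Poly_Mapping.map.rep_eq when_def)
  moreover have "ev_by h (Poly_Mapping.map f p) \<mu> =
    (\<Sum>e\<in>Poly_Mapping.keys p. mon_ev e \<mu> * h (Poly_Mapping.lookup (Poly_Mapping.map f p) e))"
    unfolding ev_by_def
    by (rule sum.mono_neutral_left) (auto simp: in_keys_iff assms Poly_Mapping.map.rep_eq when_def split: if_splits)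
  ultimately show ?thesis by (simp add: ev_by_def)
qed

lemma poly_fun_ev_comp:
  assumes "\<And>b. poly_fun (\<lambda>\<mu> D. \<phi> \<mu> D b)"
  shows "\<exists>p. \<forall>\<mu> D b. ev_comp b p \<mu> D = \<phi> \<mu> D b"
proof -
  obtain p r where pr: "\<And>\<mu> D. \<phi> \<mu> D False = ev_by (\<lambda>u. poly u D) p \<mu>" "\<And>\<mu> D. \<phi> \<mu> D True = ev_by (\<lambda>u. poly u D) r \<mu>"
    using assms[of False] assms[of True] unfolding poly_fun_def by blast
  let ?p = "Poly_Mapping.map (\<lambda>u. (u, 0)) p + Poly_Mapping.map (\<lambda>u. (0, u)) r"
  have "ev_comp b ?p \<mu> D = \<phi> \<mu> D b" for \<mu> D b
  proof -
    have z: "((0, 0) :: 'a poly \<times> 'a poly) = 0" by (simp add: zero_prod_def)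
    have e0: "ev_by (\<lambda>u. 0 :: 'a) q \<mu> = 0" for q :: "'a poly mpol" by (simp add: ev_by_def)
    have "ev_by (comp_at b D) (Poly_Mapping.map (\<lambda>u. (u, 0)) p) \<mu> = (if b then 0 else \<phi> \<mu> D False)"
      by (subst ev_by_map) (simp_all add: comp_at_zero z comp_at_def pr e0)
    moreover have "ev_by (comp_at b D) (Poly_Mapping.map (\<lambda>u. (0, u)) r) \<mu> = (if b then \<phi> \<mu> D True else 0)"
      by (subst ev_by_map) (simp_all add: comp_at_zero z comp_at_def pr e0)
    ultimately show ?thesis
      unfolding ev_comp_def by (subst ev_by_add) (simp_all add: comp_at_add)
  qed
  then show ?thesis by blast
qed

section \<open>Cochains and their families\<close>

definition points :: "('f::field_char_0 poly \<times> 'f poly) list \<Rightarrow> (nat \<Rightarrow> 'f) \<Rightarrow> 'f point list" where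
  "points as \<mu> = map (\<lambda>i. point (as ! i) (\<mu> i)) [0..<length as]"

lemma length_points [simp]: "length (points as \<mu>) = length as"
  by (simp add: points_def)

lemma nth_points: "i < length as \<Longrightarrow> points as \<mu> ! i = point (as ! i) (\<mu> i)"
  by (simp add: points_def)

lemma points_Cons: "points (a # as) \<mu> = point a (\<mu> 0) # points as (\<lambda>i. \<mu> (Suc i))"
  by (rule nth_equalityI) (auto simp: nth_points nth_Cons split: nat.split)

lemma points_update:
  assumes "i < length as"
  shows "points (as[i := a]) \<mu> = take i (points as \<mu>) @ point a (\<mu> i) # drop (Suc i) (points as \<mu>)"
proof -
  have "points (as[i := a]) \<mu> = (points as \<mu>)[i := point a (\<mu> i)]"
    using assms by (intro nth_equalityI) (auto simp: nth_points nth_list_update)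
  then show ?thesis using assms by (simp add: upd_conv_take_nth_drop)
qed

text \<open>\<open>F\<close> is the family of the cochain \<open>f\<close>.  The condition is imposed for all arguments, not only for the
  generators; since an element enters through \<open>point\<close> only, sesquilinearity of \<open>f\<close> is built in.\<close>

definition realizes :: "nat \<Rightarrow> ('f::field_char_0 poly \<times> 'f poly, 'f poly \<times> 'f poly) cochain \<Rightarrow> 'f fam \<Rightarrow> bool" where
  "realizes q f F \<longleftrightarrow> (\<forall>as. length as \<noteq> q \<longrightarrow> f as = 0) \<and>
     (\<forall>as \<mu> D b. length as = q \<longrightarrow> ev_comp b (f as) \<mu> D = F (points as \<mu>) D b)"

lemma realizesD:
  assumes "realizes q f F"
  shows "length as \<noteq> q \<Longrightarrow> f as = 0" "length as = q \<Longrightarrow> ev_comp b (f as) \<mu> D = F (points as \<mu>) D b"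
  using assms unfolding realizes_def by auto

lemma realizes_unique:
  assumes "realizes q f F" "realizes q g F"
  shows "f = g"
proof
  fix as
  show "f as = g as"
    using assms by (cases "length as = q") (auto simp: realizesD intro: ev_comp_inj)
qed

lemma alternating_move: "alternating F \<Longrightarrow> F (xs @ x # ms @ y # zs) D b = - F (xs @ y # ms @ x # zs) D b"
proof (induction ms arbitrary: xs)
  case Nil
  then show ?case using alternatingD[of F xs x y zs] by simp
next
  case (Cons m ms)
  have "F (xs @ x # (m # ms) @ y # zs) D b = - F ((xs @ [m]) @ x # ms @ y # zs) D b"
    using alternatingD[OF Cons.prems, of xs x m "ms @ y # zs"] by simp
  also have "\<dots> = F ((xs @ [m]) @ y # ms @ x # zs) D b"
    using Cons.IH[OF Cons.prems, of "xs @ [m]"] by simp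
  also have "\<dots> = - F (xs @ y # (m # ms) @ x # zs) D b"
    using alternatingD[OF Cons.prems, of xs y m "ms @ x # zs"] by simp
  finally show ?case .
qed

lemma alternating_transpose:
  assumes "alternating F" "i < j" "j < length xs"
  shows "F (permute_list (transpose i j) xs) D b = - F xs D b"
proof -
  let ?a = "take i xs" and ?m = "drop (Suc i) (take j xs)" and ?z = "drop (Suc j) xs"
  have "take j xs = take i (take j xs) @ (take j xs) ! i # drop (Suc i) (take j xs)"
    using assms by (intro id_take_nth_drop) simp
  then have "take j xs = ?a @ xs ! i # ?m" using assms by simp
  moreover have "xs = take j xs @ xs ! j # ?z" using assms by (intro id_take_nth_drop) simp
  ultimately have xs: "xs = ?a @ xs ! i # ?m @ xs ! j # ?z" by (metis append.assoc append_Cons)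
  have "permute_list (transpose i j) xs = ?a @ xs ! j # ?m @ xs ! i # ?z"
  proof (rule nth_equalityI)
    show "length (permute_list (transpose i j) xs) = length (?a @ xs ! j # ?m @ xs ! i # ?z)"
      using assms by simp
    fix k assume "k < length (permute_list (transpose i j) xs)"
    then show "permute_list (transpose i j) xs ! k = (?a @ xs ! j # ?m @ xs ! i # ?z) ! k"
      using assms by (auto simp: permute_list_def transpose_def nth_append nth_Cons' min_def)
  qed
  then show ?thesis
    using alternating_move[OF assms(1), of ?a "xs ! j" ?m "xs ! i" ?z D b] xs by simp
qed

text \<open>The sign rule for adjacent transpositions extends to all permutations, as required by skew-symmetry of
  cochains.\<close>

lemma alternating_permute:
  assumes "alternating F" "\<pi> permutes {..<length xs}"
  shows "F (permute_list \<pi> xs) D b = of_int (sign \<pi>) * F xs D b"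
  using finite_lessThan assms(2)
proof (induction rule: permutes_rev_induct)
  case id
  then show ?case by simp
next
  case (swap i j p)
  let ?t = "transpose i j"
  have "F (permute_list (p \<circ> ?t) xs) D b = F (permute_list ?t (permute_list p xs)) D b"
    using swap by (subst permute_list_compose) (auto intro: permutes_swap_id)
  also have "\<dots> = - F (permute_list p xs) D b"
  proof (cases "i < j")
    case True
    then show ?thesis using swap by (intro alternating_transpose[OF assms(1)]) auto
  next
    case False
    then have "j < i" using swap by simp
    then show ?thesis using swap
      by (subst transpose_commute) (intro alternating_transpose[OF assms(1)], auto)
  qed
  also have "- F (permute_list p xs) D b = of_int (sign (p \<circ> ?t)) * F xs D b"
  proof -
    have "permutation p" using swap permutes_imp_permutation by blast
    then have "sign (p \<circ> ?t) = - sign p"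
      using swap by (simp add: sign_compose permutation_swap_id sign_swap_id)
    then show ?thesis using swap by simp
  qed
  finally show ?case .
qed

lemma point_add: assumes "multilin F" shows "F (xs @ point (a + c) l # ys) D b = F (xs @ point a l # ys) D b + F (xs @ point c l # ys) D b"
  unfolding point_def by (subst (1 2 3) multilinD[OF assms]) (simp add: algebra_simps)

lemma point_scale: assumes "multilin F" shows "F (xs @ point (lscale W_neg1 r a) l # ys) D b = r * F (xs @ point a l # ys) D b"
  unfolding point_def by (subst (1 2) multilinD[OF assms]) (simp add: W_neg1_def algebra_simps split: prod.splits)

lemma point_der: assumes "multilin F" shows "F (xs @ point (lder W_neg1 a) l # ys) D b = - l * F (xs @ point a l # ys) D b"
  unfolding point_def by (subst (1 2) multilinD[OF assms]) (simp add: W_neg1_def algebra_simps split: prod.splits)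

lemma points_permute:
  assumes "\<pi> permutes {..<length as}" "\<And>i. i < length as \<Longrightarrow> \<nu> i = \<mu> (\<pi> i)"
  shows "points (permute_list \<pi> as) \<nu> = permute_list \<pi> (points as \<mu>)"
proof (rule nth_equalityI)
  fix i assume "i < length (points (permute_list \<pi> as) \<nu>)"
  then have i: "i < length as" by simp
  then have "\<pi> i < length as" using permutes_in_image[OF assms(1)] by simp
  then show "points (permute_list \<pi> as) \<nu> ! i = permute_list \<pi> (points as \<mu>) ! i"
    using i assms by (simp add: nth_points permute_list_nth)
qed simp

text \<open>By injectivity of the evaluation, each of the conditions on a cochain may be checked after substituting
  numbers, where it becomes a property of \<open>F\<close>.\<close>

lemma realizes_basic:
  assumes r: "realizes q f F" and F: "multilin F" "alternating F"
  shows "f \<in> basic_cochains W_neg1 (adjoint W_neg1) q"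
  unfolding basic_cochains_def mem_Collect_eq adjoint_W_simps
proof (intro conjI allI impI)
  note f = realizesD(2)[OF r]
  show "f as = 0" if "length as \<noteq> q" for as
    using realizesD(1)[OF r that] .
  show "\<forall>e\<in>Poly_Mapping.keys (f as). Poly_Mapping.keys e \<subseteq> {..<q}" for as
  proof (cases "length as = q")
    case True
    have "vars_below q (f as)"
    proof (rule vars_belowI)
      fix \<mu> \<nu> :: "nat \<Rightarrow> 'a" and D b
      assume "\<And>i. i < q \<Longrightarrow> \<mu> i = \<nu> i"
      then have "points as \<mu> = points as \<nu>" using True by (simp add: points_def)
      then show "ev_comp b (f as) \<mu> D = ev_comp b (f as) \<nu> D" by (simp add: f[OF True])
    qed
    then show ?thesis by (simp add: vars_below_def)
  next
    case False
    then show ?thesis using realizesD(1)[OF r] by simp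
  qed
  show "f (as[i := a + c]) = f (as[i := a]) + f (as[i := c])" if "length as = q \<and> i < q" for as i a c
    using that by (intro ev_comp_inj) (simp add: ev_comp_add f points_update point_add[OF F(1)])
  show "f (as[i := lscale W_neg1 c a]) = pscale (lscale W_neg1) (const c) (f (as[i := a]))" if "length as = q \<and> i < q" for as i c a
    using that by (intro ev_comp_inj) (simp add: ev_comp_pscale ev_const f points_update point_scale[OF F(1)])
  show "f (as[i := lder W_neg1 (as ! i)]) = pscale (lscale W_neg1) (- lam i) (f as)" if "length as = q \<and> i < q" for as i
  proof (rule ev_comp_inj)
    fix \<mu> D b
    have "ev_comp b (f as) \<mu> D = ev_comp b (f (as[i := as ! i])) \<mu> D" by simp
    also have "\<dots> = F (take i (points as \<mu>) @ point (as ! i) (\<mu> i) # drop (Suc i) (points as \<mu>)) D b"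
      using that by (subst f) (simp_all only: length_list_update points_update)
    finally show "ev_comp b (f (as[i := lder W_neg1 (as ! i)])) \<mu> D = ev_comp b (pscale (lscale W_neg1) (- lam i) (f as)) \<mu> D"
      using that by (simp add: ev_comp_pscale ev_simps f points_update point_der[OF F(1)])
  qed
  show "psubst (lscale W_neg1) (permute_list \<pi> (map lam [0..<q])) (f (permute_list \<pi> as)) =
      pscale (lscale W_neg1) (const (of_int (sign \<pi>))) (f as)" if "length as = q \<and> \<pi> permutes {..<q}" for as \<pi>
  proof (rule ev_comp_inj)
    fix \<mu> D b
    have \<pi>: "\<pi> permutes {..<length as}" using that by simp
    have "points (permute_list \<pi> as) (\<lambda>i. ev (permute_list \<pi> (map lam [0..<q]) ! i) \<mu>) = permute_list \<pi> (points as \<mu>)"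
    proof (rule points_permute[OF \<pi>])
      fix i assume "i < length as"
      then have "i < q" "\<pi> i < q" using that permutes_in_image[of \<pi> "{..<q}" i] by auto
      then show "ev (permute_list \<pi> (map lam [0..<q]) ! i) \<mu> = \<mu> (\<pi> i)"
        using that by (simp add: permute_list_nth ev_lam)
    qed
    then show "ev_comp b (psubst (lscale W_neg1) (permute_list \<pi> (map lam [0..<q])) (f (permute_list \<pi> as))) \<mu> D =
        ev_comp b (pscale (lscale W_neg1) (const (of_int (sign \<pi>))) (f as)) \<mu> D"
      using that alternating_permute[OF F(2), of \<pi> "points as \<mu>"]
      by (simp add: ev_comp_psubst ev_comp_pscale ev_const f)
  qed
qed

text \<open>A point, with its parameter forgotten, as an element \<open>p L + q H\<close> without \<open>\<partial>\<close>.\<close>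

definition const_elt :: "'f::field_char_0 point \<Rightarrow> 'f poly \<times> 'f poly" where
  "const_elt x = ([:fst x:], [:fst (snd x):])"

definition fam_of :: "('f::field_char_0 poly \<times> 'f poly, 'f poly \<times> 'f poly) cochain \<Rightarrow> 'f fam" where
  "fam_of f xs D b = ev_comp b (f (map const_elt xs)) (\<lambda>i. snd (snd (xs ! i))) D"

lemma realizes_fam_of:
  assumes "realizes q f F" "\<And>xs D b. length xs \<noteq> q \<Longrightarrow> F xs D b = 0"
  shows "fam_of f = F"
proof (intro ext)
  fix xs :: "'a point list" and D b
  have "points (map const_elt xs) (\<lambda>i. snd (snd (xs ! i))) = xs"
    by (rule nth_equalityI) (auto simp: nth_points point_def const_elt_def)
  then show "fam_of f xs D b = F xs D b"
    using assms(2) realizesD[OF assms(1), of "map const_elt xs"]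
    by (cases "length xs = q") (simp_all add: fam_of_def ev_comp_zero)
qed

lemma basic_cochainsD:
  assumes "f \<in> basic_cochains W_neg1 (adjoint W_neg1) q"
  shows "length as \<noteq> q \<Longrightarrow> f as = 0" "vars_below q (f as)"
    "length as = q \<Longrightarrow> i < q \<Longrightarrow> f (as[i := a + c]) = f (as[i := a]) + f (as[i := c])"
    "length as = q \<Longrightarrow> i < q \<Longrightarrow> f (as[i := lscale W_neg1 r a]) = pscale (lscale W_neg1) (const r) (f (as[i := a]))"
    "length as = q \<Longrightarrow> i < q \<Longrightarrow> f (as[i := lder W_neg1 (as ! i)]) = pscale (lscale W_neg1) (- lam i) (f as)"
    "length as = q \<Longrightarrow> \<pi> permutes {..<q} \<Longrightarrow>
      psubst (lscale W_neg1) (permute_list \<pi> (map lam [0..<q])) (f (permute_list \<pi> as)) =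
      pscale (lscale W_neg1) (const (of_int (sign \<pi>))) (f as)"
  using assms unfolding basic_cochains_def mem_Collect_eq adjoint_W_simps vars_below_def by blast+

text \<open>Sesquilinearity reduces a slot to generators: \<open>p(\<partial>) L\<close> contributes the factor \<open>p(- \<lambda>)\<close>.\<close>

lemma slot_expand:
  assumes "f \<in> basic_cochains W_neg1 (adjoint W_neg1) q" "length as = q" "i < q"
  shows "ev_comp b (f (as[i := a])) \<mu> D = comp_at False (- \<mu> i) a * ev_comp b (f (as[i := gen_L])) \<mu> D
    + comp_at True (- \<mu> i) a * ev_comp b (f (as[i := gen_H])) \<mu> D"
proof (induction a rule: W_induct)
  case 1 show ?case by (simp add: comp_at_def gen_L_def)
next
  case 2 show ?case by (simp add: comp_at_def gen_H_def)
next
  case (3 x y)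
  then show ?case using basic_cochainsD(3)[OF assms] by (simp add: ev_comp_add comp_at_add algebra_simps)
next
  case (4 r x)
  then show ?case using basic_cochainsD(4)[OF assms] by (simp add: ev_comp_pscale ev_const comp_at_scale algebra_simps)
next
  case (5 x)
  have "f (as[i := lder W_neg1 x]) = pscale (lscale W_neg1) (- lam i) (f (as[i := x]))"
    using basic_cochainsD(5)[OF assms(1), of "as[i := x]" i] assms by simp
  then show ?case using 5 by (simp add: ev_comp_pscale ev_simps comp_at_der algebra_simps)
qed

lemma slot_const_elt:
  assumes "f \<in> basic_cochains W_neg1 (adjoint W_neg1) q" "length as = q" "i < q"
  shows "ev_comp b (f (as[i := a])) \<mu> D = ev_comp b (f (as[i := const_elt (point a (\<mu> i))])) \<mu> D"
  using slot_expand[OF assms, of b a] slot_expand[OF assms, of b "const_elt (point a (\<mu> i))"]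
  by (simp add: comp_at_def const_elt_def point_def)

text \<open>By \<open>slot_expand\<close> the arguments may be replaced, one after the other, by elements without \<open>\<partial>\<close>.\<close>

lemma basic_realizes:
  assumes f: "f \<in> basic_cochains W_neg1 (adjoint W_neg1) q"
  shows "realizes q f (fam_of f)"
  unfolding realizes_def
proof (intro conjI allI impI)
  fix as :: "('a poly \<times> 'a poly) list"
  show "f as = 0" if "length as \<noteq> q" using basic_cochainsD(1)[OF f that] .
  fix \<mu> D b
  assume as: "length as = q"
  let ?c = "\<lambda>i. const_elt (point (as ! i) (\<mu> i))"
  \<comment> \<open>the first \<open>j\<close> arguments have been replaced\<close>
  have step: "ev_comp b (f as) \<mu> D = ev_comp b (f (map ?c [0..<j] @ drop j as)) \<mu> D" if "j \<le> q" for j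
    using that
  proof (induction j)
    case (Suc j)
    let ?as = "map ?c [0..<j] @ drop j as"
    have d: "drop j as = as ! j # drop (Suc j) as" using Suc as by (simp add: Cons_nth_drop_Suc)
    have "ev_comp b (f as) \<mu> D = ev_comp b (f (?as[j := as ! j])) \<mu> D"
      using Suc by (simp add: d list_update_append)
    also have "\<dots> = ev_comp b (f (?as[j := ?c j])) \<mu> D"
      using Suc as by (intro slot_const_elt[OF f]) auto
    also have "?as[j := ?c j] = map ?c [0..<Suc j] @ drop (Suc j) as"
      by (simp add: d list_update_append)
    finally show ?case .
  qed simp
  have "map ?c [0..<q] = map const_elt (points as \<mu>)" by (simp add: points_def as)
  then have "ev_comp b (f as) \<mu> D = ev_comp b (f (map const_elt (points as \<mu>))) \<mu> D" using step[of q] as by simp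
  also have "\<dots> = fam_of f (points as \<mu>) D b"
    unfolding fam_of_def by (rule ev_comp_cong[OF basic_cochainsD(2)[OF f]]) (simp add: nth_points as point_def)
  finally show "ev_comp b (f as) \<mu> D = fam_of f (points as \<mu>) D b" .
qed

lemma fam_of_length:
  assumes "f \<in> basic_cochains W_neg1 (adjoint W_neg1) q" "length xs \<noteq> q"
  shows "fam_of f xs D b = 0"
  using basic_cochainsD(1)[OF assms(1), of "map const_elt xs"] assms(2) by (simp add: fam_of_def ev_comp_zero)

lemma multilin_fam_of:
  assumes f: "f \<in> basic_cochains W_neg1 (adjoint W_neg1) q"
  shows "multilin (fam_of f)"
  unfolding multilin_def
proof (intro allI)
  fix xs :: "'a point list" and p s l ys D b
  show "fam_of f (xs @ (p, s, l) # ys) D b = p * fam_of f (xs @ (1, 0, l) # ys) D b + s * fam_of f (xs @ (0, 1, l) # ys) D b"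
  proof (cases "length xs + length ys + 1 = q")
    case True
    let ?\<mu> = "\<lambda>i. snd (snd ((xs @ (p, s, l) # ys) ! i))"
    have \<mu>: "(\<lambda>i. snd (snd ((xs @ (p', s', l) # ys) ! i))) = ?\<mu>" for p' s'
      by (intro ext) (auto simp: nth_append nth_Cons split: nat.split)
    let ?as = "map const_elt (xs @ (p, s, l) # ys)"
    have upd: "map const_elt (xs @ (p', s', l) # ys) = ?as[length xs := const_elt (p', s', l)]" for p' s'
      by (simp add: list_update_append)
    have "fam_of f (xs @ (p', s', l) # ys) D b = p' * ev_comp b (f (?as[length xs := gen_L])) ?\<mu> D
        + s' * ev_comp b (f (?as[length xs := gen_H])) ?\<mu> D" for p' s'
    proof -
      have "fam_of f (xs @ (p', s', l) # ys) D b = ev_comp b (f (?as[length xs := const_elt (p', s', l)])) ?\<mu> D"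
        unfolding fam_of_def by (subst \<mu>[of p' s'], subst upd[of p' s'], rule refl)
      also have "\<dots> = comp_at False (- ?\<mu> (length xs)) (const_elt (p', s', l)) * ev_comp b (f (?as[length xs := gen_L])) ?\<mu> D
        + comp_at True (- ?\<mu> (length xs)) (const_elt (p', s', l)) * ev_comp b (f (?as[length xs := gen_H])) ?\<mu> D"
        using True by (intro slot_expand[OF f]) auto
      finally show ?thesis by (simp add: comp_at_def const_elt_def)
    qed
    then show ?thesis by simp
  next
    case False
    then show ?thesis using fam_of_length[OF f] by simp
  qed
qed

lemma alternating_fam_of:
  assumes f: "f \<in> basic_cochains W_neg1 (adjoint W_neg1) q"
  shows "alternating (fam_of f)"
  unfolding alternating_def
proof (intro allI)
  fix xs :: "'a point list" and x y ys D b
  let ?zs = "xs @ x # y # ys" and ?i = "length xs"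
  let ?\<pi> = "transpose ?i (Suc ?i)"
  show "fam_of f ?zs D b = - fam_of f (xs @ y # x # ys) D b"
  proof (cases "length ?zs = q")
    case True
    have \<pi>: "?\<pi> permutes {..<q}" using True by (intro permutes_swap_id) auto
    have perm: "permute_list ?\<pi> ?zs = xs @ y # x # ys"
    proof (rule nth_equalityI)
      fix k assume "k < length (permute_list ?\<pi> ?zs)"
      then have k: "k < length ?zs" by simp
      have p: "permute_list ?\<pi> ?zs ! k = ?zs ! ?\<pi> k"
        using k \<pi> True by (intro permute_list_nth) auto
      show "permute_list ?\<pi> ?zs ! k = (xs @ y # x # ys) ! k"
      proof (cases "k \<le> Suc ?i")
        case True
        then consider "k < ?i" | "k = ?i" | "k = Suc ?i" by linarith
        then show ?thesis unfolding p by cases (simp_all add: transpose_def nth_append)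
      next
        case False
        then obtain m where "k = Suc (Suc ?i + m)" using less_imp_Suc_add[of "Suc ?i" k] by auto
        then show ?thesis unfolding p by (simp add: transpose_def nth_append)
      qed
    qed simp
    have "ev_comp b (f (permute_list ?\<pi> (map const_elt ?zs))) (\<lambda>i. ev (permute_list ?\<pi> (map lam [0..<q]) ! i) (\<lambda>i. snd (snd (?zs ! i)))) D
      = - fam_of f ?zs D b"
      using arg_cong[OF basic_cochainsD(6)[OF f _ \<pi>, of "map const_elt ?zs"], of "\<lambda>p. ev_comp b p (\<lambda>i. snd (snd (?zs ! i))) D"] True
      by (simp add: ev_comp_psubst ev_comp_pscale ev_const sign_swap_id fam_of_def)
    moreover have "ev_comp b (f (permute_list ?\<pi> (map const_elt ?zs))) (\<lambda>i. ev (permute_list ?\<pi> (map lam [0..<q]) ! i) (\<lambda>i. snd (snd (?zs ! i)))) D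
      = fam_of f (xs @ y # x # ys) D b"
    proof -
      have "permute_list ?\<pi> (map const_elt ?zs) = map const_elt (permute_list ?\<pi> ?zs)"
        using \<pi> True by (intro permute_list_map) simp
      then have m: "permute_list ?\<pi> (map const_elt ?zs) = map const_elt (xs @ y # x # ys)" using perm by simp
      show ?thesis unfolding m fam_of_def
      proof (rule ev_comp_cong[OF basic_cochainsD(2)[OF f]])
        fix i assume i: "i < q"
        then have "?\<pi> i < q" using permutes_in_image[OF \<pi>, of i] by simp
        then have "ev (permute_list ?\<pi> (map lam [0..<q]) ! i) (\<lambda>i. snd (snd (?zs ! i))) = snd (snd (?zs ! ?\<pi> i))"
          using i \<pi> by (simp add: permute_list_nth ev_lam)
        also have "?zs ! ?\<pi> i = permute_list ?\<pi> ?zs ! i"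
          using i \<pi> True by (simp add: permute_list_nth)
        finally show "ev (permute_list ?\<pi> (map lam [0..<q]) ! i) (\<lambda>i. snd (snd (?zs ! i))) = snd (snd ((xs @ y # x # ys) ! i))"
          unfolding perm .
      qed
    qed
    ultimately have "- fam_of f ?zs D b = fam_of f (xs @ y # x # ys) D b" by (simp only:)
    then show ?thesis by (metis add.inverse_inverse)
  next
    case False
    then show ?thesis using fam_of_length[OF f] by simp
  qed
qed

text \<open>The modes are the coefficients of the values of \<open>f\<close> on generators; they are alternating since \<open>F\<close> is,
  by uniqueness of coefficients.\<close>

lemma realizes_Coch:
  assumes r: "realizes q f F" and F: "multilin F" "alternating F" "\<And>xs D b. length xs \<noteq> q \<Longrightarrow> F xs D b = 0"
  shows "F \<in> Coch q"
proof -
  have nv: "vars_below q (f as)" for as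
    using basic_cochainsD(2)[OF realizes_basic[OF r F(1,2)]] .
  let ?g = "\<lambda>g. if g then gen_H else gen_L :: 'a poly \<times> 'a poly"
  let ?P = "\<lambda>gs. f (map ?g gs)"
  let ?gs = "{gs :: bool list. length gs = q}"
  have "\<forall>gs. \<exists>N. degrees_le N (?P gs)" using degrees_le_exists by blast
  from choice[OF this] obtain M where M: "\<And>gs. degrees_le (M gs) (?P gs)" by blast
  have fin: "finite ?gs"
    using finite_lists_length_eq[of "UNIV :: bool set" q] by simp
  define N where "N = (\<Sum>gs\<in>?gs. M gs)"
  have N: "degrees_le N (?P gs)" if "length gs = q" for gs
    using M[of gs] member_le_sum[of gs ?gs M] fin that by (auto simp: N_def intro: degrees_le_mono)
  let ?C = "modes_of q ?P"
  have supp: "supp q N ?C"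
    unfolding supp_def
  proof (intro allI impI)
    fix ps :: "(bool \<times> nat) list" and k b
    assume C: "?C ps k b \<noteq> 0"
    then have len: "length ps = q" by (auto simp: modes_of_def split: if_splits)
    let ?u = "Poly_Mapping.lookup (?P (map fst ps)) (exponent (map snd ps))"
    have c: "coeff ((if b then snd else fst) ?u) k \<noteq> 0" using C len by (simp add: modes_of_def)
    then have "?u \<noteq> 0" by (cases b) auto
    then have "exponent (map snd ps) \<in> Poly_Mapping.keys (?P (map fst ps))" by (simp add: in_keys_iff)
    with N[of "map fst ps"] len have e: "\<And>i. Poly_Mapping.lookup (exponent (map snd ps)) i \<le> N" "degree (fst ?u) \<le> N" "degree (snd ?u) \<le> N"
      by (auto simp: degrees_le_def)
    have "k \<le> N" using c e(2,3) le_degree[OF c] by (cases b) auto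
    moreover have "\<forall>p\<in>set ps. snd p \<le> N"
    proof
      fix p assume "p \<in> set ps"
      then obtain i where "i < length ps" "p = ps ! i" by (auto simp: in_set_conv_nth)
      then show "snd p \<le> N" using e(1)[of i] by (simp add: lookup_exponent)
    qed
    ultimately show "length ps = q \<and> (\<forall>p\<in>set ps. snd p \<le> N) \<and> k \<le> N" using len by simp
  qed
  have eq: "F = gfun N ?C"
  proof (intro ext)
    fix xs :: "'a point list" and D b
    show "F xs D b = gfun N ?C xs D b"
    proof (cases "length xs = q")
      case True
      show ?thesis
      proof (rule multilin_gens_eq[OF F(1) multilin_gfun])
        fix gs :: "bool list" and ls :: "'a list" and D b
        assume l: "length gs = length xs" "length ls = length xs"
        have "points (map ?g gs) ((!) ls) = map2 gen_point gs ls"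
          by (rule nth_equalityI) (use l in \<open>auto simp: nth_points point_def gen_point_def gen_L_def gen_H_def\<close>)
        then show "F (map2 gen_point gs ls) D b = gfun N ?C (map2 gen_point gs ls) D b"
          using gfun_modes_of[of gs q ls ?P N D b] l True nv N[of gs] realizesD(2)[OF r, of "map ?g gs" b "(!) ls" D] by simp
      qed
    next
      case False
      have "gfun N ?C xs D b = 0" by (rule gfun_length) (use False in \<open>simp add: modes_of_def\<close>)
      then show ?thesis using F(3)[OF False] by simp
    qed
  qed
  have "alt_modes ?C"
    unfolding alt_modes_def
  proof (intro allI)
    fix ps qs :: "(bool \<times> nat) list" and x y k b
    let ?ps = "ps @ x # y # qs" and ?ps' = "ps @ y # x # qs" and ?i = "length ps"
    show "?C ?ps k b = - ?C ?ps' k b"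
    proof (cases "length ?ps = q \<and> (\<forall>p\<in>set ?ps. snd p \<le> N) \<and> k \<le> N")
      case True
      \<comment> \<open>the generating function of \<open>?C\'\<close> is the symmetrization of \<open>F\<close>, hence zero\<close>
      let ?C' = "\<lambda>ps k b. ?C ps k b + ?C (swap_at ?i ps) k b"
      have "gfun N ?C' xs D b = 0" if xs: "length xs = q" for xs D b
      proof -
        obtain as u v bs where s: "xs = as @ u # v # bs" "length as = ?i"
          using split_at2[of ?i xs] True xs by auto
        have "gfun N ?C' xs D b = gfun N ?C xs D b + gfun N ?C (swap_at ?i xs) D b"
          using gfun_swap_at[of ?i xs N ?C D b] s by (simp add: gfun_add)
        also have "swap_at ?i xs = as @ v # u # bs" using swap_at_append[of as u v bs] s by simp
        finally show ?thesis using alternatingD[OF F(2), of as u v bs D b] by (simp add: s eq)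
      qed
      from gfun_unique[OF this, where ps = ?ps and k = k and b = b] True
      have "?C' ?ps k b = 0" by blast
      then show ?thesis by (simp add: swap_at_append eq_neg_iff_add_eq_0)
    next
      case False
      have "?C ?ps k b = 0" using suppD[OF supp, of ?ps k b] False by blast
      moreover have "?C ?ps' k b = 0" using suppD[OF supp, of ?ps' k b] False by auto
      ultimately show ?thesis by simp
    qed
  qed
  then show ?thesis using CochI[OF _ supp] eq by simp
qed

lemma Coch_realizes:
  assumes "F \<in> Coch q"
  obtains f where "realizes q f F"
proof -
  obtain N C where NC: "F = gfun N C" using assms by (rule CochE)
  have "\<exists>p. \<forall>\<mu> D b. ev_comp b p \<mu> D = F (points as \<mu>) D b" for as
  proof (rule poly_fun_ev_comp)
    fix b
    have "points as \<mu> = map (\<lambda>(a, i). point a (\<mu> i)) (zip as [0..<length as])" for \<mu>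
      by (rule nth_equalityI) (auto simp: nth_points)
    then show "poly_fun (\<lambda>\<mu> D. F (points as \<mu>) D b)" using poly_fun_gfun[of N C "zip as [0..<length as]" b] by (simp add: NC)
  qed
  then obtain f where f: "\<And>as \<mu> D b. ev_comp b (f as) \<mu> D = F (points as \<mu>) D b" by metis
  have "f as = 0" if "length as \<noteq> q" for as
    by (rule ev_comp_eq_zero) (use Coch_length[OF assms, of "points as _"] that f in simp)
  then have "realizes q f F" using f by (simp add: realizes_def)
  then show thesis by (rule that)
qed

lemma omit_Cons: "omit I (x # xs) = (if 0 \<in> I then [] else [x]) @ omit {j. Suc j \<in> I} xs"
  by (simp add: omit_def nths_Cons Compl_eq)

lemma omit_simps:
  "omit {0} (x # xs) = xs" "omit {Suc k} (x # xs) = x # omit {k} xs"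
  "omit {0, Suc l} (x # xs) = omit {l} xs" "omit {Suc k, Suc l} (x # xs) = x # omit {k, l} xs"
proof -
  have "omit {} xs = xs" by (simp add: omit_def nths_all)
  moreover have "{j. Suc j = 0} = {}" "{j. Suc j \<in> {Suc k}} = {k}" "{j. Suc j \<in> {0, Suc l}} = {l}" "{j. Suc j \<in> {Suc k, Suc l}} = {k, l}"
    by auto
  ultimately show "omit {0} (x # xs) = xs" "omit {Suc k} (x # xs) = x # omit {k} xs"
  "omit {0, Suc l} (x # xs) = omit {l} xs" "omit {Suc k, Suc l} (x # xs) = x # omit {k, l} xs"
    by (simp_all only: omit_Cons) simp_all
qed

lemma omit_single: "l < length xs \<Longrightarrow> omit {l} xs = take l xs @ drop (Suc l) xs"
proof (induction xs arbitrary: l)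
  case (Cons x xs)
  then show ?case by (cases l) (simp_all add: omit_simps)
qed simp

lemma length_omit2: "k < l \<Longrightarrow> l < length xs \<Longrightarrow> length (omit {k, l} xs) = length xs - 2"
proof (induction xs arbitrary: k l)
  case (Cons x xs)
  then obtain l' where l: "l = Suc l'" by (cases l) auto
  show ?case
  proof (cases k)
    case 0
    then show ?thesis using Cons.prems by (simp add: l omit_simps omit_single)
  next
    case (Suc k')
    then have "length (omit {k', l'} xs) = length xs - 2" using Cons by (simp add: l)
    then show ?thesis using Cons.prems Suc l by (simp add: omit_simps)
  qed
qed simp

lemma lie_explicit:
  "lie x F xs D b = act x (F xs) D b - (\<Sum>l<length xs. F (xs[l := br x (xs ! l)]) D b)"
proof (induction xs arbitrary: F)
  case (Cons y ys)
  show ?case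
    unfolding lie_Cons Cons.IH length_Cons sum.lessThan_Suc_shift by (simp add: ins_def)
qed (simp add: lie_Nil)

lemma alternating_front: "alternating F \<Longrightarrow> F (as @ z # bs) D b = (- 1) ^ length as * F (z # as @ bs) D b"
proof (induction as arbitrary: F)
  case (Cons a as)
  have "F (a # as @ z # bs) D b = (- 1) ^ length as * F (a # z # as @ bs) D b"
    using Cons.IH[OF alternating_ins[OF Cons.prems, of a]] by (simp add: ins_def)
  then show ?case using alternatingD_hd[OF Cons.prems, of a z "as @ bs" D b] by simp
qed simp

lemma alternating_update: "alternating F \<Longrightarrow> l < length xs \<Longrightarrow> F (xs[l := z]) D b = (- 1) ^ l * F (z # omit {l} xs) D b"
  using alternating_front[of F "take l xs" z "drop (Suc l) xs" D b] by (simp add: upd_conv_take_nth_drop omit_single)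

text \<open>The defining recursion of \<open>cd\<close> separates the summands that involve the first argument \<open>x\<close>.  Among the
  brackets, these are the ones of \<open>x\<close> with another argument; moving the bracket from the front to the
  position of that argument turns them into the terms of the Lie derivative.\<close>

lemma cd_explicit:
  "alternating F \<Longrightarrow> cd F xs D b = (\<Sum>k<length xs. (- 1) ^ k * act (xs ! k) (F (omit {k} xs)) D b) +
    (\<Sum>l<length xs. \<Sum>k<l. (- 1) ^ (k + l) * F (br (xs ! k) (xs ! l) # omit {k, l} xs) D b)"
proof (induction xs arbitrary: F)
  case Nil
  show ?case by (simp add: cd_Nil)
next
  case (Cons x xs)
  let ?n = "length xs"
  have a: "(\<Sum>k<length (x # xs). (- 1) ^ k * act ((x # xs) ! k) (F (omit {k} (x # xs))) D b) =
      act x (F xs) D b - (\<Sum>k<?n. (- 1) ^ k * act (xs ! k) (ins x F (omit {k} xs)) D b)"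
    unfolding length_Cons sum.lessThan_Suc_shift by (simp add: omit_simps ins_def[abs_def] sum_negf)
  have "(\<Sum>k<Suc l. (- 1) ^ (k + Suc l) * F (br ((x # xs) ! k) ((x # xs) ! Suc l) # omit {k, Suc l} (x # xs)) D b) =
      - F (xs[l := br x (xs ! l)]) D b
      - (\<Sum>k<l. (- 1) ^ (k + l) * ins x F (br (xs ! k) (xs ! l) # omit {k, l} xs) D b)" if "l < ?n" for l
  proof -
    have "F (br (xs ! k) (xs ! l) # x # omit {k, l} xs) D b = - ins x F (br (xs ! k) (xs ! l) # omit {k, l} xs) D b" for k
      unfolding ins_def by (rule alternatingD_hd[OF Cons.prems])
    then show ?thesis
      unfolding sum.lessThan_Suc_shift alternating_update[OF Cons.prems that]
      by (simp add: omit_simps sum_negf)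
  qed
  then have b: "(\<Sum>l<length (x # xs). \<Sum>k<l. (- 1) ^ (k + l) * F (br ((x # xs) ! k) ((x # xs) ! l) # omit {k, l} (x # xs)) D b)
      = - (\<Sum>l<?n. F (xs[l := br x (xs ! l)]) D b)
      - (\<Sum>l<?n. \<Sum>k<l. (- 1) ^ (k + l) * ins x F (br (xs ! k) (xs ! l) # omit {k, l} xs) D b)"
    unfolding length_Cons sum.lessThan_Suc_shift[of _ ?n] by (simp add: sum_subtractf sum_negf)
  show ?case
    unfolding a b cd_Cons Cons.IH[OF alternating_ins[OF Cons.prems]] lie_explicit by simp
qed

lemma points_omit:
  assumes "length as = n"
  shows "points (omit I as) (\<lambda>i. ev (omit I (map lam [0..<n]) ! i) \<mu>) = omit I (points as \<mu>)"
proof -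
  let ?idx = "omit I [0..<n]"
  have as: "as = map ((!) as) [0..<n]" using assms by (simp add: map_nth flip: assms)
  have 1: "omit I as = map ((!) as) ?idx" by (subst as) (simp add: omit_def nths_map)
  have 2: "omit I (map lam [0..<n]) = map lam ?idx" by (simp add: omit_def nths_map)
  have 3: "omit I (points as \<mu>) = map (\<lambda>i. point (as ! i) (\<mu> i)) ?idx" by (simp add: points_def assms omit_def nths_map)
  show ?thesis unfolding 1 2 3 by (rule nth_equalityI) (auto simp: nth_points ev_lam)
qed

text \<open>Evaluate the formula for the differential summand by summand and compare with \<open>cd_explicit\<close>.\<close>

lemma realizes_diff:
  assumes r: "realizes q f F" and F: "multilin F" "alternating F" "\<And>xs D b. length xs \<noteq> q \<Longrightarrow> F xs D b = 0"
  shows "realizes (Suc q) (diff W_neg1 (adjoint W_neg1) f) (cd F)"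
proof -
  have f: "ev_comp b (f as) \<mu> D = F (points as \<mu>) D b" for as \<mu> D b
    using realizesD[OF r, of as] F(3)[of "points as \<mu>"] by (cases "length as = q") (simp_all add: ev_comp_zero)
  have main: "ev_comp b (diff W_neg1 (adjoint W_neg1) f as) \<mu> D = cd F (points as \<mu>) D b" for as \<mu> D b
  proof -
    let ?n = "length as" and ?xs = "points as \<mu>"
    have t1: "ev_comp b (pscale (lscale W_neg1) ((- 1) ^ k) (act_at (adjoint W_neg1) (lam k) (as ! k)
          (psubst (lscale W_neg1) (omit {k} (map lam [0..<?n])) (f (omit {k} as))))) \<mu> D
        = (- 1) ^ k * act (?xs ! k) (F (omit {k} ?xs)) D b" if "k < ?n" for k
      using that by (simp add: ev_comp_pscale ev_simps ev_comp_act_at ev_comp_psubst f points_omit nth_points)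
    have t2: "ev_comp b (pscale (lscale W_neg1) ((- 1) ^ (k + l))
        (\<Sum>i\<le>degree (lbr W_neg1 (as ! k) (as ! l)). pscale (lscale W_neg1) (lam k ^ i)
          (psubst (lscale W_neg1) ((lam k + lam l) # omit {k, l} (map lam [0..<?n]))
            (f (coeff (lbr W_neg1 (as ! k) (as ! l)) i # omit {k, l} as))))) \<mu> D
        = (- 1) ^ (k + l) * F (br (?xs ! k) (?xs ! l) # omit {k, l} ?xs) D b" if "k < l" "l < ?n" for k l
      using that br_point[OF F(1), where a = "as ! k" and m = "as ! l" and x = "\<mu> k" and y = "\<mu> l" and zs = "omit {k, l} ?xs" and D = D and b = b]
      by (simp add: ev_comp_pscale ev_simps ev_comp_sum ev_comp_psubst f points_Cons points_omit nth_points)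
    show ?thesis
      unfolding diff_def Let_def adjoint_W_simps ev_comp_add ev_comp_sum cd_explicit[OF F(2)] length_points
      by (intro arg_cong2[of _ _ _ _ "(+)"] sum.cong refl) (auto simp: t1 t2)
  qed
  have "diff W_neg1 (adjoint W_neg1) f as = 0" if "length as \<noteq> Suc q" for as
  proof (rule ev_comp_eq_zero)
    fix \<mu> D b
    have "F (omit {k} (points as \<mu>)) = (\<lambda>D b. 0)" if "k < length as" for k
      using that \<open>length as \<noteq> Suc q\<close> by (intro ext F(3)) (auto simp: omit_single)
    moreover have "F (z # omit {k, l} (points as \<mu>)) D b = 0" if "k < l" "l < length as" for k l z
      using that \<open>length as \<noteq> Suc q\<close> by (intro F(3)) (auto simp: length_omit2)
    ultimately show "ev_comp b (diff W_neg1 (adjoint W_neg1) f as) \<mu> D = 0"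
      unfolding main cd_explicit[OF F(2)] length_points by (simp add: act_zero)
  qed
  then show ?thesis using main by (simp add: realizes_def)
qed

lemma realizes_cochain_der:
  assumes r: "realizes q f F"
  shows "realizes q (cochain_der (adjoint W_neg1) f) (fder F)"
  unfolding realizes_def
proof (intro conjI allI impI)
  show "cochain_der (adjoint W_neg1) f as = 0" if "length as \<noteq> q" for as
  proof (rule ev_comp_eq_zero)
    show "ev_comp b (cochain_der (adjoint W_neg1) f as) \<mu> D = 0" for \<mu> D b
      using realizesD(1)[OF r that] by (simp add: cochain_der_def ev_comp_add ev_comp_map_der ev_comp_pscale ev_comp_zero)
  qed
  fix as :: "('a poly \<times> 'a poly) list" and \<mu> D b assume as: "length as = q"
  have "(\<Sum>(p, s, l)\<leftarrow>points as \<mu>. l) = (\<Sum>k<length as. \<mu> k)"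
  proof -
    have "(\<Sum>(p, s, l)\<leftarrow>points as \<mu>. l) = (\<Sum>i\<leftarrow>[0..<length as]. \<mu> i)"
      by (simp add: points_def point_def comp_def)
    then show ?thesis by (simp add: sum_list_distinct_conv_sum_set lessThan_atLeast0)
  qed
  then show "ev_comp b (cochain_der (adjoint W_neg1) f as) \<mu> D = fder F (points as \<mu>) D b"
    using realizesD(2)[OF r as] by (simp add: cochain_der_def ev_comp_add ev_comp_map_der ev_comp_pscale ev_sum ev_lam fder_def algebra_simps)
qed

lemma cd_length:
  assumes "\<And>xs D b. length xs \<noteq> q \<Longrightarrow> F xs D b = 0" "length xs \<noteq> Suc q" "alternating F"
  shows "cd F xs D b = 0"
proof -
  have "F (omit {k} xs) = (\<lambda>D b. 0)" if "k < length xs" for k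
    using that assms(2) by (intro ext assms(1)) (auto simp: omit_single)
  moreover have "F (z # omit {k, l} xs) D b = 0" if "k < l" "l < length xs" for k l z
    using that assms(2) by (intro assms(1)) (auto simp: length_omit2)
  ultimately show ?thesis unfolding cd_explicit[OF assms(3)] by (simp add: act_zero)
qed

text \<open>That \<open>cd F\<close> is again polynomial is inherited from the differential of the cochain with family \<open>F\<close>.\<close>

lemma cd_Coch:
  assumes "F \<in> Coch q"
  shows "cd F \<in> Coch (Suc q)"
proof -
  obtain f where f: "realizes q f F" using Coch_realizes[OF assms] .
  note F = multilin_Coch[OF assms] alternating_Coch[OF assms]
  show ?thesis
    by (rule realizes_Coch[OF realizes_diff[OF f F Coch_length[OF assms]]])
      (auto intro: multilin_cd alternating_cd F cd_length Coch_length[OF assms])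
qed

lemma multilin_fder: "multilin F \<Longrightarrow> multilin (fder F)"
proof -
  assume F: "multilin F"
  have "fder F = lie (1, 0, 0) F" by (intro ext) (rule lie_0_fder[OF F, symmetric])
  then show ?thesis using multilin_lie[OF F] by simp
qed

lemma alternating_fder: "multilin F \<Longrightarrow> alternating F \<Longrightarrow> alternating (fder F)"
proof -
  assume F: "multilin F" "alternating F"
  have "fder F = lie (1, 0, 0) F" by (intro ext) (rule lie_0_fder[OF F(1), symmetric])
  then show ?thesis using alternating_lie[OF F(2)] by simp
qed

lemma fder_Coch:
  assumes "F \<in> Coch q"
  shows "fder F \<in> Coch q"
proof -
  obtain f where f: "realizes q f F" using Coch_realizes[OF assms] .
  note F = multilin_Coch[OF assms] alternating_Coch[OF assms]
  show ?thesis
    by (rule realizes_Coch[OF realizes_cochain_der[OF f]])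
      (auto intro: multilin_fder alternating_fder F simp: fder_def Coch_length[OF assms])
qed

section \<open>The differential in weight zero\<close>

text \<open>For lists of equal length a comparison of sets is enough, since \<open>cs\<close> has no repetitions; the simplifier
  decides it for concrete lists.\<close>

lemma bas_modes_eval:
  assumes "cs \<in> set canon"
  shows "bas_modes cs v ps k b =
    (if k = 0 \<and> b = v \<and> length ps = length cs \<and> set cs \<subseteq> set ps then inv_sign ps else 0)"
proof -
  have d: "distinct cs" by (rule canon_facts(1)[OF assms])
  have "mset ps = mset cs \<longleftrightarrow> length ps = length cs \<and> set cs \<subseteq> set ps"
  proof
    assume *: "length ps = length cs \<and> set cs \<subseteq> set ps"
    then have "card (set ps) \<le> card (set cs)" using card_length[of ps] distinct_card[OF d] by simp
    with * have "set cs = set ps" by (intro card_seteq) auto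
    moreover from this have "distinct ps" using * distinct_card[OF d] by (intro card_distinct) simp
    ultimately show "mset ps = mset cs" using d by (simp add: set_eq_iff_mset_eq_distinct)
  qed (auto dest: mset_eq_length mset_eq_setD)
  then show ?thesis by (simp add: bas_modes_def)
qed

text \<open>Homogeneity under the single dilation by \<open>2\<close> determines the degree, because the powers of \<open>2\<close> are distinct
  in characteristic \<open>0\<close>.\<close>

lemma Coch0I_dilate:
  assumes "F \<in> Coch (n + 2)" "\<And>t xs D b. F (dilate t xs) (t * D) b = t ^ n * F xs D b"
  shows "F \<in> Coch0 (n + 2)"
proof -
  obtain N C where NC: "alt_modes C" "supp (n + 2) N C" "F = gfun N C" using assms(1) by (rule CochE)
  have "exp_sum ps + k + 2 = n + 2" if C: "C ps k b \<noteq> 0" for ps k b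
  proof -
    have "gfun N (\<lambda>ps k b. 1 * (2 ^ (exp_sum ps + k) * C ps k b) + (- (2 ^ n)) * C ps k b) xs D b = 0" for xs D b
      using assms(2)[of 2 xs D b] unfolding gfun_lin by (simp add: NC(3) gfun_dilate)
    from gfun_unique[OF this, of ps "length ps" k b] suppD[OF NC(2) C]
    have "(2 ^ (exp_sum ps + k) - 2 ^ n) * C ps k b = 0" by (simp add: algebra_simps)
    then have "(2 :: 'a) ^ (exp_sum ps + k) = 2 ^ n" using C by simp
    then have "of_nat (2 ^ (exp_sum ps + k)) = (of_nat (2 ^ n) :: 'a)" by simp
    then have "(2 :: nat) ^ (exp_sum ps + k) = 2 ^ n" by (simp only: of_nat_eq_iff)
    then show ?thesis by simp
  qed
  then show ?thesis unfolding Coch0_def using NC by blast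
qed

lemma cd_Coch0: assumes "F \<in> Coch0 (n + 2)" shows "cd F \<in> Coch0 (n + 3)"
proof -
  have "cd F \<in> Coch0 (Suc n + 2)"
  proof (rule Coch0I_dilate)
    show "cd F \<in> Coch (Suc n + 2)" using cd_Coch[OF Coch0_Coch[OF assms]] by simp
    fix t xs D b
    have "dilate_fam t F = (\<lambda>xs D b. t ^ n * F xs D b + 0 * F xs D b)"
      by (intro ext) (simp add: dilate_fam_def Coch0_dilate[OF assms])
    then have "cd (dilate_fam t F) xs D b = t ^ n * cd F xs D b" using cd_lin[of "t ^ n" F 0 F xs D b] by simp
    then show "cd F (dilate t xs) (t * D) b = t ^ Suc n * cd F xs D b"
      using cd_dilate[OF multilin_Coch[OF Coch0_Coch[OF assms]], of t xs D b] by simp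
  qed
  then show ?thesis by (simp add: eval_nat_numeral)
qed

text \<open>The members of \<open>canon\<close>, and points that separate the basis elements of each degree.\<close>

abbreviation "s2 \<equiv> [(False, 0 :: nat), (True, 0)]"
abbreviation "s3L \<equiv> [(False, 0 :: nat), (True, 0), (False, Suc 0)]"
abbreviation "s3H \<equiv> [(False, 0 :: nat), (True, 0), (True, Suc 0)]"
abbreviation "s4 \<equiv> [(False, 0 :: nat), (True, 0), (False, Suc 0), (True, Suc 0)]"

abbreviation "x2 \<equiv> [(1, 0, 0), (0, 1, 0)] :: 'f::field_char_0 point list"
abbreviation "x3L \<equiv> [(1, 0, 1), (1, 0, 0), (0, 1, 0)] :: 'f::field_char_0 point list"
abbreviation "x3H \<equiv> [(1, 0, 0), (0, 1, 1), (0, 1, 0)] :: 'f::field_char_0 point list"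
abbreviation "x4 \<equiv> [(1, 0, 1), (1, 0, 0), (0, 1, 1), (0, 1, 0)] :: 'f::field_char_0 point list"

lemma canon_mem: "s2 \<in> set canon" "s3L \<in> set canon" "s3H \<in> set canon" "s4 \<in> set canon"
  by (simp_all add: canon_def)

text \<open>The bound is written \<open>Suc 0\<close> because the simplifier rewrites \<open>1\<close> to it.\<close>

lemma gfun1: 
  "gfun (Suc 0) C [] D b = C [] 0 b + D * C [] (Suc 0) b"
  "gfun (Suc 0) C ((p, q, l) # xs) D b =
    p * gfun (Suc 0) (mode_ins (False, 0) C) xs D b + q * gfun (Suc 0) (mode_ins (True, 0) C) xs D b +
    l * (p * gfun (Suc 0) (mode_ins (False, Suc 0) C) xs D b + q * gfun (Suc 0) (mode_ins (True, Suc 0) C) xs D b)"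
  by (simp_all add: gfun_Nil gfun_Cons)

lemmas bas_evals = bas_def One_nat_def canon_mem[THEN bas_modes_eval, unfolded One_nat_def]
  gfun1 mode_ins_def inv_sign_def mode_key_def

lemma Coch0_expand':
  assumes "F \<in> Coch0 q"
  shows "q = 2 \<Longrightarrow> \<exists>a b. F = fscale a (bas s2 False) + fscale b (bas s2 True)"
    "q = 3 \<Longrightarrow> \<exists>a b c d. F = fscale a (bas s3L False) + fscale b (bas s3L True) + fscale c (bas s3H False) + fscale d (bas s3H True)"
    "q = 4 \<Longrightarrow> \<exists>a b. F = fscale a (bas s4 False) + fscale b (bas s4 True)"
    "q \<notin> {2, 3, 4} \<Longrightarrow> F = 0"
proof -
  obtain c where F: "F = (\<Sum>cs\<leftarrow>canon. if length cs = q then fscale (c cs False) (bas cs False) + fscale (c cs True) (bas cs True) else 0)"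
    by (rule Coch0_expand[OF assms])
  show "\<exists>a b. F = fscale a (bas s2 False) + fscale b (bas s2 True)" if "q = 2"
    by (rule exI[of _ "c s2 False"], rule exI[of _ "c s2 True"]) (simp only: F that, simp add: canon_def)
  show "\<exists>a b. F = fscale a (bas s4 False) + fscale b (bas s4 True)" if "q = 4"
    by (rule exI[of _ "c s4 False"], rule exI[of _ "c s4 True"]) (simp only: F that, simp add: canon_def)
  show "\<exists>a b d e. F = fscale a (bas s3L False) + fscale b (bas s3L True) + fscale d (bas s3H False) + fscale e (bas s3H True)" if "q = 3"
    by (rule exI[of _ "c s3L False"], rule exI[of _ "c s3L True"], rule exI[of _ "c s3H False"], rule exI[of _ "c s3H True"])
      (simp only: F that, simp add: canon_def add.assoc)
  show "F = 0" if "q \<notin> {2, 3, 4}"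
    using that by (simp only: F) (simp add: canon_def)
qed

lemma bas_s2: "bas s2 v [(p, q, l), (p', q', l')] D b = of_bool (b = v) * (p * q' - q * p')"
  by (simp add: bas_evals)

lemma bas_s3:
  "bas s3L v [(p1, q1, l1), (p2, q2, l2), (p3, q3, l3)] D b =
    of_bool (b = v) * (p1 * p2 * q3 * (l1 - l2) - p1 * q2 * p3 * (l1 - l3) + q1 * p2 * p3 * (l2 - l3))"
  "bas s3H v [(p1, q1, l1), (p2, q2, l2), (p3, q3, l3)] D b =
    of_bool (b = v) * (- p1 * q2 * q3 * (l2 - l3) + q1 * p2 * q3 * (l1 - l3) - q1 * q2 * p3 * (l1 - l2))"
  by (cases "b = v"; simp add: bas_evals; simp add: algebra_simps)+

lemma bas_s4: "bas s4 v x4 0 b = - of_bool (b = v)"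
  by (simp add: bas_evals)

lemma cd_bas_values:
  "cd (bas s2 v) x3L 0 b = 0" "cd (bas s2 v) x3H 0 b = - 2 * of_bool (\<not> v \<and> b)"
  "cd (bas s3L v) x4 0 b = 2 * of_bool (\<not> v \<and> b)"
  "cd (bas s3H v) x4 0 b = 0"
  by (simp_all add: cd_Cons cd_Nil lie_Cons lie_Nil ins_def bas_s2 bas_s3)

lemma cd_bas_Coch0:
  assumes "cs \<in> set canon"
  shows "cd (bas cs v) \<in> Coch0 (Suc (length cs))"
proof -
  obtain n where n: "length cs = n + 2" using canon_facts(4)[OF assms] by (metis)
  have "cd (bas cs v) \<in> Coch0 (n + 3)" using bas_Coch0[OF assms, of v] unfolding n by (rule cd_Coch0)
  then show ?thesis by (simp add: n eval_nat_numeral)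
qed

text \<open>By homogeneity the differential of a basis element is a combination of the basis elements of the next
  degree, whose coefficients are found by evaluation at the points \<open>x3L\<close>, \<open>x3H\<close>, \<open>x4\<close>; in degree \<open>5\<close> there
  is nothing of weight zero.\<close>

lemma cd_bas:
  fixes v :: bool
  shows "cd (bas s2 v) = (fscale (2 * of_bool (\<not> v)) (bas s3H True) :: 'f::field_char_0 fam)"
    "cd (bas s3L v) = (fscale (- 2 * of_bool (\<not> v)) (bas s4 True) :: 'f fam)"
    "cd (bas s3H v) = (0 :: 'f fam)"
    "cd (bas s4 v) = (0 :: 'f fam)"
proof -
  note cs = bas_s2 bas_s3 bas_s4 cd_bas_values
  have "cd (bas s2 v) \<in> (Coch0 3 :: 'f fam set)" using cd_bas_Coch0[OF canon_mem(1), of v] by (simp add: eval_nat_numeral)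
  from Coch0_expand'(2)[OF this refl] obtain a b c d where
    eq: "cd (bas s2 v) = (fscale a (bas s3L False) + fscale b (bas s3L True) + fscale c (bas s3H False) + fscale d (bas s3H True) :: 'f fam)" by blast
  have "cd (bas s2 v) xs D k = a * bas s3L False xs D k + b * bas s3L True xs D k + c * bas s3H False xs D k + d * bas s3H True xs D k" for xs D k
    by (simp only: eq fam_apply fscale_apply)
  note v = this[of x3L 0 False] this[of x3L 0 True] this[of x3H 0 False] this[of x3H 0 True]
  have "a = 0" "b = 0" "c = 0" "d = 2 * of_bool (\<not> v)"
    using v[unfolded cs] by (simp_all split: if_splits)
  then show "cd (bas s2 v) = (fscale (2 * of_bool (\<not> v)) (bas s3H True) :: 'f fam)" by (simp only: eq fscale_simps add_0)
next
  note cs = bas_s4 cd_bas_values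
  have *: "G = fscale (- G x4 0 False) (bas s4 False) + fscale (- G x4 0 True) (bas s4 True)" if G: "G \<in> Coch0 4" for G :: "'f fam"
  proof -
    from Coch0_expand'(3)[OF G refl] obtain a b where eq: "G = fscale a (bas s4 False) + fscale b (bas s4 True)" by blast
    have "G x4 0 k = a * bas s4 False x4 0 k + b * bas s4 True x4 0 k" for k
      by (simp only: eq fam_apply fscale_apply)
    from this[of False] this[of True] show ?thesis by (simp add: bas_s4 eq)
  qed
  have "cd (bas s3L v) \<in> (Coch0 4 :: 'f fam set)" using cd_bas_Coch0[OF canon_mem(2), of v] by (simp add: eval_nat_numeral)
  from *[OF this] show "cd (bas s3L v) = (fscale (- 2 * of_bool (\<not> v)) (bas s4 True) :: 'f fam)"
    by (simp add: cd_bas_values fscale_simps)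
  have "cd (bas s3H v) \<in> (Coch0 4 :: 'f fam set)" using cd_bas_Coch0[OF canon_mem(3), of v] by (simp add: eval_nat_numeral)
  from *[OF this] show "cd (bas s3H v) = (0 :: 'f fam)"
    by (simp add: cd_bas_values fscale_simps)
  have "cd (bas s4 v) \<in> (Coch0 5 :: 'f fam set)" using cd_bas_Coch0[OF canon_mem(4), of v] by (simp add: eval_nat_numeral)
  from Coch0_expand'(4)[OF this] show "cd (bas s4 v) = (0 :: 'f fam)" by simp
qed

section \<open>Vector spaces presented as quotients\<close>

locale presentation = vector_space scale
  for scale :: "'a::field \<Rightarrow> 'b::ab_group_add \<Rightarrow> 'b" (infixr "*s" 75)
begin

text \<open>\<open>V\<close> is \<open>Z / U\<close>, the map \<open>\<psi>\<close> sending \<open>x \<in> Z\<close> to its class.  All computations with iterated quotients, whose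
  elements are sets of sets, thus take place in the vector space that contains \<open>Z\<close>.\<close>

definition presents :: "('a, 'v) vspace \<Rightarrow> ('b \<Rightarrow> 'v) \<Rightarrow> 'b set \<Rightarrow> 'b set \<Rightarrow> bool" where
  "presents V \<psi> Z U \<longleftrightarrow> subspace Z \<and> subspace U \<and> U \<subseteq> Z \<and> vcarrier V = \<psi> ` Z \<and> vzero V = \<psi> 0 \<and>
     (\<forall>x\<in>Z. \<forall>y\<in>Z. vadd V (\<psi> x) (\<psi> y) = \<psi> (x + y)) \<and>
     (\<forall>c. \<forall>x\<in>Z. vscale V c (\<psi> x) = \<psi> (c *s x)) \<and>
     (\<forall>x\<in>Z. \<forall>y\<in>Z. \<psi> x = \<psi> y \<longleftrightarrow> x - y \<in> U)"

lemma presents_restrict: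
  assumes "presents V \<psi> Z U" "subspace Z'" "U \<subseteq> Z'" "Z' \<subseteq> Z"
  shows "presents (V\<lparr>vcarrier := \<psi> ` Z'\<rparr>) \<psi> Z' U"
  using assms unfolding presents_def by (auto simp: subset_iff)

text \<open>\<open>(Z / U) / (B / U) = Z / B\<close>.\<close>

lemma presents_vquot:
  assumes p: "presents V \<psi> Z U" and B: "subspace B" "U \<subseteq> B" "B \<subseteq> Z"
  shows "presents (vquot V (\<psi> ` B)) (\<lambda>x. vcoset V (\<psi> ` B) (\<psi> x)) Z B"
proof -
  have Z: "subspace Z" and add: "\<And>x y. x \<in> Z \<Longrightarrow> y \<in> Z \<Longrightarrow> vadd V (\<psi> x) (\<psi> y) = \<psi> (x + y)"
    and sc: "\<And>c x. x \<in> Z \<Longrightarrow> vscale V c (\<psi> x) = \<psi> (c *s x)"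
    and eq: "\<And>x y. x \<in> Z \<Longrightarrow> y \<in> Z \<Longrightarrow> \<psi> x = \<psi> y \<longleftrightarrow> x - y \<in> U"
    and car: "vcarrier V = \<psi> ` Z"
    using p unfolding presents_def by auto
  have BZ: "\<And>x. x \<in> B \<Longrightarrow> x \<in> Z" using B(3) by blast
  have ZB: "x + b \<in> Z" if "x \<in> Z" "b \<in> B" for x b using that subspace_add[OF Z] BZ by blast
  have cos: "vcoset V (\<psi> ` B) (\<psi> x) = (\<lambda>b. \<psi> (x + b)) ` B" if "x \<in> Z" for x
    unfolding vcoset_def image_image using that by (intro image_cong refl) (auto simp: add BZ)
  have "vadd (vquot V (\<psi> ` B)) (vcoset V (\<psi> ` B) (\<psi> x)) (vcoset V (\<psi> ` B) (\<psi> y)) = vcoset V (\<psi> ` B) (\<psi> (x + y))"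
    if xy: "x \<in> Z" "y \<in> Z" for x y
  proof -
    have 1: "vadd V (\<psi> (x + b)) (\<psi> (y + c)) = \<psi> (x + y + (b + c))" if "b \<in> B" "c \<in> B" for b c
      using add[OF ZB[OF xy(1) that(1)] ZB[OF xy(2) that(2)]] by (simp add: add_ac)
    have "{vadd V u w |u w. u \<in> (\<lambda>b. \<psi> (x + b)) ` B \<and> w \<in> (\<lambda>b. \<psi> (y + b)) ` B} = (\<lambda>b. \<psi> (x + y + b)) ` B"
    proof (intro equalityI subsetI)
      fix z assume "z \<in> {vadd V u w |u w. u \<in> (\<lambda>b. \<psi> (x + b)) ` B \<and> w \<in> (\<lambda>b. \<psi> (y + b)) ` B}"
      then show "z \<in> (\<lambda>b. \<psi> (x + y + b)) ` B" using 1 subspace_add[OF B(1)] by blast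
    next
      fix z assume "z \<in> (\<lambda>b. \<psi> (x + y + b)) ` B"
      then obtain b where b: "b \<in> B" "z = vadd V (\<psi> (x + b)) (\<psi> (y + 0))"
        using 1[OF _ subspace_0[OF B(1)]] by auto
      then show "z \<in> {vadd V u w |u w. u \<in> (\<lambda>b. \<psi> (x + b)) ` B \<and> w \<in> (\<lambda>b. \<psi> (y + b)) ` B}"
        using subspace_0[OF B(1)] by blast
    qed
    then show ?thesis
      unfolding cos[OF xy(1)] cos[OF xy(2)] cos[OF subspace_add[OF Z xy]] by (simp add: vquot_def)
  qed
  moreover have "vscale (vquot V (\<psi> ` B)) c (vcoset V (\<psi> ` B) (\<psi> x)) = vcoset V (\<psi> ` B) (\<psi> (c *s x))"
    if x: "x \<in> Z" for c x
  proof -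
    have cx: "c *s x \<in> Z" using subspace_scale[OF Z x] .
    have 1: "vadd V (vscale V c (\<psi> (x + b))) (\<psi> d) = \<psi> (c *s x + (c *s b + d))" if "b \<in> B" "d \<in> B" for b d
      using add[OF subspace_scale[OF Z ZB[OF x that(1)]] BZ[OF that(2)], of c]
      by (simp add: sc[OF ZB[OF x that(1)]] scale_right_distrib add.assoc)
    have "{vadd V (vscale V c u) w |u w. u \<in> (\<lambda>b. \<psi> (x + b)) ` B \<and> w \<in> \<psi> ` B} = (\<lambda>b. \<psi> (c *s x + b)) ` B"
    proof (intro equalityI subsetI)
      fix z assume "z \<in> {vadd V (vscale V c u) w |u w. u \<in> (\<lambda>b. \<psi> (x + b)) ` B \<and> w \<in> \<psi> ` B}"
      then show "z \<in> (\<lambda>b. \<psi> (c *s x + b)) ` B"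
        using 1 subspace_add[OF B(1)] subspace_scale[OF B(1)] by blast
    next
      fix z assume "z \<in> (\<lambda>b. \<psi> (c *s x + b)) ` B"
      then obtain b where b: "b \<in> B" "z = vadd V (vscale V c (\<psi> (x + 0))) (\<psi> b)"
        using 1[OF subspace_0[OF B(1)]] by auto
      then show "z \<in> {vadd V (vscale V c u) w |u w. u \<in> (\<lambda>b. \<psi> (x + b)) ` B \<and> w \<in> \<psi> ` B}"
        using subspace_0[OF B(1)] by blast
    qed
    then show ?thesis unfolding cos[OF x] cos[OF cx] by (simp add: vquot_def)
  qed
  moreover have "vcoset V (\<psi> ` B) (\<psi> x) = vcoset V (\<psi> ` B) (\<psi> y) \<longleftrightarrow> x - y \<in> B" if xy: "x \<in> Z" "y \<in> Z" for x y
  proof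
    assume "vcoset V (\<psi> ` B) (\<psi> x) = vcoset V (\<psi> ` B) (\<psi> y)"
    then have "\<psi> (x + 0) \<in> (\<lambda>b. \<psi> (y + b)) ` B"
      unfolding cos[OF xy(1)] cos[OF xy(2)] using subspace_0[OF B(1)] by blast
    then obtain b where b: "b \<in> B" "\<psi> x = \<psi> (y + b)" by auto
    then have "x - (y + b) \<in> B" using eq[of x "y + b"] xy ZB B(2) by blast
    then have "(x - (y + b)) + b \<in> B" using subspace_add[OF B(1)] b(1) by blast
    then show "x - y \<in> B" by simp
  next
    assume *: "x - y \<in> B"
    have sub: "(\<lambda>b. \<psi> (u + b)) ` B \<subseteq> (\<lambda>b. \<psi> (w + b)) ` B" if "u - w \<in> B" for u w
    proof
      fix z assume "z \<in> (\<lambda>b. \<psi> (u + b)) ` B"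
      then obtain b where "b \<in> B" "z = \<psi> (w + ((u - w) + b))" by (auto simp: algebra_simps)
      then show "z \<in> (\<lambda>b. \<psi> (w + b)) ` B" using subspace_add[OF B(1) that] by blast
    qed
    have "y - x \<in> B" using subspace_neg[OF B(1) *] by simp
    then show "vcoset V (\<psi> ` B) (\<psi> x) = vcoset V (\<psi> ` B) (\<psi> y)"
      unfolding cos[OF xy(1)] cos[OF xy(2)] using sub[OF *] sub[of y x] by blast
  qed
  moreover have "vzero (vquot V (\<psi> ` B)) = vcoset V (\<psi> ` B) (\<psi> 0)"
    unfolding cos[OF subspace_0[OF Z]] by (simp add: vquot_def)
  moreover have "vcarrier (vquot V (\<psi> ` B)) = (\<lambda>x. vcoset V (\<psi> ` B) (\<psi> x)) ` Z"
    by (simp add: vquot_def car image_image)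
  ultimately show ?thesis unfolding presents_def using Z B by blast
qed

definition lin_comb :: "'a list \<Rightarrow> 'b list \<Rightarrow> 'b" where
  "lin_comb cs bs = foldr (\<lambda>(c, b). (+) (c *s b)) (zip cs bs) 0"

lemma lin_comb_simps [simp]: "lin_comb [] bs = 0" "lin_comb cs [] = 0" "lin_comb (c # cs) (b # bs) = c *s b + lin_comb cs bs"
  by (simp_all add: lin_comb_def)

lemma lin_comb_mem: "subspace Z \<Longrightarrow> set bs \<subseteq> Z \<Longrightarrow> lin_comb cs bs \<in> Z"
proof (induction bs arbitrary: cs)
  case (Cons b bs)
  then show ?case by (cases cs) (auto intro: subspace_0 subspace_add subspace_scale)
qed (simp add: subspace_0)

lemma lin_comb_diff: "length cs = length bs \<Longrightarrow> length ds = length bs \<Longrightarrow> lin_comb (map2 (-) cs ds) bs = lin_comb cs bs - lin_comb ds bs"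
proof (induction bs arbitrary: cs ds)
  case (Cons b bs)
  then show ?case by (cases cs; cases ds) (auto simp: scale_left_diff_distrib)
qed simp

lemma lin_comb_append: "length cs = length bs \<Longrightarrow> lin_comb (cs @ cs') (bs @ bs') = lin_comb cs bs + lin_comb cs' bs'"
proof (induction bs arbitrary: cs)
  case (Cons b bs)
  then show ?case by (cases cs) (auto simp: add.assoc)
qed simp

text \<open>The classes of \<open>bs\<close> form a basis of \<open>Z / B\<close>.\<close>

definition basis_mod :: "'b set \<Rightarrow> 'b set \<Rightarrow> 'b list \<Rightarrow> bool" where
  "basis_mod Z B bs \<longleftrightarrow> set bs \<subseteq> Z \<and>
     (\<forall>z\<in>Z. \<exists>cs. length cs = length bs \<and> z - lin_comb cs bs \<in> B) \<and>
     (\<forall>cs. length cs = length bs \<and> lin_comb cs bs \<in> B \<longrightarrow> (\<forall>c\<in>set cs. c = 0))"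

lemma presents_has_dim:
  assumes p: "presents V \<psi> Z B" and b: "basis_mod Z B bs"
  shows "has_dim V (length bs)"
proof -
  have Z: "subspace Z" and B: "subspace B" and add: "\<And>x y. x \<in> Z \<Longrightarrow> y \<in> Z \<Longrightarrow> vadd V (\<psi> x) (\<psi> y) = \<psi> (x + y)"
    and sc: "\<And>c x. x \<in> Z \<Longrightarrow> vscale V c (\<psi> x) = \<psi> (c *s x)"
    and eq: "\<And>x y. x \<in> Z \<Longrightarrow> y \<in> Z \<Longrightarrow> \<psi> x = \<psi> y \<longleftrightarrow> x - y \<in> B"
    and car: "vcarrier V = \<psi> ` Z" and zero: "vzero V = \<psi> 0"
    using p unfolding presents_def by auto
  have bs: "set bs \<subseteq> Z" using b unfolding basis_mod_def by blast
  have lin: "lincomb V cs (map \<psi> as) = \<psi> (lin_comb cs as)" if "set as \<subseteq> Z" for cs as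
    using that
  proof (induction as arbitrary: cs)
    case (Cons a as)
    show ?case
    proof (cases cs)
      case (Cons c cs')
      then show ?thesis
        using Cons.IH[of cs'] Cons.prems lin_comb_mem[OF Z, of as cs'] subspace_scale[OF Z]
        by (simp add: lincomb_def sc add)
    qed (simp add: lincomb_def zero)
  qed (simp add: lincomb_def zero)
  show ?thesis unfolding has_dim_def
  proof (intro exI[of _ "map \<psi> bs"] conjI ballI)
    show "length (map \<psi> bs) = length bs" by simp
    show "set (map \<psi> bs) \<subseteq> vcarrier V" using bs car by auto
    fix v assume "v \<in> vcarrier V"
    then obtain z where z: "z \<in> Z" "v = \<psi> z" using car by auto
    show "\<exists>!cs. length cs = length bs \<and> lincomb V cs (map \<psi> bs) = v"
    proof (rule ex_ex1I)
      obtain cs where "length cs = length bs" "z - lin_comb cs bs \<in> B" using b z(1) unfolding basis_mod_def by blast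
      then show "\<exists>cs. length cs = length bs \<and> lincomb V cs (map \<psi> bs) = v"
        using eq[OF z(1) lin_comb_mem[OF Z bs]] lin[OF bs] z(2) by metis
    next
      fix cs ds
      assume *: "length cs = length bs \<and> lincomb V cs (map \<psi> bs) = v" "length ds = length bs \<and> lincomb V ds (map \<psi> bs) = v"
      then have "\<psi> (lin_comb cs bs) = \<psi> (lin_comb ds bs)" using lin[OF bs] by simp
      then have "lin_comb (map2 (-) cs ds) bs \<in> B"
        using eq[OF lin_comb_mem[OF Z bs] lin_comb_mem[OF Z bs]] * by (simp add: lin_comb_diff)
      moreover have "length (map2 (-) cs ds) = length bs" using * by simp
      ultimately have 0: "\<forall>c\<in>set (map2 (-) cs ds). c = 0" using b unfolding basis_mod_def by blast
      show "cs = ds"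
      proof (rule nth_equalityI)
        fix i assume i: "i < length cs"
        then have "map2 (-) cs ds ! i \<in> set (map2 (-) cs ds)" using * by (intro nth_mem) simp
        with 0 have "map2 (-) cs ds ! i = 0" by blast
        then show "cs ! i = ds ! i" using i * by simp
      qed (use * in simp)
    qed
  qed
qed

end

lemma (in presentation) presents_vzero: "presents V \<psi> Z U \<Longrightarrow> vzero V = \<psi> 0"
  and presents_vcarrier: "presents V \<psi> Z U \<Longrightarrow> vcarrier V = \<psi> ` Z"
  by (simp_all add: presents_def)

section \<open>The cohomology of the complex of families\<close>

interpretation fam: presentation "fscale :: 'f::field_char_0 \<Rightarrow> 'f fam \<Rightarrow> 'f fam"
  by (rule presentation.intro) (rule vector_space_fscale)

lemma cd_cd_fam: "multilin F \<Longrightarrow> cd (cd F) = 0"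
  by (intro ext) (simp add: cd_cd)

lemma fder_lie: "multilin F \<Longrightarrow> fder F = lie (1, 0, 0) F"
  by (intro ext) (simp add: lie_0_fder)

lemma cd_fder: "multilin F \<Longrightarrow> cd (fder F) = fder (cd F)"
  by (intro ext) (simp add: fder_lie multilin_cd cd_lie)

lemma fder_hom: "fder (F + G) = fder F + fder G" "fder (F - G) = fder F - fder G" "fder (fscale c F) = fscale c (fder F)" "fder 0 = 0"
  by (intro ext; simp add: fder_def algebra_simps)+

lemma ins_hom: "ins x (F + G) = ins x F + ins x G" "ins x (F - G) = ins x F - ins x G" "ins x (fscale c F) = fscale c (ins x F)" "ins x 0 = 0"
  by (intro ext; simp add: ins_def)+

text \<open>The Cartan formula at \<open>l = 0\<close>: a homotopy between \<open>\<partial>\<close> and zero.\<close>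

lemma homotopy: "multilin F \<Longrightarrow> cd (ins (1, 0, 0) F) + ins (1, 0, 0) (cd F) = fder F"
  by (intro ext) (simp add: ins_cd lie_0_fder)

lemma gfun_poly: "\<exists>p. \<forall>D. gfun N C xs D b = poly p D"
proof (induction xs arbitrary: C)
  case Nil
  show ?case
    by (rule exI[of _ "\<Sum>k\<le>N. monom (C [] k b) k"]) (simp add: gfun_Nil poly_sum poly_monom mult.commute)
next
  case (Cons x xs)
  obtain p q l where x: "x = (p, q, l)" by (cases x)
  have "\<forall>C. \<exists>r. \<forall>D. gfun N C xs D b = poly r D" using Cons by blast
  from choice[OF this] obtain r where r: "\<And>C D. gfun N C xs D b = poly (r C) D" by blast
  show ?case
    by (rule exI[of _ "\<Sum>n\<le>N. smult (l ^ n) (smult p (r (mode_ins (False, n) C)) + smult q (r (mode_ins (True, n) C)))"])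
      (simp add: x gfun_Cons r poly_sum)
qed

text \<open>For fixed arguments, \<open>\<partial>\<close> multiplies a polynomial in \<open>D\<close> by a polynomial of degree one.\<close>

lemma fder_eq_zero:
  assumes "F \<in> Coch q" "fder F = 0"
  shows "F = 0"
proof (intro ext)
  fix xs D b
  obtain N C where "F = gfun N C" using assms(1) by (rule CochE)
  then obtain p where p: "\<And>D. F xs D b = poly p D" using gfun_poly by blast
  let ?s = "\<Sum>(p, q, l)\<leftarrow>xs. l"
  have "poly ([:?s, 1:] * p) D = 0" for D
    using fun_cong[OF fun_cong[OF fun_cong[OF assms(2), of xs], of D], of b]
    by (simp add: fder_def p algebra_simps)
  then have "[:?s, 1:] * p = 0" using poly_all_0_iff_0 by blast
  then have "p = 0" by (simp only: mult_eq_0_iff) simp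
  then show "F xs D b = (0 :: 'a fam) xs D b" by (simp add: p)
qed

definition Cocyc :: "nat \<Rightarrow> 'f::field_char_0 fam set" where
  "Cocyc q = {F \<in> Coch q. cd F = 0}"

text \<open>Families whose classes modulo \<open>\<partial>\<close> are cocycles, respectively coboundaries, of the reduced complex.\<close>

definition RCocyc :: "nat \<Rightarrow> 'f::field_char_0 fam set" where
  "RCocyc q = {F \<in> Coch q. cd F \<in> fder ` Coch (Suc q)}"

definition RCobd :: "nat \<Rightarrow> 'f::field_char_0 fam set" where
  "RCobd q = {F + G | F G. F \<in> Cobd q \<and> G \<in> fder ` Coch q}"

lemma subspace_Coch: "fam.subspace (Coch q)"
  unfolding fam.subspace_def by (auto intro: zero_Coch Coch_add Coch_fscale)

lemma subspace_Cobd: "fam.subspace (Cobd q)"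
  unfolding fam.subspace_def by (auto intro: zero_Cobd Cobd_add Cobd_fscale)

lemma subspace_Cocyc: "fam.subspace (Cocyc q)"
  unfolding fam.subspace_def Cocyc_def
  by (auto intro: zero_Coch Coch_add Coch_fscale simp only: mem_Collect_eq cd_hom fam.scale_zero_right add_0_right)

lemma subspace_fder: "fam.subspace (fder ` Coch q)"
  unfolding fam.subspace_def
proof (intro conjI ballI allI)
  show "0 \<in> fder ` (Coch q :: 'a fam set)" using imageI[OF zero_Coch, of fder q] by (simp only: fder_hom)
  show "F + G \<in> fder ` Coch q" if "F \<in> fder ` Coch q" "G \<in> fder ` Coch q" for F G :: "'a fam"
  proof -
    from that obtain F' G' where "F' \<in> Coch q" "G' \<in> Coch q" "F + G = fder (F' + G')" by (auto simp only: fder_hom)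
    then show ?thesis using Coch_add by blast
  qed
  show "fscale c F \<in> fder ` Coch q" if "F \<in> fder ` Coch q" for F :: "'a fam" and c
  proof -
    from that obtain F' where "F' \<in> Coch q" "fscale c F = fder (fscale c F')" by (auto simp only: fder_hom)
    then show ?thesis using Coch_fscale by blast
  qed
qed

lemma subspace_RCobd: "fam.subspace (RCobd q)"
  unfolding RCobd_def using fam.subspace_sums[OF subspace_Cobd subspace_fder] by (simp add: conj_commute)

lemma subspace_RCocyc: "fam.subspace (RCocyc q)"
  unfolding fam.subspace_def RCocyc_def mem_Collect_eq cd_hom
  using subspace_Coch subspace_fder unfolding fam.subspace_def by blast

lemma Cobd_Coch: "Cobd q \<subseteq> Coch q"
  unfolding Cobd_def by (cases q) (auto intro: zero_Coch cd_Coch)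

lemma Cobd_cocycle: "F \<in> Cobd q \<Longrightarrow> cd F = 0"
  unfolding Cobd_def by (cases q) (auto simp only: nat.case cd_hom cd_cd_fam multilin_Coch singleton_iff)

lemma Cobd_Cocyc: "Cobd q \<subseteq> Cocyc q"
  using Cobd_Coch Cobd_cocycle unfolding Cocyc_def by blast

lemma RCobd_RCocyc: "RCobd q \<subseteq> RCocyc q"
proof
  fix F :: "'a fam" assume "F \<in> RCobd q"
  then obtain G H where F: "F = G + fder H" "G \<in> Cobd q" "H \<in> Coch q" unfolding RCobd_def by auto
  have "cd F = fder (cd H)" using F by (simp only: cd_hom cd_fder[OF multilin_Coch] Cobd_cocycle add_0)
  then show "F \<in> RCocyc q"
    using F Cobd_Coch fder_Coch Coch_add cd_Coch unfolding RCocyc_def by blast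
qed

lemma fder_RCobd: "fder ` Coch q \<subseteq> RCobd q"
  unfolding RCobd_def using zero_Cobd[of q] by force

text \<open>Representatives of a basis of the basic cohomology in degree \<open>q\<close>.\<close>

definition reps :: "nat \<Rightarrow> 'f::field_char_0 fam list" where
  "reps q = (if q = 2 then [bas s2 True] else if q = 3 then [bas s3H False, bas s3L True]
     else if q = 4 then [bas s4 False] else [])"

lemma bas_mem: "bas s2 v \<in> Coch0 2" "bas s3L v \<in> Coch0 3" "bas s3H v \<in> Coch0 3" "bas s4 v \<in> Coch0 4"
  using bas_Coch0[OF canon_mem(1), of v] bas_Coch0[OF canon_mem(2), of v] bas_Coch0[OF canon_mem(3), of v] bas_Coch0[OF canon_mem(4), of v]
  by (simp_all add: eval_nat_numeral)

lemma cd_bas_zero: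
  "cd (bas s2 True) = 0" "cd (bas s3L True) = 0" "cd (bas s3H v) = 0" "cd (bas s4 v) = 0"
  by (simp_all add: cd_bas fscale_simps)

lemma reps_Coch0: "F \<in> set (reps q) \<Longrightarrow> F \<in> Coch0 q"
  using bas_mem by (auto simp: reps_def split: if_splits)

lemma reps_Cocyc: "set (reps q) \<subseteq> Cocyc q"
proof
  fix F :: "'a fam" assume F: "F \<in> set (reps q)"
  then have "cd F = 0" by (auto simp: reps_def cd_bas_zero split: if_splits)
  then show "F \<in> Cocyc q" using Coch0_Coch[OF reps_Coch0[OF F]] by (simp add: Cocyc_def)
qed

lemma bas_s2_value: "bas s2 v x2 0 b = of_bool (b = v)"
  by (simp add: bas_s2)

lemma bas_s3_values:
  "bas s3L v x3L 0 b = of_bool (b = v)" "bas s3L v x3H 0 b = 0"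
  "bas s3H v x3H 0 b = - of_bool (b = v)" "bas s3H v x3L 0 b = 0"
  by (simp_all add: bas_s3)

lemma Coch0_lin_comb: assumes "2 \<le> q" "set bs \<subseteq> Coch0 q" shows "fam.lin_comb cs bs \<in> Coch0 q"
proof -
  obtain n where q: "q = n + 2" using assms(1) le_Suc_ex by (metis add.commute)
  have "fam.lin_comb cs bs \<in> Coch0 (n + 2)"
  proof (rule Coch0I_dilate)
    show "fam.lin_comb cs bs \<in> Coch (n + 2)"
      using fam.lin_comb_mem[OF subspace_Coch] assms(2) Coch0_Coch q by blast
    show "fam.lin_comb cs bs (dilate t xs) (t * D) b = t ^ n * fam.lin_comb cs bs xs D b" for t xs D b
      using assms(2)
    proof (induction bs arbitrary: cs)
      case (Cons F bs)
      have F: "F (dilate t xs) (t * D) b = t ^ n * F xs D b" by (rule Coch0_dilate) (use Cons.prems q in simp)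
      have IH: "fam.lin_comb cs bs (dilate t xs) (t * D) b = t ^ n * fam.lin_comb cs bs xs D b" for cs
        by (rule Cons.IH) (use Cons.prems in simp)
      show ?case
      proof (cases cs)
        case cs: (Cons c cs')
        show ?thesis unfolding cs fam.lin_comb_simps fam_apply fscale_apply[of c F xs] fscale_apply[of c F "dilate t xs"] F IH by (simp only: algebra_simps)
      qed (simp only: fam.lin_comb_simps fam_apply mult_zero_right)
    qed (simp only: fam.lin_comb_simps fam_apply mult_zero_right)
  qed
  then show ?thesis by (simp add: q)
qed

lemma CobdI: "F \<in> Coch p \<Longrightarrow> q = Suc p \<Longrightarrow> cd F \<in> Cobd q"
  by (simp add: Cobd_def)

text \<open>In weight zero \<open>cd_bas\<close> gives kernel and image of the differential: of the two basis elements in degree \<open>2\<close>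
  one is a cocycle; in degree \<open>3\<close> three of four are cocycles and \<open>bas s3H True\<close> is a boundary; in degree \<open>4\<close>
  the boundary is \<open>bas s4 True\<close>.\<close>

theorem basis_basic: "fam.basis_mod (Cocyc q) (Cobd q) (reps q)"
  unfolding fam.basis_mod_def
proof (intro conjI ballI allI impI)
  show "set (reps q) \<subseteq> Cocyc q" by (rule reps_Cocyc)
  fix F :: "'a fam" assume F: "F \<in> Cocyc q"
  then obtain G where G: "G \<in> Coch0 q" "cd G = 0" "F - G \<in> Cobd q"
    using cocycle_weight_zero[of F q] unfolding Cocyc_def by blast
  have "\<exists>cs. length cs = length (reps q :: 'a fam list) \<and> G - fam.lin_comb cs (reps q) \<in> Cobd q"
  proof -
    consider "q = 2" | "q = 3" | "q = 4" | "q \<notin> {2, 3, 4}" by auto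
    then show ?thesis
    proof cases
      case 1
      obtain a b where ab: "G = fscale a (bas s2 False) + fscale b (bas s2 True)" using Coch0_expand'(1)[OF G(1) 1] by blast
      have "a = 0"
        using arg_cong[OF G(2)[unfolded ab cd_hom cd_bas], of "\<lambda>F. F x3H 0 True"]
        by (simp only: fam_apply fscale_apply bas_s3_values) simp
      then have "G - fam.lin_comb [b] (reps q) = 0" by (simp add: ab reps_def 1 fscale_simps)
      then show ?thesis using zero_Cobd by (intro exI[of _ "[b]"]) (simp add: reps_def 1)
    next
      case 2
      obtain a b c d where abcd: "G = fscale a (bas s3L False) + fscale b (bas s3L True) + fscale c (bas s3H False) + fscale d (bas s3H True)"
        using Coch0_expand'(2)[OF G(1) 2] by blast
      have "a = 0"
        using arg_cong[OF G(2)[unfolded abcd cd_hom cd_bas], of "\<lambda>F. F x4 0 True"]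
        by (simp only: fam_apply fscale_apply bas_s4) simp
      then have "G - fam.lin_comb [c, b] (reps q) = fscale (d / 2) (cd (bas s2 False))"
        by (intro ext) (simp add: abcd reps_def 2 cd_bas)
      also have "\<dots> = cd (fscale (d / 2) (bas s2 False))" by (simp only: cd_hom)
      also have "\<dots> \<in> Cobd q"
        by (rule CobdI[OF Coch_fscale[OF Coch0_Coch[OF bas_mem(1)]]]) (simp add: 2)
      finally show ?thesis by (intro exI[of _ "[c, b]"]) (simp add: reps_def 2)
    next
      case 3
      obtain a b where ab: "G = fscale a (bas s4 False) + fscale b (bas s4 True)" using Coch0_expand'(3)[OF G(1) 3] by blast
      have "G - fam.lin_comb [a] (reps q) = fscale (- b / 2) (cd (bas s3L False))"
        by (intro ext) (simp add: ab reps_def 3 cd_bas)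
      also have "\<dots> = cd (fscale (- b / 2) (bas s3L False))" by (simp only: cd_hom)
      also have "\<dots> \<in> Cobd q"
        by (rule CobdI[OF Coch_fscale[OF Coch0_Coch[OF bas_mem(2)]]]) (simp add: 3)
      finally show ?thesis by (intro exI[of _ "[a]"]) (simp add: reps_def 3)
    next
      case 4
      then show ?thesis using Coch0_expand'(4)[OF G(1) 4] zero_Cobd by (intro exI[of _ "[]"]) (simp add: reps_def)
    qed
  qed
  then obtain cs where cs: "length cs = length (reps q :: 'a fam list)" "G - fam.lin_comb cs (reps q) \<in> Cobd q" by blast
  have "F - fam.lin_comb cs (reps q) = (F - G) + (G - fam.lin_comb cs (reps q))" by simp
  then show "\<exists>cs. length cs = length (reps q :: 'a fam list) \<and> F - fam.lin_comb cs (reps q) \<in> Cobd q"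
    using cs Cobd_add[OF G(3) cs(2)] by metis
next
  fix cs :: "'a list" and c
  assume *: "length cs = length (reps q :: 'a fam list) \<and> fam.lin_comb cs (reps q) \<in> Cobd q" and c: "c \<in> set cs"
  let ?G = "fam.lin_comb cs (reps q)"
  from * c have q: "q \<in> {2, 3, 4}" by (auto simp: reps_def split: if_splits)
  then obtain p where p: "q = Suc p" by (cases q) auto
  have "?G \<in> Coch0 q" using q reps_Coch0 by (intro Coch0_lin_comb) auto
  then have G0: "?G \<in> Coch0 (Suc p)" by (simp only: p)
  have "?G \<in> Cobd (Suc p)" using * by (simp only: p)
  then obtain k where k: "k \<in> Coch p" "?G = cd k" unfolding Cobd_def by auto
  obtain h where h: "h \<in> Coch0 p" "?G = cd h" by (rule weight_zero_boundary[OF G0 k])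
  consider "q = 2" "p = 1" | "q = 3" "p = 2" | "q = 4" "p = 3" using q p by auto
  then show "c = 0"
  proof cases
    case 1
    have "h = 0" using Coch0_expand'(4)[OF h(1)] 1 by simp
    then have "?G x2 0 True = (0 :: 'a fam) x2 0 True" by (simp only: h(2) cd_hom)
    with * c 1 show ?thesis by (auto simp: reps_def bas_s2_value length_Suc_conv)
  next
    case 2
    obtain a b where ab: "h = fscale a (bas s2 False) + fscale b (bas s2 True)" using Coch0_expand'(1)[OF h(1) 2(2)] by blast
    have G: "?G xs D b = 2 * a * bas s3H True xs D b" for xs D b
      by (simp only: h(2) ab cd_hom cd_bas fam_apply fscale_apply) simp
    have "length cs = Suc (Suc 0)" using * 2 by (simp add: reps_def)
    then obtain c1 c2 where cs: "cs = [c1, c2]" by (auto simp: length_Suc_conv)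
    have "c1 = 0" using G[of x3H 0 False] by (simp add: cs reps_def 2 bas_s3_values)
    moreover have "c2 = 0" using G[of x3L 0 True] by (simp add: cs reps_def 2 bas_s3_values)
    ultimately show ?thesis using c cs by auto
  next
    case 3
    obtain a b d e where ab: "h = fscale a (bas s3L False) + fscale b (bas s3L True) + fscale d (bas s3H False) + fscale e (bas s3H True)"
      using Coch0_expand'(2)[OF h(1) 3(2)] by blast
    have G: "?G xs D b = - 2 * a * bas s4 True xs D b" for xs D b
      by (simp only: h(2) ab cd_hom cd_bas fam_apply fscale_apply) simp
    have "length cs = Suc 0" using * 3 by (simp add: reps_def)
    then obtain c1 where cs: "cs = [c1]" by (auto simp: length_Suc_conv)
    have "c1 = 0" using G[of x4 0 False] by (simp add: cs reps_def 3 bas_s4)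
    then show ?thesis using c cs by auto
  qed
qed

lemma lin_comb_map_ins: "fam.lin_comb cs (map (ins x) bs) = ins x (fam.lin_comb cs bs)"
proof (induction bs arbitrary: cs)
  case (Cons b bs)
  then show ?case by (cases cs) (simp_all only: list.map fam.lin_comb_simps ins_hom)
qed (simp only: list.map fam.lin_comb_simps ins_hom)

text \<open>A reduced cocycle \<open>F\<close> satisfies \<open>d F = \<partial>g\<close> with \<open>d g = 0\<close>, as \<open>\<partial>\<close> is injective.  Expanding \<open>g\<close> in cohomology as
  \<open>g = \<Sum> c\<^sub>i b\<^sub>i + d k\<close> shows that \<open>F - \<Sum> c\<^sub>i \<iota>\<^sub>0 b\<^sub>i - \<partial>k\<close> is a basic cocycle.  Conversely, in a relation
  \<open>f + \<iota>\<^sub>0 g = m + \<partial>k\<close> with \<open>f\<close>, \<open>g\<close> combinations of representatives and \<open>m\<close> a boundary, applying \<open>d\<close> gives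
  \<open>\<partial>g = \<partial>d k\<close>, so \<open>g = d k\<close>, hence \<open>g = 0\<close> and \<open>d k = 0\<close>; then \<open>\<partial>k = d \<iota>\<^sub>0 k\<close>, and \<open>f\<close> is a boundary.\<close>

theorem basis_reduced: "fam.basis_mod (RCocyc q) (RCobd q) (reps q @ map (ins (1, 0, 0)) (reps (Suc q)))"
proof -
  let ?i = "ins (1, 0, 0) :: 'a fam \<Rightarrow> 'a fam"
  let ?b = "reps q :: 'a fam list" and ?b' = "reps (Suc q) :: 'a fam list"
  have lcZ: "fam.lin_comb cs ?b \<in> Cocyc q" and lcZ': "fam.lin_comb cs ?b' \<in> Cocyc (Suc q)" for cs
    by (intro fam.lin_comb_mem subspace_Cocyc reps_Cocyc)+
  have lcK: "fam.lin_comb cs ?b \<in> Coch q" and lcK': "fam.lin_comb cs ?b' \<in> Coch (Suc q)" for cs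
    using lcZ lcZ' by (auto simp only: Cocyc_def mem_Collect_eq)
  have cdi: "cd (?i F) = fder F" if "F \<in> Cocyc (Suc q)" for F
  proof -
    have "cd F = 0" "multilin F" using that multilin_Coch by (auto simp: Cocyc_def)
    then show ?thesis using homotopy[of F] by (simp only: ins_hom add_0_right)
  qed
  show ?thesis
    unfolding fam.basis_mod_def
  proof (intro conjI ballI allI impI)
    show "set (?b @ map ?i ?b') \<subseteq> RCocyc q"
    proof
      fix F assume "F \<in> set (?b @ map ?i ?b')"
      then consider "F \<in> set ?b" | G where "G \<in> set ?b'" "F = ?i G" by auto
      then show "F \<in> RCocyc q"
      proof cases
        case 1
        then have "F \<in> Coch q" "cd F = 0" using reps_Cocyc unfolding Cocyc_def by auto
        then show ?thesis using fam.subspace_0[OF subspace_fder, of "Suc q"] by (simp add: RCocyc_def)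
      next
        case 2
        then have G: "G \<in> Cocyc (Suc q)" using reps_Cocyc by blast
        then have "G \<in> Coch (Suc q)" by (simp add: Cocyc_def)
        then show ?thesis using cdi[OF G] ins0_Coch 2 by (auto simp: RCocyc_def)
      qed
    qed
    fix F :: "'a fam" assume "F \<in> RCocyc q"
    then obtain g where F: "F \<in> Coch q" "cd F = fder g" "g \<in> Coch (Suc q)" unfolding RCocyc_def by auto
    have "fder (cd g) = cd (cd F)" by (simp only: F(2) cd_fder[OF multilin_Coch[OF F(3)]])
    also have "\<dots> = 0" by (rule cd_cd_fam[OF multilin_Coch[OF F(1)]])
    finally have "cd g = 0" by (rule fder_eq_zero[OF cd_Coch[OF F(3)]])
    then have "g \<in> Cocyc (Suc q)" using F(3) by (simp add: Cocyc_def)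
    then obtain cs' where cs': "length cs' = length ?b'" "g - fam.lin_comb cs' ?b' \<in> Cobd (Suc q)"
      using basis_basic[of "Suc q"] unfolding fam.basis_mod_def by blast
    then obtain k where k: "k \<in> Coch q" "g - fam.lin_comb cs' ?b' = cd k" unfolding Cobd_def by auto
    let ?F = "F - ?i (fam.lin_comb cs' ?b') - fder k"
    have "cd ?F = fder (g - fam.lin_comb cs' ?b' - cd k)"
      by (simp only: cd_hom F(2) cdi[OF lcZ'] cd_fder[OF multilin_Coch[OF k(1)]] fder_hom)
    also have "\<dots> = 0" by (simp only: k(2) diff_self fder_hom)
    finally have "cd ?F = 0" .
    moreover have "?F \<in> Coch q"
      by (intro fam.subspace_diff[OF subspace_Coch] F(1) ins0_Coch lcK' fder_Coch k(1))
    ultimately have "?F \<in> Cocyc q" by (simp add: Cocyc_def)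
    then obtain cs where cs: "length cs = length ?b" "?F - fam.lin_comb cs ?b \<in> Cobd q"
      using basis_basic[of q] unfolding fam.basis_mod_def by blast
    have "F - fam.lin_comb (cs @ cs') (?b @ map ?i ?b') = (?F - fam.lin_comb cs ?b) + fder k"
      unfolding fam.lin_comb_append[OF cs(1)] lin_comb_map_ins by (simp add: algebra_simps)
    also have "\<dots> \<in> RCobd q" using cs(2) k(1) unfolding RCobd_def by blast
    finally show "\<exists>cs. length cs = length (?b @ map ?i ?b') \<and> F - fam.lin_comb cs (?b @ map ?i ?b') \<in> RCobd q"
      using cs(1) cs'(1) by (intro exI[of _ "cs @ cs'"]) simp
  next
    fix cs c
    assume *: "length cs = length (?b @ map ?i ?b') \<and> fam.lin_comb cs (?b @ map ?i ?b') \<in> RCobd q" and c: "c \<in> set cs"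
    let ?c1 = "take (length ?b) cs" and ?c2 = "drop (length ?b) cs"
    have len: "length ?c1 = length ?b" "length ?c2 = length ?b'" using * by auto
    have "fam.lin_comb cs (?b @ map ?i ?b') = fam.lin_comb ?c1 ?b + ?i (fam.lin_comb ?c2 ?b')"
      using fam.lin_comb_append[OF len(1), of ?c2 "map ?i ?b'"] by (simp only: append_take_drop_id lin_comb_map_ins)
    then obtain m k where mk: "m \<in> Cobd q" "k \<in> Coch q" "fam.lin_comb ?c1 ?b + ?i (fam.lin_comb ?c2 ?b') = m + fder k"
      using * unfolding RCobd_def by auto
    have c1: "cd (fam.lin_comb ?c1 ?b) = 0" using lcZ by (simp add: Cocyc_def)
    have "fder (fam.lin_comb ?c2 ?b') = cd (fam.lin_comb ?c1 ?b + ?i (fam.lin_comb ?c2 ?b'))"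
      by (simp only: cd_hom c1 cdi[OF lcZ'] add_0)
    also have "\<dots> = fder (cd k)"
      by (simp only: mk(3) cd_hom Cobd_cocycle[OF mk(1)] cd_fder[OF multilin_Coch[OF mk(2)]] add_0)
    finally have "fder (fam.lin_comb ?c2 ?b' - cd k) = 0" by (simp only: fder_hom diff_self)
    then have "fam.lin_comb ?c2 ?b' - cd k = 0"
      by (rule fder_eq_zero[OF fam.subspace_diff[OF subspace_Coch lcK' cd_Coch[OF mk(2)]]])
    then have c2: "fam.lin_comb ?c2 ?b' = cd k" by simp
    then have "fam.lin_comb ?c2 ?b' \<in> Cobd (Suc q)" using mk(2) by (simp add: Cobd_def)
    then have z2: "\<forall>c\<in>set ?c2. c = 0" using basis_basic[of "Suc q"] len(2) unfolding fam.basis_mod_def by blast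
    have lc0: "fam.lin_comb ds bs = 0" if "\<forall>c\<in>set ds. c = 0" for ds and bs :: "'a fam list"
      using that
    proof (induction bs arbitrary: ds)
      case (Cons b bs)
      show ?case
      proof (cases ds)
        case ds: (Cons d ds')
        then have "d = 0" "\<forall>c\<in>set ds'. c = 0" using Cons.prems by simp_all
        moreover from this have "fam.lin_comb ds' bs = 0" by (intro Cons.IH)
        ultimately
        show ?thesis by (simp only: ds fam.lin_comb_simps fscale_simps add_0)
      qed (simp only: fam.lin_comb_simps)
    qed (simp only: fam.lin_comb_simps)
    have cdk: "cd k = 0" using c2 lc0[OF z2] by simp
    have "fam.lin_comb ?c1 ?b = m + fder k" using mk(3) by (simp only: lc0[OF z2] ins_hom add_0_right)
    also have "fder k = cd (?i k)" using homotopy[OF multilin_Coch[OF mk(2)]] by (simp only: cdk ins_hom add_0_right)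
    also have "m + cd (?i k) \<in> Cobd q"
    proof (cases q)
      case 0
      have "?i k = 0" by (intro ext) (simp add: ins_def Coch_length[OF mk(2)] 0)
      then show ?thesis using mk(1) by (simp only: cd_hom add_0_right)
    next
      case (Suc p)
      then show ?thesis using mk(1) ins0_Coch[of k p] mk(2) by (intro Cobd_add) (auto simp: Cobd_def)
    qed
    finally have z1: "\<forall>c\<in>set ?c1. c = 0" using basis_basic[of q] len(1) unfolding fam.basis_mod_def by blast
    have "set cs = set ?c1 \<union> set ?c2" by (metis append_take_drop_id set_append)
    then show "c = 0" using c z1 z2 by blast
  qed
qed

section \<open>The basic and the reduced cohomology\<close>

definition cochain_of :: "nat \<Rightarrow> 'f::field_char_0 fam \<Rightarrow> ('f poly \<times> 'f poly, 'f poly \<times> 'f poly) cochain" where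
  "cochain_of q F = (THE f. realizes q f F)"

lemma realizes_cochain_of:
  assumes "F \<in> Coch q"
  shows "realizes q (cochain_of q F) F"
proof -
  obtain f where "realizes q f F" using Coch_realizes[OF assms] .
  then show ?thesis
    unfolding cochain_of_def using theI[of "\<lambda>f. realizes q f F" f] realizes_unique by blast
qed

lemma cochain_of_eq: "F \<in> Coch q \<Longrightarrow> realizes q f F \<Longrightarrow> cochain_of q F = f"
  using realizes_cochain_of realizes_unique by blast

lemma cochain_of_image: "cochain_of q ` Coch q = basic_cochains W_neg1 (adjoint W_neg1) q"
proof (intro equalityI subsetI)
  fix f assume "f \<in> cochain_of q ` (Coch q :: 'a fam set)"
  then obtain F where "F \<in> Coch q" "f = cochain_of q F" by blast
  then show "f \<in> basic_cochains W_neg1 (adjoint W_neg1) q"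
    using realizes_basic[OF realizes_cochain_of] multilin_Coch alternating_Coch by blast
next
  fix f :: "('a poly \<times> 'a poly, 'a poly \<times> 'a poly) cochain" assume f: "f \<in> basic_cochains W_neg1 (adjoint W_neg1) q"
  have K: "fam_of f \<in> Coch q"
    by (rule realizes_Coch[OF basic_realizes[OF f] multilin_fam_of[OF f] alternating_fam_of[OF f] fam_of_length[OF f]])
  show "f \<in> cochain_of q ` Coch q"
    by (rule image_eqI[where x = "fam_of f"]) (simp_all add: K cochain_of_eq[OF K basic_realizes[OF f]])
qed

lemma fam_of_cochain_of: "F \<in> Coch q \<Longrightarrow> fam_of (cochain_of q F) = F"
  by (rule realizes_fam_of[of q]) (auto intro: Coch_length realizes_cochain_of)

lemma cochain_of_inj: "F \<in> Coch q \<Longrightarrow> G \<in> Coch q \<Longrightarrow> cochain_of q F = cochain_of q G \<Longrightarrow> F = G"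
proof -
  assume *: "F \<in> Coch q" "G \<in> Coch q" "cochain_of q F = cochain_of q G"
  have "F = fam_of (cochain_of q F)" by (rule fam_of_cochain_of[OF *(1), symmetric])
  also have "\<dots> = G" unfolding *(3) by (rule fam_of_cochain_of[OF *(2)])
  finally show ?thesis .
qed

lemma presents_basic: "fam.presents (basic_space W_neg1 (adjoint W_neg1) q) (cochain_of q) (Coch q) {0}"
  unfolding fam.presents_def
proof (intro conjI ballI allI)
  show "fam.subspace (Coch q)" by (rule subspace_Coch)
  show "fam.subspace {0}" by (rule fam.subspace_single_0)
  show "{0} \<subseteq> Coch q" using zero_Coch by blast
  show "vcarrier (basic_space W_neg1 (adjoint W_neg1) q) = cochain_of q ` Coch q" by (simp add: basic_space_def cochain_of_image)
  show "vzero (basic_space W_neg1 (adjoint W_neg1) q) = cochain_of q 0"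
    unfolding basic_space_def by (simp, rule cochain_of_eq[OF zero_Coch, symmetric]) (simp add: realizes_def ev_comp_zero)
  fix F :: "'a fam" assume F: "F \<in> Coch q"
  note f = realizesD[OF realizes_cochain_of[OF F]]
  show "vscale (basic_space W_neg1 (adjoint W_neg1) q) c (cochain_of q F) = cochain_of q (fscale c F)" for c
    unfolding basic_space_def adjoint_W_simps
    by (simp, rule cochain_of_eq[OF Coch_fscale[OF F], symmetric])
      (simp add: realizes_def ev_comp_pscale ev_const f pscale_zero_right[OF W_vector_space])
  fix G :: "'a fam" assume G: "G \<in> Coch q"
  note g = realizesD[OF realizes_cochain_of[OF G]]
  show "vadd (basic_space W_neg1 (adjoint W_neg1) q) (cochain_of q F) (cochain_of q G) = cochain_of q (F + G)"
    unfolding basic_space_def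
    by (simp, rule cochain_of_eq[OF Coch_add[OF F G], symmetric]) (simp add: realizes_def ev_comp_add f g)
  show "cochain_of q F = cochain_of q G \<longleftrightarrow> F - G \<in> {0}" using cochain_of_inj[OF F G] by auto
qed

lemma diff_cochain_of: "F \<in> Coch q \<Longrightarrow> diff W_neg1 (adjoint W_neg1) (cochain_of q F) = cochain_of (Suc q) (cd F)"
  by (rule cochain_of_eq[OF cd_Coch realizes_diff[OF realizes_cochain_of multilin_Coch alternating_Coch Coch_length], symmetric])

lemma der_cochain_of: "F \<in> Coch q \<Longrightarrow> cochain_der (adjoint W_neg1) (cochain_of q F) = cochain_of q (fder F)"
  by (rule cochain_of_eq[OF fder_Coch realizes_cochain_der[OF realizes_cochain_of], symmetric])

lemma vzero_basic: "vzero (basic_space W_neg1 (adjoint W_neg1) q) = cochain_of q 0"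
  and vcarrier_basic: "vcarrier (basic_space W_neg1 (adjoint W_neg1) q) = cochain_of q ` Coch q"
  using fam.presents_vzero[OF presents_basic] fam.presents_vcarrier[OF presents_basic] .

lemma presents_basic_cohomology:
  "fam.presents (basic_cohomology W_neg1 (adjoint W_neg1) q)
     (\<lambda>F. vcoset ((basic_space W_neg1 (adjoint W_neg1) q)\<lparr>vcarrier := cochain_of q ` Cocyc q\<rparr>) (cochain_of q ` Cobd q) (cochain_of q F))
     (Cocyc q) (Cobd q :: 'f::field_char_0 fam set)"
proof -
  have "cocycles (basic_space W_neg1 (adjoint W_neg1)) (\<lambda>q. diff W_neg1 (adjoint W_neg1)) q = cochain_of q ` (Cocyc q :: 'f fam set)"
  proof -
    have *: "diff W_neg1 (adjoint W_neg1) (cochain_of q F) = cochain_of (Suc q) 0 \<longleftrightarrow> cd F = 0" if "F \<in> Coch q" for F :: "'f fam"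
      unfolding diff_cochain_of[OF that] using cochain_of_inj[OF cd_Coch[OF that] zero_Coch] by auto
    show ?thesis
      unfolding cocycles_def Cocyc_def vcarrier_basic vzero_basic by (auto simp: *)
  qed
  moreover have "coboundaries (basic_space W_neg1 (adjoint W_neg1)) (\<lambda>q. diff W_neg1 (adjoint W_neg1)) q = cochain_of q ` (Cobd q :: 'f fam set)"
  proof (cases q)
    case 0
    then show ?thesis by (simp add: coboundaries_def Cobd_def vzero_basic)
  next
    case (Suc p)
    then show ?thesis by (auto simp: coboundaries_def Cobd_def vcarrier_basic image_image diff_cochain_of intro!: image_cong)
  qed
  moreover have "fam.presents ((basic_space W_neg1 (adjoint W_neg1) q)\<lparr>vcarrier := cochain_of q ` Cocyc q\<rparr>) (cochain_of q) (Cocyc q) ({0} :: 'f fam set)"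
    using fam.subspace_0[OF subspace_Cocyc]
    by (intro fam.presents_restrict[OF presents_basic subspace_Cocyc]) (auto simp: Cocyc_def)
  moreover have "{0} \<subseteq> (Cobd q :: 'f fam set)" using zero_Cobd by blast
  ultimately show ?thesis
    unfolding basic_cohomology_def cohomology_def
    using fam.presents_vquot[OF _ subspace_Cobd _ Cobd_Cocyc] by (simp only:)
qed

definition red_class :: "nat \<Rightarrow> 'f::field_char_0 fam \<Rightarrow> ('f poly \<times> 'f poly, 'f poly \<times> 'f poly) cochain set" where
  "red_class q F = vcoset (basic_space W_neg1 (adjoint W_neg1) q) (cochain_of q ` fder ` Coch q) (cochain_of q F)"

lemma der_image: "cochain_der (adjoint W_neg1) ` basic_cochains W_neg1 (adjoint W_neg1) q = cochain_of q ` fder ` Coch q"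
  unfolding cochain_of_image[symmetric] image_image by (intro image_cong refl der_cochain_of)

lemma presents_reduced: "fam.presents (reduced_space W_neg1 (adjoint W_neg1) q) (red_class q) (Coch q) (fder ` Coch q)"
proof -
  have "{0} \<subseteq> fder ` (Coch q :: 'a fam set)" using fam.subspace_0[OF subspace_fder, of q] by blast
  moreover have "fder ` Coch q \<subseteq> (Coch q :: 'a fam set)" using fder_Coch by blast
  ultimately have "fam.presents (vquot (basic_space W_neg1 (adjoint W_neg1) q) (cochain_of q ` fder ` (Coch q :: 'a fam set)))
      (\<lambda>F. vcoset (basic_space W_neg1 (adjoint W_neg1) q) (cochain_of q ` fder ` Coch q) (cochain_of q F)) (Coch q) (fder ` Coch q)"
    by (intro fam.presents_vquot[OF presents_basic subspace_fder])
  then show ?thesis unfolding reduced_space_def der_image red_class_def[abs_def] .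
qed

lemma vzero_reduced: "vzero (reduced_space W_neg1 (adjoint W_neg1) q) = red_class q 0"
  and vcarrier_reduced: "vcarrier (reduced_space W_neg1 (adjoint W_neg1) q) = red_class q ` Coch q"
  using fam.presents_vzero[OF presents_reduced] fam.presents_vcarrier[OF presents_reduced] .

lemma red_class_eq: "F \<in> Coch q \<Longrightarrow> G \<in> Coch q \<Longrightarrow> red_class q F = red_class q G \<longleftrightarrow> F - G \<in> fder ` Coch q"
  using presents_reduced[of q] unfolding fam.presents_def by blast

lemma red_class_members: "F \<in> Coch q \<Longrightarrow> red_class q F = {cochain_of q (F + fder G) | G. G \<in> Coch q}"
proof -
  assume F: "F \<in> Coch q"
  have "vadd (basic_space W_neg1 (adjoint W_neg1) q) (cochain_of q F) (cochain_of q (fder G)) = cochain_of q (F + fder G)" if "G \<in> Coch q" for G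
    using presents_basic[of q] F fder_Coch[OF that] unfolding fam.presents_def by blast
  then show ?thesis unfolding red_class_def vcoset_def by (auto simp: image_iff)
qed

text \<open>Changing the representative by \<open>\<partial>G\<close> changes the differential by \<open>\<partial>(d G)\<close>, so the union over all
  representatives is a single class.\<close>

lemma reduced_diff_red_class:
  assumes "F \<in> Coch q"
  shows "reduced_diff W_neg1 (adjoint W_neg1) q (red_class q F) = red_class (Suc q) (cd F)"
proof -
  have *: "red_class (Suc q) (cd (F + fder G)) = red_class (Suc q) (cd F)" if "G \<in> Coch q" for G
  proof -
    have "cd (F + fder G) - cd F = fder (cd G)" by (simp add: cd_hom cd_fder[OF multilin_Coch[OF that]])
    then show ?thesis
      using red_class_eq[of "cd (F + fder G)" "Suc q" "cd F"] cd_Coch[OF assms] cd_Coch[OF that] cd_Coch[OF Coch_add[OF assms fder_Coch[OF that]]] by auto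
  qed
  have "reduced_diff W_neg1 (adjoint W_neg1) q (red_class q F) = (\<Union>G\<in>Coch q. red_class (Suc q) (cd (F + fder G)))"
  proof -
    have "vcoset (basic_space W_neg1 (adjoint W_neg1) (Suc q)) (cochain_of (Suc q) ` fder ` Coch (Suc q)) (diff W_neg1 (adjoint W_neg1) (cochain_of q (F + fder G)))
        = red_class (Suc q) (cd (F + fder G))" if "G \<in> Coch q" for G
      by (simp only: red_class_def diff_cochain_of[OF Coch_add[OF assms fder_Coch[OF that]]])
    moreover have "red_class q F = (\<lambda>G. cochain_of q (F + fder G)) ` Coch q" using red_class_members[OF assms] by auto
    ultimately show ?thesis
      unfolding reduced_diff_def der_image by auto
  qed
  also have "\<dots> = red_class (Suc q) (cd F)" using * zero_Coch by auto
  finally show ?thesis .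
qed

lemma presents_reduced_cohomology:
  "fam.presents (reduced_cohomology W_neg1 (adjoint W_neg1) q)
     (\<lambda>F. vcoset ((reduced_space W_neg1 (adjoint W_neg1) q)\<lparr>vcarrier := red_class q ` RCocyc q\<rparr>) (red_class q ` RCobd q) (red_class q F))
     (RCocyc q) (RCobd q :: 'f::field_char_0 fam set)"
proof -
  have "cocycles (reduced_space W_neg1 (adjoint W_neg1)) (reduced_diff W_neg1 (adjoint W_neg1)) q = red_class q ` (RCocyc q :: 'f fam set)"
  proof -
    have *: "reduced_diff W_neg1 (adjoint W_neg1) q (red_class q F) = red_class (Suc q) 0 \<longleftrightarrow> cd F \<in> fder ` Coch (Suc q)"
      if "F \<in> Coch q" for F :: "'f fam"
      unfolding reduced_diff_red_class[OF that] using red_class_eq[OF cd_Coch[OF that] zero_Coch] by simp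
    show ?thesis
      unfolding cocycles_def RCocyc_def vcarrier_reduced vzero_reduced using * by blast
  qed
  moreover have "coboundaries (reduced_space W_neg1 (adjoint W_neg1)) (reduced_diff W_neg1 (adjoint W_neg1)) q = red_class q ` (RCobd q :: 'f fam set)"
  proof -
    have red_class: "red_class q (F + G) = red_class q F" if "F \<in> Cobd q" "G \<in> fder ` Coch q" for F G :: "'f fam"
    proof -
      have K: "F \<in> Coch q" "G \<in> Coch q" using that Cobd_Coch fder_Coch by auto
      have "(F + G) - F \<in> fder ` Coch q" using that(2) by simp
      then show ?thesis using red_class_eq[OF Coch_add[OF K] K(1)] by blast
    qed
    have "red_class q ` RCobd q = red_class q ` (Cobd q :: 'f fam set)"
    proof (intro equalityI subsetI)
      fix X assume "X \<in> red_class q ` (RCobd q :: 'f fam set)"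
      then show "X \<in> red_class q ` Cobd q" using red_class unfolding RCobd_def by blast
    next
      fix X assume "X \<in> red_class q ` (Cobd q :: 'f fam set)"
      then obtain F where F: "F \<in> Cobd q" "X = red_class q (F + 0)" by auto
      then have "F + 0 \<in> RCobd q" using fam.subspace_0[OF subspace_fder, of q] unfolding RCobd_def by blast
      then show "X \<in> red_class q ` RCobd q" using F(2) by blast
    qed
    moreover have "coboundaries (reduced_space W_neg1 (adjoint W_neg1)) (reduced_diff W_neg1 (adjoint W_neg1)) q = red_class q ` (Cobd q :: 'f fam set)"
    proof (cases q)
      case 0
      then show ?thesis by (simp add: coboundaries_def Cobd_def vzero_reduced)
    next
      case (Suc p)
      then show ?thesis
        by (auto simp: coboundaries_def Cobd_def vcarrier_reduced image_image reduced_diff_red_class intro!: image_cong)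
    qed
    ultimately show ?thesis by (simp only:)
  qed
  moreover have "fam.presents ((reduced_space W_neg1 (adjoint W_neg1) q)\<lparr>vcarrier := red_class q ` RCocyc q\<rparr>) (red_class q) (RCocyc q) (fder ` Coch q :: 'f fam set)"
    using fder_RCobd[of q] RCobd_RCocyc[of q]
    by (intro fam.presents_restrict[OF presents_reduced subspace_RCocyc]) (auto simp: RCocyc_def)
  ultimately show ?thesis
    unfolding reduced_cohomology_def cohomology_def
    using fam.presents_vquot[OF _ subspace_RCobd fder_RCobd RCobd_RCocyc] by (simp only:)
qed

theorem theorem4p7:
  fixes q :: nat
  shows "has_dim
           (basic_cohomology
             (W_neg1 :: ('f::field_char_0, 'f poly \<times> 'f poly) lca) (adjoint W_neg1) q)
           (if q = 2 \<or> q = 4 then 1 else if q = 3 then 2 else 0)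
       \<and> has_dim
           (reduced_cohomology
             (W_neg1 :: ('f::field_char_0, 'f poly \<times> 'f poly) lca) (adjoint W_neg1) q)
           (if q = 1 \<or> q = 4 then 1 else if q = 2 \<or> q = 3 then 3 else 0)"
proof
  have "length (reps q :: 'f fam list) = (if q = 2 \<or> q = 4 then 1 else if q = 3 then 2 else 0)"
    by (simp add: reps_def)
  then show "has_dim (basic_cohomology (W_neg1 :: ('f, 'f poly \<times> 'f poly) lca) (adjoint W_neg1) q)
     (if q = 2 \<or> q = 4 then 1 else if q = 3 then 2 else 0)"
    using fam.presents_has_dim[OF presents_basic_cohomology basis_basic[of q, where 'a = 'f]] by (simp only:)
  have "length (reps q @ map (ins (1, 0, 0)) (reps (Suc q)) :: 'f fam list) = (if q = 1 \<or> q = 4 then 1 else if q = 2 \<or> q = 3 then 3 else 0)"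
    by (simp add: reps_def)
  then show "has_dim (reduced_cohomology (W_neg1 :: ('f, 'f poly \<times> 'f poly) lca) (adjoint W_neg1) q)
     (if q = 1 \<or> q = 4 then 1 else if q = 2 \<or> q = 3 then 3 else 0)"
    using fam.presents_has_dim[OF presents_reduced_cohomology basis_reduced[of q, where 'a = 'f]] by (simp only:)
qed

end
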